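(* Let $S$ be a cancellative and right amenable monoid, $K$ a compact (Hausdorff) Abelian group with a right $S$-action $\rho$ by continuous endomorphisms, and $X$ a discrete Abelian group with a left $S$-action $\lambda$ by endomorphisms. Then: (1) $h_{\mathrm{top}}(\rho)=h_{\mathrm{alg}}(\rho^\wedge)$; (2) $h_{\mathrm{alg}}(\lambda)=h_{\mathrm{top}}(\lambda^\wedge)$.
   Context: A cancellative monoid $S$ is right amenable if it admits a right F{\o}lner net, i.e. a net $\{F_i\}_{i\in I}$ of non-empty finite subsets of $S$ such that $\lim_{i\in I}|F_is\setminus F_i|/|F_i|=0$ for every $s\in S$. A right $S$-action $\rho$ on a compact Abelian group $K$: continuous endomorphisms $\rho_s$ with $\rho_1=\mathrm{id}$, $\rho_{st}=\rho_t\circ\rho_s$. A left $S$-action $\lambda$ on an Abelian group $X$: endomorphisms $\lambda_s$ with $\lambda_1=\mathrm{id}$, $\lambda_{st}=\lambda_s\circ\lambda_t$. Duality: for a locally compact Abelian group $\Gamma$, $\Gamma^\wedge$ is its Pontryagin dual (continuous homomorphisms to $\mathbb T=\mathbb R/\mathbb Z$, with the compact-open topology), and $\phi^\wedge(\chi)=\chi\circ\phi$ for a continuous homomorphism $\phi$. The dual $\rho^\wedge$ is the left $S$-action on the discrete group $K^\wedge$ given by $(\rho^\wedge)_s=(\rho_s)^\wedge$; the dual $\lambda^\wedge$ is the right $S$-action on the compact group $X^\wedge$ given by $(\lambda^\wedge)_s=(\lambda_s)^\wedge$. Topological entropy: for an open cover $\mathcal U$ of $K$ let $N(\mathcal U)$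 be the minimal cardinality of a subcover; $\mathcal U\vee\mathcal V=\{U\cap V:U\in\mathcal U,V\in\mathcal V\}$; $\mathcal U_{\rho,F}=\bigvee_{s\in F}\rho_s^{-1}(\mathcal U)$ for non-empty finite $F\subseteq S$. For a right F{\o}lner net $\{F_i\}_{i\in I}$ of $S$, $H_{\mathrm{top}}(\rho,\mathcal U)=\lim_{i}\frac{\log N(\mathcal U_{\rho,F_i})}{|F_i|}$ and $h_{\mathrm{top}}(\rho)=\sup_{\mathcal U}H_{\mathrm{top}}(\rho,\mathcal U)\in[0,\infty]$, over all open covers. Algebraic entropy: for a finite subset $E\subseteq X$ containing $0$ and a non-empty finite $F\subseteq S$ let $T_F(\lambda,E)=\sum_{s\in F}\lambda_s(E)$ (sum of subsets of $X$). Then $H_{\mathrm{alg}}(\lambda,E)=\lim_i\frac{\log|T_{F_i}(\lambda,E)|}{|F_i|}$ and $h_{\mathrm{alg}}(\lambda)=\sup_E H_{\mathrm{alg}}(\lambda,E)\in[0,\infty]$, over all finite $E\subseteq X$ with $0\in E$. All these limits exist and do not depend on the choice of the right F{\o}lner net. *)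

theory Defs
  imports "HOL-Analysis.Analysis" "HOL-Library.Set_Algebras"
begin

section \<open>The circle group R/Z\<close>

quotient_type circle = real / "\<lambda>x y. x - y \<in> \<int>"
  morphisms rep_circle to_circle
proof (rule equivpI)
  show "reflp (\<lambda>x y::real. x - y \<in> \<int>)"
    by (simp add: reflp_def)
  show "symp (\<lambda>x y::real. x - y \<in> \<int>)"
    by (metis (no_types, lifting) Ints_minus minus_diff_eq sympI)
  show "transp (\<lambda>x y::real. x - y \<in> \<int>)"
  proof (rule transpI)
    fix x y z :: real
    assume "x - y \<in> \<int>" "y - z \<in> \<int>"
    then have "(x - y) + (y - z) \<in> \<int>" by (rule Ints_add)
    then show "x - z \<in> \<int>" by simp
  qed
qed

lemma to_circle_eq_iff: "to_circle x = to_circle y \<longleftrightarrow> x - y \<in> \<int>"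
  using Quotient3_rel[OF Quotient3_circle, of x y] by auto

lemma to_circle_surj: "\<exists>x. a = to_circle x"
  using Quotient3_abs_rep[OF Quotient3_circle, of a] by metis

instantiation circle :: ab_group_add
begin

lift_definition zero_circle :: circle is 0 .

lift_definition plus_circle :: "circle \<Rightarrow> circle \<Rightarrow> circle" is "(+)"
proof -
  fix a b c d :: real
  assume "a - b \<in> \<int>" "c - d \<in> \<int>"
  then have "(a - b) + (c - d) \<in> \<int>" by (rule Ints_add)
  then show "(a + c) - (b + d) \<in> \<int>" by (simp add: algebra_simps)
qed

lift_definition uminus_circle :: "circle \<Rightarrow> circle" is uminus
proof -
  fix a b :: real
  assume "a - b \<in> \<int>"
  then have "- (a - b) \<in> \<int>" by (simp only: Ints_minus)
  then show "- a - - b \<in> \<int>" by simp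
qed

definition minus_circle :: "circle \<Rightarrow> circle \<Rightarrow> circle" where
  "a - b = a + - (b :: circle)"

instance
proof
  fix a b c :: circle
  show "a + b + c = a + (b + c)" by transfer (simp add: algebra_simps)
  show "a + b = b + a" by transfer (simp add: algebra_simps)
  show "0 + a = a" by transfer simp
  show "- a + a = 0" by transfer simp
  show "a - b = a + - b" by (simp add: minus_circle_def)
qed

end

lemma to_circle_add: "to_circle (x + y) = to_circle x + to_circle y"
  by (simp add: plus_circle.abs_eq)

lemma to_circle_uminus: "to_circle (- x) = - to_circle x"
  by (simp add: uminus_circle.abs_eq)

text \<open>The quotient topology.\<close>

instantiation circle :: topological_space
begin

definition open_circle :: "circle set \<Rightarrow> bool" where
  "open_circle U \<longleftrightarrow> open (to_circle -` U)"

instance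
proof
  show "open (UNIV :: circle set)" by (simp add: open_circle_def)
  fix A B :: "circle set"
  assume "open A" "open B"
  then show "open (A \<inter> B)" by (simp add: open_circle_def vimage_Int open_Int)
next
  fix K :: "circle set set"
  assume "\<forall>A\<in>K. open A"
  then show "open (\<Union>K)" by (auto simp: open_circle_def vimage_Union)
qed

end

lemma open_to_circle_image:
  assumes "open A" shows "open (to_circle ` A)"
proof -
  have "to_circle -` to_circle ` A = (\<Union>n\<in>\<int>. (+) n ` A)"
  proof (intro equalityI subsetI)
    fix x assume "x \<in> to_circle -` to_circle ` A"
    then obtain y where y: "y \<in> A" "x - y \<in> \<int>" by (auto simp: to_circle_eq_iff)
    then have "x \<in> (+) (x - y) ` A" by force
    with y show "x \<in> (\<Union>n\<in>\<int>. (+) n ` A)" by blast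
  next
    fix x assume "x \<in> (\<Union>n\<in>\<int>. (+) n ` A)"
    then obtain n y where y: "n \<in> \<int>" "y \<in> A" "x = n + y" by auto
    then have "to_circle x = to_circle y" by (simp add: to_circle_eq_iff)
    with y show "x \<in> to_circle -` to_circle ` A" by auto
  qed
  moreover have "open (\<Union>n\<in>\<int>. (+) n ` A)"
    using assms by (intro open_UN ballI open_translation)
  ultimately show ?thesis by (simp add: open_circle_def)
qed

instance circle :: topological_ab_group_add
proof
  fix a b :: circle
  obtain x y where xy: "a = to_circle x" "b = to_circle y" using to_circle_surj by metis
  show "LIM z (nhds a \<times>\<^sub>F nhds b). fst z + snd z :> nhds (a + b)"
    unfolding filterlim_iff
  proof (intro allI impI)
    fix P assume "eventually P (nhds (a + b))"
    then obtain W where W: "open W" "a + b \<in> W" "\<And>w. w \<in> W \<Longrightarrow> P w"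
      by (auto simp: eventually_nhds)
    have "open (to_circle -` W)" "x + y \<in> to_circle -` W"
      using W xy by (auto simp: open_circle_def to_circle_add)
    then have "eventually (\<lambda>v. v \<in> to_circle -` W) (nhds (x + y))"
      by (rule eventually_nhds_in_open)
    then have "eventually (\<lambda>z. fst z + snd z \<in> to_circle -` W) (nhds x \<times>\<^sub>F nhds y)"
      using tendsto_add_Pair[of x y] by (auto simp: filterlim_iff)
    then obtain P1 P2 where P12: "eventually P1 (nhds x)" "eventually P2 (nhds y)"
      "\<And>u v. P1 u \<Longrightarrow> P2 v \<Longrightarrow> u + v \<in> to_circle -` W"
      by (auto simp: eventually_prod_filter)
    obtain A B where A: "open A" "x \<in> A" "\<And>u. u \<in> A \<Longrightarrow> P1 u"
      and B: "open B" "y \<in> B" "\<And>u. u \<in> B \<Longrightarrow> P2 u"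
      using P12(1,2) by (auto simp: eventually_nhds)
    have "eventually (\<lambda>u. u \<in> to_circle ` A) (nhds a)"
      using A xy by (intro eventually_nhds_in_open open_to_circle_image) auto
    moreover have "eventually (\<lambda>u. u \<in> to_circle ` B) (nhds b)"
      using B xy by (intro eventually_nhds_in_open open_to_circle_image) auto
    moreover have "P (u + v)" if "u \<in> to_circle ` A" "v \<in> to_circle ` B" for u v
      using that P12(3) A(3) B(3) W(3) by (force simp: to_circle_add)
    ultimately show "eventually (\<lambda>z. P (fst z + snd z)) (nhds a \<times>\<^sub>F nhds b)"
      by (force simp: eventually_prod_filter)
  qed
next
  fix a :: circle
  have "open (uminus -` U)" if "open U" for U :: "circle set"
  proof -
    have "to_circle -` uminus -` U = uminus -` to_circle -` U"
      by (auto simp: to_circle_uminus)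
    moreover have "open (uminus -` (to_circle -` U))"
      using that
      by (intro open_vimage[of "to_circle -` U"]) (auto simp: open_circle_def intro: continuous_intros)
    ultimately show ?thesis by (simp add: open_circle_def)
  qed
  then show "(uminus \<longlongrightarrow> - a) (nhds a)"
    by (intro topological_tendstoI) (use eventually_nhds_in_open in fastforce)
qed

section \<open>Pontryagin duality\<close>

typedef (overloaded) 'g dual =
  "{\<xi> :: 'g::topological_ab_group_add \<Rightarrow> circle. Modules.additive \<xi> \<and> continuous_on UNIV \<xi>}"
  morphisms character Abs_dual
  by (rule exI[of _ "\<lambda>_. 0"]) (simp add: Modules.additive_def)

setup_lifting type_definition_dual

instantiation dual :: (topological_ab_group_add) ab_group_add
begin

lift_definition zero_dual :: "'a dual" is "\<lambda>_. 0"
  by (simp add: Modules.additive_def)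

lift_definition plus_dual :: "'a dual \<Rightarrow> 'a dual \<Rightarrow> 'a dual" is "\<lambda>\<xi> \<psi> x. \<xi> x + \<psi> x"
  by (auto simp: Modules.additive_def algebra_simps intro: continuous_on_add)

lift_definition uminus_dual :: "'a dual \<Rightarrow> 'a dual" is "\<lambda>\<xi> x. - \<xi> x"
  by (auto simp: Modules.additive_def algebra_simps intro: continuous_on_minus)

lift_definition minus_dual :: "'a dual \<Rightarrow> 'a dual \<Rightarrow> 'a dual" is "\<lambda>\<xi> \<psi> x. \<xi> x - \<psi> x"
  by (auto simp: Modules.additive_def algebra_simps intro: continuous_on_diff)

instance
  by standard (transfer; simp add: algebra_simps)+

end

text \<open>The compact-open topology.\<close>

instantiation dual :: (topological_ab_group_add) topological_space
begin

definition open_dual :: "'a dual set \<Rightarrow> bool" where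
  "open_dual = generate_topology
     {{\<xi>. character \<xi> ` C \<subseteq> U} | C U. compact C \<and> open U}"

instance
proof -
  have "class.topological_space
      (generate_topology {{\<xi> :: 'a dual. character \<xi> ` C \<subseteq> U} | C U. compact C \<and> open U})"
    by (rule topological_space_generate_topology)
  then show "OFCLASS('a dual, topological_space_class)"
    by (intro_classes) (auto simp: open_dual_def class.topological_space_def)
qed

end

text \<open>Meaningful only when \<open>\<phi>\<close> is a continuous homomorphism; see \<open>character_dual_map\<close>.\<close>

definition dual_map ::
    "('g::topological_ab_group_add \<Rightarrow> 'h::topological_ab_group_add) \<Rightarrow> 'h dual \<Rightarrow> 'g dual" where
  "dual_map \<phi> \<xi> = Abs_dual (character \<xi> \<circ> \<phi>)"

lemma character_dual_map:
  assumes "Modules.additive \<phi>" "continuous_on UNIV \<phi>"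
  shows "character (dual_map \<phi> \<xi>) = character \<xi> \<circ> \<phi>"
proof -
  have "Modules.additive (character \<xi>)" "continuous_on UNIV (character \<xi>)"
    using character[of \<xi>] by auto
  then have "Modules.additive (character \<xi> \<circ> \<phi>)" "continuous_on UNIV (character \<xi> \<circ> \<phi>)"
    using assms by (auto simp only: Modules.additive_def o_apply intro!: continuous_on_compose intro: continuous_on_subset)
  then show ?thesis
    unfolding dual_map_def by (subst Abs_dual_inverse) auto
qed

section \<open>Actions of a monoid\<close>

definition right_action ::
    "('s::monoid_mult \<Rightarrow> 'k::topological_ab_group_add \<Rightarrow> 'k) \<Rightarrow> bool" where
  "right_action \<rho> \<longleftrightarrow>
     (\<forall>s. Modules.additive (\<rho> s) \<and> continuous_on UNIV (\<rho> s)) \<and>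
     \<rho> 1 = id \<and> (\<forall>s t. \<rho> (s * t) = \<rho> t \<circ> \<rho> s)"

definition left_action :: "('s::monoid_mult \<Rightarrow> 'x::ab_group_add \<Rightarrow> 'x) \<Rightarrow> bool" where
  "left_action l \<longleftrightarrow>
     (\<forall>s. Modules.additive (l s)) \<and> l 1 = id \<and> (\<forall>s t. l (s * t) = l s \<circ> l t)"

definition dual_action ::
    "('s \<Rightarrow> 'g::topological_ab_group_add \<Rightarrow> 'g) \<Rightarrow> 's \<Rightarrow> 'g dual \<Rightarrow> 'g dual" where
  "dual_action \<alpha> s = dual_map (\<alpha> s)"

lemma left_action_dual_action:
  assumes "right_action \<rho>" shows "left_action (dual_action \<rho>)"
proof -
  have ch: "character (dual_action \<rho> s \<xi>) = character \<xi> \<circ> \<rho> s" for s \<xi>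
    using assms by (simp add: dual_action_def character_dual_map right_action_def)
  show ?thesis
    unfolding left_action_def Modules.additive_def
    using assms
    by (auto simp: fun_eq_iff character_inject[symmetric] ch plus_dual.rep_eq right_action_def)
qed

section \<open>Amenability\<close>

text \<open>Nets are families indexed along a proper filter, as usual in the library.\<close>

definition right_folner_net :: "'i filter \<Rightarrow> ('i \<Rightarrow> 's::monoid_mult set) \<Rightarrow> bool" where
  "right_folner_net I F \<longleftrightarrow>
     I \<noteq> bot \<and> (\<forall>i. finite (F i) \<and> F i \<noteq> {}) \<and>
     (\<forall>s. ((\<lambda>i. real (card ((\<lambda>x. x * s) ` F i - F i)) / real (card (F i))) \<longlongrightarrow> 0) I)"

text \<open>
  The index type \<open>'s set\<close> in the definitions below is no restriction: every net of non-empty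
  finite subsets can be replaced by one with this index type, with the same limits of all
  functions of the subsets.
\<close>

lemma right_folner_net_reindex:
  fixes F :: "'i \<Rightarrow> 's::monoid_mult set"
  assumes "right_folner_net I F"
  obtains J :: "'s set filter" and G :: "'s set \<Rightarrow> 's set" where "right_folner_net J G"
    and "\<And>(f :: 's set \<Rightarrow> real) h. ((\<lambda>j. f (G j)) \<longlongrightarrow> h) J \<longleftrightarrow> ((\<lambda>i. f (F i)) \<longlongrightarrow> h) I"
proof
  let ?G = "\<lambda>A :: 's set. if finite A \<and> A \<noteq> {} then A else {1}"
  have G: "?G (F i) = F i" for i
    using assms by (auto simp: right_folner_net_def)
  show lim: "((\<lambda>j. f (?G j)) \<longlongrightarrow> h) (filtermap F I) \<longleftrightarrow> ((\<lambda>i. f (F i)) \<longlongrightarrow> h) I"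
    for f :: "'s set \<Rightarrow> real" and h
    by (simp only: filterlim_filtermap G)
  show "right_folner_net (filtermap F I) ?G"
    unfolding right_folner_net_def
  proof (intro conjI allI)
    fix s :: 's
    show "((\<lambda>i. real (card ((\<lambda>x. x * s) ` ?G i - ?G i)) / real (card (?G i))) \<longlongrightarrow> 0)
        (filtermap F I)"
      using assms
        lim[of "\<lambda>A. real (card ((\<lambda>x. x * s) ` A - A)) / real (card A)" 0]
      by (simp add: right_folner_net_def)
  qed (use assms in \<open>auto simp: right_folner_net_def filtermap_bot_iff\<close>)
qed

definition right_amenable :: "'s::monoid_mult itself \<Rightarrow> bool" where
  "right_amenable _ \<longleftrightarrow> (\<exists>(I :: 's set filter) (F :: 's set \<Rightarrow> 's set). right_folner_net I F)"

text \<open>The common limit of \<open>f (F i) / card (F i)\<close> along all right Folner nets \<open>F\<close>.\<close>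

definition folner_lim :: "('s::monoid_mult set \<Rightarrow> real) \<Rightarrow> real" where
  "folner_lim f = (THE h. \<forall>(I :: 's set filter) F. right_folner_net I F \<longrightarrow>
     ((\<lambda>i. f (F i) / real (card (F i))) \<longlongrightarrow> h) I)"

section \<open>Topological entropy\<close>

definition open_cover :: "'k::topological_space set set \<Rightarrow> bool" where
  "open_cover \<U> \<longleftrightarrow> (\<forall>U\<in>\<U>. open U) \<and> \<Union>\<U> = UNIV"

definition cover_number :: "'k set set \<Rightarrow> nat" where
  "cover_number \<U> = Inf {card \<V> | \<V>. \<V> \<subseteq> \<U> \<and> finite \<V> \<and> \<Union>\<V> = UNIV}"

definition cover_join :: "'s set \<Rightarrow> ('s \<Rightarrow> 'k set set) \<Rightarrow> 'k set set" where
  "cover_join F \<U> = {\<Inter>s\<in>F. V s | V. \<forall>s\<in>F. V s \<in> \<U> s}"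

definition cover_refine :: "('s \<Rightarrow> 'k \<Rightarrow> 'k) \<Rightarrow> 's set \<Rightarrow> 'k set set \<Rightarrow> 'k set set" where
  "cover_refine \<rho> F \<U> = cover_join F (\<lambda>s. (\<lambda>U. \<rho> s -` U) ` \<U>)"

definition H_top :: "('s::monoid_mult \<Rightarrow> 'k \<Rightarrow> 'k) \<Rightarrow> 'k set set \<Rightarrow> real" where
  "H_top \<rho> \<U> = folner_lim (\<lambda>F. ln (real (cover_number (cover_refine \<rho> F \<U>))))"

definition h_top :: "('s::monoid_mult \<Rightarrow> 'k::topological_space \<Rightarrow> 'k) \<Rightarrow> ereal" where
  "h_top \<rho> = (SUP \<U>\<in>{\<U>. open_cover \<U>}. ereal (H_top \<rho> \<U>))"

section \<open>Algebraic entropy\<close>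

text \<open>The sum of subsets is the pointwise one of \<open>Set_Algebras\<close>.\<close>

definition trajectory :: "('s \<Rightarrow> 'x::ab_group_add \<Rightarrow> 'x) \<Rightarrow> 's set \<Rightarrow> 'x set \<Rightarrow> 'x set" where
  "trajectory l F E = (\<Sum>s\<in>F. l s ` E)"

definition H_alg :: "('s::monoid_mult \<Rightarrow> 'x::ab_group_add \<Rightarrow> 'x) \<Rightarrow> 'x set \<Rightarrow> real" where
  "H_alg l E = folner_lim (\<lambda>F. ln (real (card (trajectory l F E))))"

definition h_alg :: "('s::monoid_mult \<Rightarrow> 'x::ab_group_add \<Rightarrow> 'x) \<Rightarrow> ereal" where
  "h_alg l = (SUP E\<in>{E. finite E \<and> 0 \<in> E}. ereal (H_alg l E))"

end

theory Submission
  imports Defs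
begin

text \<open>
  Both parts are the equality of the two entropies for a pairing \<open>X \<times> K \<rightarrow> T\<close> of a discrete and a
  compact group that separates points on both sides.

  If \<open>N\<close> pieces of \<open>K\<close> are so small that every \<open>\<langle>\<lambda>\<^sub>s x, \<cdot>\<rangle>\<close> with \<open>s \<in> F\<close>, \<open>x \<in> E\<close> is almost constant on
  each piece, then on a piece a character \<open>\<Sum>\<^sub>s \<lambda>\<^sub>s x\<^sub>s\<close> of the trajectory is a constant times
  \<open>\<Prod>\<^sub>s (1 + z\<^sub>s)\<close> with small \<open>z\<^sub>s\<close>, and expanding the product up to degree \<open>\<delta>|F|\<close> puts all these
  characters close to a space of dimension \<open>N e\<^sup>o\<^sup>(\<^sup>|\<^sup>F\<^sup>|\<^sup>)\<close>. Distinct characters are orthogonal, so the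
  trajectory is no larger. Conversely, take a maximal set of points any two of which are separated
  in more than \<open>\<delta>|F|\<close> of the coordinates \<open>s \<in> F\<close>. Translates of a product of high powers of
  \<open>(1 + \<langle>\<lambda>\<^sub>s x, \<cdot>\<rangle>) / 2\<close> to these points form a diagonally dominant system inside the span of a
  trajectory, which bounds their number, and they yield a cover with \<open>e\<^sup>o\<^sup>(\<^sup>|\<^sup>F\<^sup>|\<^sup>)\<close> times as many sets.

  The limits exist by the Ornstein-Weiss lemma. That characters separate the points of a compact
  group follows from an invariant mean, by splitting off minimal idempotents of the convolution
  algebra; for a discrete group it follows from the divisibility of the circle.
\<close>

section \<open>The Ornstein-Weiss lemma\<close>

text \<open>The obstacle in both directions is accumulation over \<open>F\<close>. A product of
  \<open>card F\<close> factors close to 1 can be far from 1, so a character of the trajectory need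
  not be almost constant on a piece, and the pieces cannot shrink with \<open>F\<close>: the cover
  and the finite set must be fixed before \<open>F\<close>. Truncation works because the discarded
  terms, of degree above \<open>\<delta> * card F\<close>, are exponentially small for a fixed
  closeness. Conversely, there may be \<open>q ^ card F\<close> separated points, with
  \<open>q\<close> the number of cells, so the off-diagonal entries must beat
  \<open>1 / q ^ card F\<close>; separation in more than \<open>\<delta> * card F\<close>
  coordinates gives this with a power \<open>m\<close> fixed before \<open>F\<close>. In both
  directions the main loss is the weighted number of sparse subsets of \<open>F\<close>, at most
  \<open>exp (\<kappa> * card F)\<close>. The monoid has no inverses. The tiling survives because
  tiles are moved by left multiplication, under which the entropy functionals do not increase, while
  invariance is tested by right multiplication, and the two commute.\<close>

text \<open>The Folner condition for a single set. Limits along nets become statements about all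
  sufficiently invariant finite sets, so independence of the net comes for free.\<close>

definition folner_invariant :: "'s::monoid_mult set \<Rightarrow> real \<Rightarrow> 's set \<Rightarrow> bool" where
  "folner_invariant E \<delta> F \<longleftrightarrow> finite F \<and> F \<noteq> {} \<and>
     (\<forall>s\<in>E. real (card ((\<lambda>x. x * s) ` F - F)) \<le> \<delta> * real (card F))"

lemma folner_invariant_mono:
  assumes "folner_invariant E \<delta> F" "E' \<subseteq> E" "\<delta> \<le> \<delta>'"
  shows "folner_invariant E' \<delta>' F"
proof -
  have "\<delta> * real (card F) \<le> \<delta>' * real (card F)" using assms(3) by (intro mult_right_mono) auto
  then show ?thesis using assms(1,2) unfolding folner_invariant_def by (blast intro: order_trans)
qed

locale amenable_cancel_monoid =
  fixes S :: "'s::monoid_mult itself"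
  assumes left_cancel: "\<And>a b c :: 's. a * b = a * c \<Longrightarrow> b = c"
    and right_cancel: "\<And>a b c :: 's. b * a = c * a \<Longrightarrow> b = c"
    and amenable: "right_amenable TYPE('s)"
begin

lemma card_left_translate: "card ((*) (s::'s) ` A) = card A"
  by (intro card_image inj_onI) (auto dest: left_cancel)

lemma card_right_translate: "card ((\<lambda>x. x * s) ` A) = card A" for s :: 's
  by (intro card_image inj_onI) (auto dest: right_cancel)

text \<open>An \<open>s\<close> is lost only if some \<open>d\<close> moves it out of
  \<open>F\<close>, and right multiplication by \<open>d\<close> injects the points lost in this way
  into the boundary of \<open>F\<close>. Hence most points of an invariant \<open>F\<close> are left
  ends of tiles inside \<open>F\<close>.\<close>

lemma card_interior:
  fixes D F :: "'s set"
  assumes "finite D" "finite F"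
  shows "card F \<le> card {s\<in>F. \<forall>d\<in>D. s * d \<in> F} + (\<Sum>d\<in>D. card ((\<lambda>x. x * d) ` F - F))"
proof -
  have "F \<subseteq> {s\<in>F. \<forall>d\<in>D. s * d \<in> F} \<union> (\<Union>d\<in>D. {s\<in>F. s * d \<notin> F})" by auto
  then have "card F \<le> card ({s\<in>F. \<forall>d\<in>D. s * d \<in> F} \<union> (\<Union>d\<in>D. {s\<in>F. s * d \<notin> F}))"
    using assms by (intro card_mono) auto
  also have "\<dots> \<le> card {s\<in>F. \<forall>d\<in>D. s * d \<in> F} + card (\<Union>d\<in>D. {s\<in>F. s * d \<notin> F})"
    by (rule card_Un_le)
  also have "card (\<Union>d\<in>D. {s\<in>F. s * d \<notin> F}) \<le> (\<Sum>d\<in>D. card {s\<in>F. s * d \<notin> F})"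
    using assms by (intro card_UN_le)
  also have "\<dots> \<le> (\<Sum>d\<in>D. card ((\<lambda>x. x * d) ` F - F))"
  proof (rule sum_mono)
    fix d
    have "card {s\<in>F. s * d \<notin> F} = card ((\<lambda>x. x * d) ` {s\<in>F. s * d \<notin> F})"
      by (simp add: card_right_translate)
    also have "\<dots> \<le> card ((\<lambda>x. x * d) ` F - F)"
      using assms by (intro card_mono) auto
    finally show "card {s\<in>F. s * d \<notin> F} \<le> card ((\<lambda>x. x * d) ` F - F)" .
  qed
  finally show ?thesis by simp
qed

text \<open>A subfamily of maximal size among those with small overlap covers a fixed proportion:
  every discarded tile meets the covered part \<open>Y\<close> in a proportion at least \<open>\<epsilon>\<close>, while each point
  lies in at most \<open>card D\<close> tiles.\<close>

lemma tile_family: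
  fixes D F :: "'s set" and \<epsilon> :: real
  assumes D: "finite D" "D \<noteq> {}" and F: "finite F" and \<epsilon>: "0 < \<epsilon>" "\<epsilon> < 1"
  defines "I \<equiv> {s\<in>F. \<forall>d\<in>D. s * d \<in> F}"
  obtains T where "T \<subseteq> I" "(1 - \<epsilon>) * card D * card T \<le> card (\<Union>t\<in>T. (*) t ` D)"
    "\<epsilon> * card I \<le> card (\<Union>t\<in>T. (*) t ` D)"
proof -
  have finI: "finite I" using F by (simp add: I_def)
  define P where "P T \<longleftrightarrow> T \<subseteq> I \<and> (1 - \<epsilon>) * card D * card T \<le> card (\<Union>t\<in>T. (*) t ` D)" for T
  have "P {}" by (simp add: P_def)
  moreover have "\<forall>T. P T \<longrightarrow> card T < Suc (card I)"
    using finI by (auto simp: P_def less_Suc_eq_le card_mono)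
  ultimately obtain T where T: "P T" and max: "\<And>T'. P T' \<Longrightarrow> card T' \<le> card T"
    using ex_has_greatest_nat[of P "{}" card] by metis
  define Y where "Y = (\<Union>t\<in>T. (*) t ` D)"
  have TI: "T \<subseteq> I" and Tc: "(1 - \<epsilon>) * card D * card T \<le> card Y" using T by (auto simp: P_def Y_def)
  have finT: "finite T" using TI finI finite_subset by blast
  have finY: "finite Y" using finT D by (simp add: Y_def)
  have cD: "card D > 0" using D by (simp add: card_gt_0_iff)
  have overlap: "\<epsilon> * card D \<le> card ((*) s ` D \<inter> Y)" if "s \<in> I" for s
  proof (cases "s \<in> T")
    case True
    then have "(*) s ` D \<inter> Y = (*) s ` D" by (auto simp: Y_def)
    then show ?thesis using \<epsilon> by (simp add: card_left_translate mult_left_le_one_le)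
  next
    case False
    show ?thesis
    proof (rule ccontr)
      assume "\<not> ?thesis"
      then have small: "card ((*) s ` D \<inter> Y) < \<epsilon> * card D" by simp
      have eq: "(\<Union>t\<in>insert s T. (*) t ` D) = Y \<union> ((*) s ` D - Y)" by (auto simp: Y_def)
      have "card (Y \<union> ((*) s ` D - Y)) = card Y + card ((*) s ` D - Y)"
        using finY D by (intro card_Un_disjoint) auto
      also have "card ((*) s ` D - Y) = card D - card ((*) s ` D \<inter> Y)"
        using D by (simp add: card_Diff_subset_Int card_left_translate)
      finally have "real (card (Y \<union> ((*) s ` D - Y))) \<ge> card Y + (card D - card ((*) s ` D \<inter> Y))"
        by linarith
      then have "(1 - \<epsilon>) * card D * card (insert s T) \<le> card (\<Union>t\<in>insert s T. (*) t ` D)"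
        using Tc small False finT unfolding eq by (simp add: algebra_simps)
      then have "P (insert s T)" using TI that by (simp add: P_def)
      then show False using max[of "insert s T"] False finT by simp
    qed
  qed
  have "\<epsilon> * card D * card I = (\<Sum>s\<in>I. \<epsilon> * card D)" by simp
  also have "\<dots> \<le> (\<Sum>s\<in>I. real (card ((*) s ` D \<inter> Y)))" by (rule sum_mono) (rule overlap)
  also have "\<dots> = real (card (SIGMA s:I. (*) s ` D \<inter> Y))"
    using finI finY by (subst card_SigmaI) auto
  also have "card (SIGMA s:I. (*) s ` D \<inter> Y) \<le> card (D \<times> Y)"
  proof -
    let ?Q = "{(s, d) \<in> I \<times> D. s * d \<in> Y}"
    have finQ: "finite ?Q" by (rule finite_subset[of _ "I \<times> D"]) (use finI D in auto)
    have "(SIGMA s:I. (*) s ` D \<inter> Y) \<subseteq> (\<lambda>(s, d). (s, s * d)) ` ?Q" by force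
    then have "card (SIGMA s:I. (*) s ` D \<inter> Y) \<le> card ?Q"
      using finQ by (rule surj_card_le[rotated])
    also have "\<dots> \<le> card (D \<times> Y)"
    proof (rule card_inj_on_le)
      \<comment> \<open>Right cancellation: for fixed \<open>d\<close>, the point
        \<open>s * d\<close> determines \<open>s\<close>.\<close>
      show "inj_on (\<lambda>(s, d). (d, s * d)) ?Q" by (auto intro!: inj_onI dest: right_cancel)
    qed (use D finY in auto)
    finally show ?thesis .
  qed
  finally have "card D * (\<epsilon> * card I) \<le> card D * real (card Y)"
    by (simp add: card_cartesian_product algebra_simps)
  then have "\<epsilon> * card I \<le> card Y" using cD by simp
  then show thesis using that[OF TI] Tc by (simp add: Y_def)
qed

text \<open>A point \<open>x * e\<close> that leaves the remainder either leaves \<open>F\<close> or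
  lands in a tile at some \<open>t * d\<close>. In the second case \<open>d\<close> is not of the
  form \<open>d' * e\<close>, since cancelling \<open>e\<close> would put \<open>x\<close> itself
  into the tile. So tiles that are themselves invariant do little damage.\<close>

lemma remainder_invariant:
  fixes D F T :: "'s set"
  assumes fin: "finite D" "finite F" "finite T"
  defines "F' \<equiv> F - (\<Union>t\<in>T. (*) t ` D)"
  shows "card ((\<lambda>x. x * e) ` F' - F') \<le>
    card ((\<lambda>x. x * e) ` F - F) + card T * card ((\<lambda>x. x * e) ` D - D)"
proof -
  have "(\<lambda>x. x * e) ` F' - F' \<subseteq> ((\<lambda>x. x * e) ` F - F) \<union> (\<Union>t\<in>T. (*) t ` (D - (\<lambda>x. x * e) ` D))"
    (is "_ \<subseteq> ?A \<union> ?B")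
  proof
    fix y assume y: "y \<in> (\<lambda>x. x * e) ` F' - F'"
    then obtain x where x: "x \<in> F'" "y = x * e" by auto
    show "y \<in> ?A \<union> ?B"
    proof (cases "y \<in> F")
      case True
      with y obtain t d where td: "t \<in> T" "d \<in> D" "y = t * d" by (auto simp: F'_def)
      have "d \<notin> (\<lambda>x. x * e) ` D"
      proof
        assume "d \<in> (\<lambda>x. x * e) ` D"
        then obtain d' where d': "d' \<in> D" "d = d' * e" by auto
        then have "x * e = (t * d') * e" using x td by (simp add: mult.assoc)
        then have "x = t * d'" by (rule right_cancel)
        then show False using x td d' by (auto simp: F'_def)
      qed
      then show ?thesis using td by auto
    qed (use x in \<open>auto simp: F'_def\<close>)
  qed
  then have "card ((\<lambda>x. x * e) ` F' - F') \<le> card (?A \<union> ?B)"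
    using fin by (intro card_mono) auto
  also have "\<dots> \<le> card ?A + card ?B" by (rule card_Un_le)
  also have "card ?B \<le> (\<Sum>t\<in>T. card ((*) t ` (D - (\<lambda>x. x * e) ` D)))"
    using fin by (intro card_UN_le)
  also have "\<dots> = card T * card (D - (\<lambda>x. x * e) ` D)"
    by (simp add: card_left_translate)
  also have "card (D - (\<lambda>x. x * e) ` D) = card ((\<lambda>x. x * e) ` D - D)"
    using fin by (simp add: card_Diff_subset_Int card_right_translate Int_commute)
  finally show ?thesis by simp
qed

lemma folner_net_eventually:
  fixes F :: "'i \<Rightarrow> 's set"
  assumes IF: "right_folner_net I F" and "finite E" "\<delta> > 0"
  shows "eventually (\<lambda>i. folner_invariant E \<delta> (F i)) I"
proof -
  have "eventually (\<lambda>i. \<forall>s\<in>E. real (card ((\<lambda>x. x * s) ` F i - F i)) / real (card (F i)) < \<delta>) I"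
  proof (rule eventually_ball_finite[OF \<open>finite E\<close>], rule ballI)
    fix s assume "s \<in> E"
    have "((\<lambda>i. real (card ((\<lambda>x. x * s) ` F i - F i)) / real (card (F i))) \<longlongrightarrow> 0) I"
      using IF by (simp add: right_folner_net_def)
    then show "eventually (\<lambda>i. real (card ((\<lambda>x. x * s) ` F i - F i)) / real (card (F i)) < \<delta>) I"
      using \<open>\<delta> > 0\<close> by (rule order_tendstoD)
  qed
  then show ?thesis
  proof (rule eventually_mono)
    fix i assume *: "\<forall>s\<in>E. real (card ((\<lambda>x. x * s) ` F i - F i)) / real (card (F i)) < \<delta>"
    have F: "finite (F i)" "F i \<noteq> {}" using IF by (auto simp: right_folner_net_def)
    then have "real (card (F i)) > 0" by (simp add: card_gt_0_iff)
    then have "real (card ((\<lambda>x. x * s) ` F i - F i)) \<le> \<delta> * real (card (F i))" if "s \<in> E" for s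
      using bspec[OF * that] by (simp add: field_simps)
    then show "folner_invariant E \<delta> (F i)"
      using F unfolding folner_invariant_def by blast
  qed
qed

lemma ex_folner_invariant:
  assumes "finite (E::'s set)" "\<delta> > 0"
  shows "\<exists>F. folner_invariant E \<delta> F"
proof -
  obtain I :: "'s set filter" and F :: "'s set \<Rightarrow> 's set" where IF: "right_folner_net I F"
    using amenable by (auto simp: right_amenable_def)
  then have "I \<noteq> bot" by (simp add: right_folner_net_def)
  then show ?thesis
    using eventually_happens[OF folner_net_eventually[OF IF assms]] by blast
qed

text \<open>For translates only an inequality is asked: the endomorphism attached to
  \<open>s\<close> may identify points of a trajectory. Tiles are left translates, so this is the
  direction in which it gets applied.\<close>

definition subinvariant :: "('s set \<Rightarrow> real) \<Rightarrow> bool" where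
  "subinvariant f \<longleftrightarrow> f {} = 0 \<and> (\<forall>A. finite A \<longrightarrow> f A \<ge> 0) \<and>
     (\<forall>A B. finite A \<longrightarrow> finite B \<longrightarrow> f (A \<union> B) \<le> f A + f B) \<and>
     (\<forall>s A. finite A \<longrightarrow> f ((*) s ` A) \<le> f A)"

lemma subinvariant_translate:
  "subinvariant f \<Longrightarrow> finite A \<Longrightarrow> f ((*) s ` A) \<le> f A"
  by (simp add: subinvariant_def)

lemma subinvariant_UN:
  assumes "subinvariant f" "finite I" "\<And>i. i \<in> I \<Longrightarrow> finite (A i)"
  shows "f (\<Union>i\<in>I. A i) \<le> (\<Sum>i\<in>I. f (A i))"
  using assms(2,3)
proof (induction I)
  case empty
  then show ?case using assms(1) by (simp add: subinvariant_def)
next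
  case (insert j I)
  have "f (\<Union>i\<in>insert j I. A i) = f (A j \<union> (\<Union>i\<in>I. A i))" by simp
  also have "\<dots> \<le> f (A j) + f (\<Union>i\<in>I. A i)"
    using assms(1) insert by (simp add: subinvariant_def)
  also have "\<dots> \<le> f (A j) + (\<Sum>i\<in>I. f (A i))"
    using insert by simp
  finally show ?case using insert by simp
qed

text \<open>\<open>A\<close> is a union of left translates of \<open>{1}\<close>. The bound absorbs
  the part of a set that the tiles leave over.\<close>

lemma subinvariant_card_bound:
  assumes "subinvariant f" "finite A"
  shows "f A \<le> f {1} * card A"
proof -
  have "f A = f (\<Union>x\<in>A. (*) x ` {1})" by simp
  also have "\<dots> \<le> (\<Sum>x\<in>A. f ((*) x ` {1}))" using assms by (intro subinvariant_UN) auto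
  also have "\<dots> \<le> (\<Sum>x\<in>A. f {1})" 
    using assms(1) by (intro sum_mono subinvariant_translate) auto
  finally show ?thesis by (simp add: mult.commute)
qed

text \<open>Induction on the number of rounds. A round covers a share of at least
  \<open>\<epsilon> / 2\<close> by tiles with small overlap. The shape used first is constructed
  last: it has to be invariant under the demands of the later rounds, so that the remainder still
  meets them.\<close>

lemma quasi_tiling:
  fixes f :: "'s set \<Rightarrow> real" and c \<eta> :: real
  assumes f: "subinvariant f" and c: "c \<ge> 0" and \<epsilon>: "0 < \<epsilon>" "\<epsilon> \<le> 1 / 2"
    and tiles: "\<And>E \<delta>. finite E \<Longrightarrow> \<delta> > 0 \<Longrightarrow> \<exists>D. folner_invariant E \<delta> D \<and> f D \<le> c * card D"
  shows "\<exists>E \<delta>. finite E \<and> \<delta> > 0 \<and> (\<forall>F. folner_invariant E \<delta> F \<longrightarrow>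
    (\<exists>F'\<subseteq>F. f F \<le> c / (1 - \<epsilon>) * card (F - F') + f F' \<and> card F' \<le> max \<epsilon> ((1 - \<epsilon> / 2) ^ n) * card F))"
proof (induction n)
  case 0
  show ?case
  proof (rule exI[of _ "{}"], rule exI[of _ "1::real"], intro conjI allI impI)
    fix F :: "'s set"
    show "\<exists>F'\<subseteq>F. f F \<le> c / (1 - \<epsilon>) * card (F - F') + f F' \<and>
        card F' \<le> max \<epsilon> ((1 - \<epsilon> / 2) ^ 0) * card F"
      using \<epsilon> by (intro exI[of _ F]) (simp add: max_absorb2)
  qed auto
next
  case (Suc n)
  then obtain E \<delta> where E: "finite E" "\<delta> > 0" and IH: "\<And>F. folner_invariant E \<delta> F \<Longrightarrow>
    \<exists>F'\<subseteq>F. f F \<le> c / (1 - \<epsilon>) * card (F - F') + f F' \<and> card F' \<le> max \<epsilon> ((1 - \<epsilon> / 2) ^ n) * card F"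
    by blast
  \<comment> \<open>The tiles have total size at most \<open>2 * card F\<close>, so the boundary of
    the remainder is at most \<open>4 * \<delta>1 * card F\<close>; this is at most
    \<open>\<delta> * card F1\<close> as long as the remainder has size at least
    \<open>\<epsilon> * card F\<close>.\<close>
  define \<delta>1 where "\<delta>1 = \<delta> * \<epsilon> / 4"
  have \<delta>1: "\<delta>1 > 0" using E \<epsilon> by (simp add: \<delta>1_def)
  obtain D where D: "folner_invariant E \<delta>1 D" and fD: "f D \<le> c * card D"
    using tiles[OF E(1) \<delta>1] by blast
  have finD: "finite D" "D \<noteq> {}" using D by (auto simp: folner_invariant_def)
  then have cD: "card D > 0" by (simp add: card_gt_0_iff)
  \<comment> \<open>The second bound makes the interior of \<open>F\<close> at least half of
    \<open>F\<close>.\<close>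
  define \<delta>2 where "\<delta>2 = min \<delta>1 (1 / (2 * card D))"
  have \<delta>2: "\<delta>2 > 0" using \<delta>1 cD by (simp add: \<delta>2_def)
  show ?case
  proof (rule exI[of _ "E \<union> D"], rule exI[of _ \<delta>2], intro conjI allI impI)
    show "finite (E \<union> D)" using E finD by simp
    show "\<delta>2 > 0" by fact
    fix F assume inv: "folner_invariant (E \<union> D) \<delta>2 F"
    then have finF: "finite F" "F \<noteq> {}" by (auto simp: folner_invariant_def)
    then have cF: "card F > 0" by (simp add: card_gt_0_iff)
    define I where "I = {s\<in>F. \<forall>d\<in>D. s * d \<in> F}"
    have \<epsilon>': "\<epsilon> < 1" using \<epsilon> by simp
    obtain T where TI: "T \<subseteq> I" and T1: "(1 - \<epsilon>) * card D * card T \<le> card (\<Union>t\<in>T. (*) t ` D)"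
      and T2: "\<epsilon> * card I \<le> card (\<Union>t\<in>T. (*) t ` D)"
      by (rule tile_family[OF finD finF(1) \<epsilon>(1) \<epsilon>', folded I_def])
    define Y where "Y = (\<Union>t\<in>T. (*) t ` D)"
    define F1 where "F1 = F - Y"
    have YF: "Y \<subseteq> F" using TI by (auto simp: Y_def I_def)
    have finI: "finite I" using finF by (simp add: I_def)
    have finT: "finite T" using TI finI finite_subset by blast
    have finY: "finite Y" using YF finF finite_subset by blast
    have cardF: "real (card F) = card Y + card F1"
      using YF finF finY by (simp add: F1_def card_Diff_subset card_mono of_nat_diff)
    have "real (card F) \<le> card I + (\<Sum>d\<in>D. real (card ((\<lambda>x. x * d) ` F - F)))"
      using card_interior[OF finD(1) finF(1)] unfolding I_def[symmetric]
      by (simp flip: of_nat_sum of_nat_add)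
    also have "(\<Sum>d\<in>D. real (card ((\<lambda>x. x * d) ` F - F))) \<le> (\<Sum>d\<in>D. \<delta>2 * card F)"
      using inv by (intro sum_mono) (auto simp: folner_invariant_def)
    also have "\<dots> = (\<delta>2 * card D) * card F" by simp
    also have "\<dots> \<le> (1 / 2) * card F"
    proof (rule mult_right_mono)
      have "\<delta>2 \<le> 1 / (2 * card D)" by (simp add: \<delta>2_def)
      then show "\<delta>2 * card D \<le> 1 / 2" using cD by (simp add: field_simps)
    qed simp
    finally have "card F / 2 \<le> real (card I)" by simp
    then have "\<epsilon> * (card F / 2) \<le> \<epsilon> * card I" using \<epsilon> by (intro mult_left_mono) auto
    then have Ybig: "\<epsilon> / 2 * card F \<le> card Y" using T2 by (simp add: Y_def)
    have F1small: "card F1 \<le> (1 - \<epsilon> / 2) * card F" using Ybig cardF by (simp add: algebra_simps)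
    have "f Y \<le> (\<Sum>t\<in>T. f ((*) t ` D))"
      unfolding Y_def using f finT finD by (intro subinvariant_UN) auto
    also have "\<dots> \<le> (\<Sum>t\<in>T. f D)"
      using f finD by (intro sum_mono) (auto simp: subinvariant_def)
    also have "\<dots> = card T * f D" by simp
    also have "\<dots> \<le> card T * (c * card D)" using fD by (intro mult_left_mono) auto
    also have "\<dots> = c / (1 - \<epsilon>) * ((1 - \<epsilon>) * card D * card T)" using \<epsilon>' by (simp add: field_simps)
    also have "\<dots> \<le> c / (1 - \<epsilon>) * card Y"
      using T1 c \<epsilon>' by (intro mult_left_mono) (auto simp: Y_def)
    finally have fY: "f Y \<le> c / (1 - \<epsilon>) * card Y" .
    have "F = Y \<union> F1" using YF by (auto simp: F1_def)
    then have fF: "f F \<le> f Y + f F1"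
      using f finF finY unfolding subinvariant_def F1_def by (metis finite_Diff)
    show "\<exists>F'\<subseteq>F. f F \<le> c / (1 - \<epsilon>) * card (F - F') + f F' \<and>
        card F' \<le> max \<epsilon> ((1 - \<epsilon> / 2) ^ Suc n) * card F"
    \<comment> \<open>A remainder below \<open>\<epsilon> * card F\<close> ends the process, since
      its boundary can no longer be compared with its own size; this is why the bound contains a
      maximum.\<close>
    proof (cases "card F1 \<le> \<epsilon> * card F")
      case True
      have "F - F1 = Y" using YF by (auto simp: F1_def)
      moreover have "real (card F1) \<le> max \<epsilon> ((1 - \<epsilon> / 2) ^ Suc n) * card F"
        by (rule order_trans[OF True], rule mult_right_mono) auto
      ultimately show ?thesis
        using fF fY by (intro exI[of _ F1]) (auto simp: F1_def)
    next
      case False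
      then have F1big: "\<epsilon> * card F \<le> card F1" by simp
      have cT: "card T * card D \<le> 2 * real (card F)"
      proof -
        have "(1/2) * (real (card D) * real (card T)) \<le> (1 - \<epsilon>) * (card D * real (card T))"
          using \<epsilon> by (intro mult_right_mono) auto
        then have "(1/2) * (real (card D) * real (card T)) \<le> real (card Y)" using T1 by (simp add: Y_def)
        then show ?thesis using cardF by (simp add: algebra_simps)
      qed
      have "folner_invariant E \<delta> F1"
        unfolding folner_invariant_def
      proof (intro conjI ballI)
        show "finite F1" using finF by (simp add: F1_def)
        show "F1 \<noteq> {}" using False \<epsilon> cF by auto
        fix e assume e: "e \<in> E"
        have "real (card ((\<lambda>x. x * e) ` F1 - F1)) \<le>
            card ((\<lambda>x. x * e) ` F - F) + card T * card ((\<lambda>x. x * e) ` D - D)"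
          using remainder_invariant[OF finD(1) finF(1) finT, of e]
          unfolding F1_def Y_def by linarith
        also have "\<dots> = real (card ((\<lambda>x. x * e) ` F - F)) + card T * real (card ((\<lambda>x. x * e) ` D - D))"
          by simp
        also have "\<dots> \<le> \<delta>1 * card F + card T * (\<delta>1 * card D)"
        proof (intro add_mono mult_left_mono)
          have "real (card ((\<lambda>x. x * e) ` F - F)) \<le> \<delta>2 * card F"
            using inv e by (simp add: folner_invariant_def)
          also have "\<dots> \<le> \<delta>1 * card F" by (intro mult_right_mono) (auto simp: \<delta>2_def)
          finally show "real (card ((\<lambda>x. x * e) ` F - F)) \<le> \<delta>1 * card F" .
          show "real (card ((\<lambda>x. x * e) ` D - D)) \<le> \<delta>1 * card D"
            using D e by (simp add: folner_invariant_def)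
        qed auto
        also have "\<dots> = \<delta>1 * (card F + card T * card D)" by (simp add: algebra_simps)
        also have "\<dots> \<le> \<delta>1 * (4 * card F)"
          using cT \<delta>1 by (intro mult_left_mono) auto
        also have "\<dots> = \<delta> * (\<epsilon> * card F)" by (simp add: \<delta>1_def)
        also have "\<dots> \<le> \<delta> * card F1" using F1big E by (intro mult_left_mono) auto
        finally show "real (card ((\<lambda>x. x * e) ` F1 - F1)) \<le> \<delta> * card F1" .
      qed
      from IH[OF this] obtain F' where F': "F' \<subseteq> F1"
        "f F1 \<le> c / (1 - \<epsilon>) * card (F1 - F') + f F'"
        "card F' \<le> max \<epsilon> ((1 - \<epsilon> / 2) ^ n) * card F1" by blast
      have "F - F' = Y \<union> (F1 - F')" "Y \<inter> (F1 - F') = {}" using F' YF by (auto simp: F1_def)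
      then have "card (F - F') = card Y + card (F1 - F')"
        using finY finF by (simp add: card_Un_disjoint F1_def)
      then have "f F \<le> c / (1 - \<epsilon>) * card (F - F') + f F'"
        using fF fY F'(2) by (simp add: algebra_simps)
      moreover have "max \<epsilon> ((1 - \<epsilon> / 2) ^ n) * card F1 \<le> max \<epsilon> ((1 - \<epsilon> / 2) ^ Suc n) * card F"
      proof (cases "\<epsilon> \<le> (1 - \<epsilon> / 2) ^ n")
        case True
        have "(1 - \<epsilon> / 2) ^ n * card F1 \<le> (1 - \<epsilon> / 2) ^ n * ((1 - \<epsilon> / 2) * card F)"
          using \<epsilon> F1small by (intro mult_left_mono) auto
        also have "\<dots> = (1 - \<epsilon> / 2) ^ Suc n * card F" by simp
        also have "\<dots> \<le> max \<epsilon> ((1 - \<epsilon> / 2) ^ Suc n) * card F" by (intro mult_right_mono) auto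
        finally show ?thesis using True by (simp add: max_absorb2)
      next
        case False
        have "\<epsilon> * card F1 \<le> \<epsilon> * card F" using cardF \<epsilon> by (intro mult_left_mono) auto
        also have "\<dots> \<le> max \<epsilon> ((1 - \<epsilon> / 2) ^ Suc n) * card F" by (intro mult_right_mono) auto
        finally show ?thesis using False by (simp add: max_absorb1)
      qed
      ultimately show ?thesis using F' by (intro exI[of _ F']) (auto simp: F1_def)
    qed
  qed
qed

text \<open>After enough rounds the remainder is below \<open>\<epsilon> * card F\<close>. The
  overlaps cost a factor \<open>1 / (1 - \<epsilon>)\<close>, the remainder at most
  \<open>f {1} * \<epsilon> * card F\<close>.\<close>

lemma quasi_tiling_bound:
  fixes f :: "'s set \<Rightarrow> real" and c \<eta> :: real
  assumes f: "subinvariant f" and c: "c \<ge> 0" and \<eta>: "\<eta> > 0"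
    and tiles: "\<And>E \<delta>. finite E \<Longrightarrow> \<delta> > 0 \<Longrightarrow> \<exists>D. folner_invariant E \<delta> D \<and> f D \<le> c * card D"
  obtains E \<delta> where "finite E" "\<delta> > 0" "\<And>F. folner_invariant E \<delta> F \<Longrightarrow> f F \<le> (c + \<eta>) * card F"
proof -
  define M where "M = f {1}"
  have M: "M \<ge> 0" using f by (simp add: M_def subinvariant_def)
  \<comment> \<open>The bound \<open>1 / 2\<close> gives
    \<open>1 / (1 - \<epsilon>) \<le> 1 + 2 * \<epsilon>\<close>; the other one keeps the two losses
    together below \<open>\<eta>\<close>.\<close>
  define \<epsilon> where "\<epsilon> = min (1 / 2) (\<eta> / (2 * c + M + 1))"
  have den: "2 * c + M + 1 > 0" using c M by simp
  have \<epsilon>: "0 < \<epsilon>" "\<epsilon> \<le> 1 / 2" using \<eta> den unfolding \<epsilon>_def by (simp, intro min.cobounded1)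
  have \<epsilon>\<eta>: "\<epsilon> * (2 * c + M + 1) \<le> \<eta>"
  proof -
    have "\<epsilon> \<le> \<eta> / (2 * c + M + 1)" by (simp add: \<epsilon>_def)
    then show ?thesis using den by (simp add: field_simps)
  qed
  obtain n where n: "(1 - \<epsilon> / 2) ^ n < \<epsilon>"
    using real_arch_pow_inv[of \<epsilon> "1 - \<epsilon> / 2"] \<epsilon> by auto
  obtain E \<delta> where E: "finite E" "\<delta> > 0" and *: "\<And>F. folner_invariant E \<delta> F \<Longrightarrow>
    (\<exists>F'\<subseteq>F. f F \<le> c / (1 - \<epsilon>) * card (F - F') + f F' \<and> card F' \<le> max \<epsilon> ((1 - \<epsilon> / 2) ^ n) * card F)"
    using quasi_tiling[OF f c \<epsilon> tiles, of n] by blast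
  show thesis
  proof (rule that[OF E])
    fix F assume inv: "folner_invariant E \<delta> F"
    then have finF: "finite F" by (simp add: folner_invariant_def)
    obtain F' where F': "F' \<subseteq> F" "f F \<le> c / (1 - \<epsilon>) * card (F - F') + f F'"
      "card F' \<le> max \<epsilon> ((1 - \<epsilon> / 2) ^ n) * card F" using *[OF inv] by blast
    have "f F' \<le> M * card F'"
      unfolding M_def using f F' finF finite_subset by (intro subinvariant_card_bound) auto
    also have "\<dots> \<le> M * (\<epsilon> * card F)"
      using F'(3) n M by (intro mult_left_mono) (auto simp: max_absorb1)
    finally have 1: "f F' \<le> M * \<epsilon> * card F" by simp
    have "1 / (1 - \<epsilon>) \<le> 1 + 2 * \<epsilon>"
    proof -
      have "0 \<le> \<epsilon> * (1 - 2 * \<epsilon>)" using \<epsilon> by simp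
      then have "(1 + 2 * \<epsilon>) * (1 - \<epsilon>) \<ge> 1" by (simp add: algebra_simps)
      then show ?thesis using \<epsilon> by (simp add: field_simps)
    qed
    then have "c * (1 / (1 - \<epsilon>)) * card (F - F') \<le> c * (1 + 2 * \<epsilon>) * card F"
      using c \<epsilon> finF by (intro mult_mono mult_left_mono) (auto intro!: card_mono)
    then have "f F \<le> c * (1 + 2 * \<epsilon>) * card F + M * \<epsilon> * card F" using F'(2) 1 by simp
    also have "\<dots> = (c + \<epsilon> * (2 * c + M)) * card F" by (simp add: algebra_simps)
    also have "\<dots> \<le> (c + \<eta>) * card F"
      using \<epsilon>\<eta> \<epsilon> by (intro mult_right_mono) (auto simp: algebra_simps)
    finally show "f F \<le> (c + \<eta>) * card F" .
  qed
qed

text \<open>\<open>C\<close> consists of the densities reached on arbitrarily invariant sets, so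
  \<open>h\<close> is the lower limit of \<open>f F / card F\<close>. Tiles that nearly attain it
  bound every sufficiently invariant set from above, which makes the lower limit a limit.\<close>

lemma folner_lim_uniform:
  fixes f :: "'s set \<Rightarrow> real" and c \<eta> :: real
  assumes f: "subinvariant f"
  obtains h where "\<And>\<eta>. \<eta> > 0 \<Longrightarrow> \<exists>E \<delta>. finite E \<and> \<delta> > 0 \<and>
    (\<forall>F. folner_invariant E \<delta> F \<longrightarrow> \<bar>f F / card F - h\<bar> \<le> \<eta>)"
proof -
  define C where "C = {c::real. c \<ge> 0 \<and> (\<forall>E \<delta>. finite E \<longrightarrow> \<delta> > 0 \<longrightarrow>
    (\<exists>D. folner_invariant E \<delta> D \<and> f D \<le> c * card D))}"
  have "f {1} \<in> C"
    unfolding C_def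
  proof (intro CollectI conjI allI impI)
    show "f {1} \<ge> 0" using f by (simp add: subinvariant_def)
    fix E :: "'s set" and \<delta> :: real assume "finite E" "\<delta> > 0"
    then obtain D where "folner_invariant E \<delta> D" using ex_folner_invariant by blast
    then show "\<exists>D. folner_invariant E \<delta> D \<and> f D \<le> f {1} * card D"
      using subinvariant_card_bound[OF f] by (auto simp: folner_invariant_def)
  qed
  then have ne: "C \<noteq> {}" by auto
  have bdd: "bdd_below C" by (rule bdd_belowI[of _ 0]) (simp add: C_def)
  define h where "h = Inf C"
  show thesis
  proof (rule that[of h])
    fix \<eta> :: real assume \<eta>: "\<eta> > 0"
    obtain c where c: "c \<in> C" "c < h + \<eta> / 2"
      using \<eta> cInf_lessD[OF ne, of "h + \<eta> / 2"] by (auto simp: h_def)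
    obtain E1 \<delta>1 where 1: "finite E1" "\<delta>1 > 0"
      "\<And>F. folner_invariant E1 \<delta>1 F \<Longrightarrow> f F \<le> (c + \<eta> / 2) * card F"
      using quasi_tiling_bound[OF f, of c "\<eta> / 2"] c \<eta> unfolding C_def by auto
    have "\<exists>E \<delta>. finite E \<and> \<delta> > 0 \<and> (\<forall>F. folner_invariant E \<delta> F \<longrightarrow> f F \<ge> (h - \<eta>) * card F)"
    proof (cases "h - \<eta> \<ge> 0")
      case True
      have "h - \<eta> \<notin> C" using cInf_lower[OF _ bdd, of "h - \<eta>"] \<eta> by (auto simp: h_def)
      then obtain E \<delta> where "finite E" "\<delta> > 0" "\<And>D. folner_invariant E \<delta> D \<Longrightarrow> \<not> f D \<le> (h - \<eta>) * card D"
        using True unfolding C_def by blast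
      then show ?thesis by (meson linear)
    next
      case False
      have "f F \<ge> (h - \<eta>) * card F" if "finite F" for F
      proof -
        have "(h - \<eta>) * card F \<le> 0" using False by (intro mult_nonpos_nonneg) auto
        also have "0 \<le> f F" using f that by (simp add: subinvariant_def)
        finally show ?thesis .
      qed
      then show ?thesis
        by (intro exI[of _ "{}"] exI[of _ 1]) (auto simp: folner_invariant_def)
    qed
    then obtain E2 \<delta>2 where 2: "finite E2" "\<delta>2 > 0"
      "\<And>F. folner_invariant E2 \<delta>2 F \<Longrightarrow> f F \<ge> (h - \<eta>) * card F" by blast
    show "\<exists>E \<delta>. finite E \<and> \<delta> > 0 \<and> (\<forall>F. folner_invariant E \<delta> F \<longrightarrow> \<bar>f F / card F - h\<bar> \<le> \<eta>)"
    proof (rule exI[of _ "E1 \<union> E2"], rule exI[of _ "min \<delta>1 \<delta>2"], intro conjI allI impI)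
      fix F assume inv: "folner_invariant (E1 \<union> E2) (min \<delta>1 \<delta>2) F"
      then have "card F > 0" by (simp add: folner_invariant_def card_gt_0_iff)
      moreover have "f F \<le> (c + \<eta> / 2) * card F" "f F \<ge> (h - \<eta>) * card F"
        by (rule 1(3) 2(3), rule folner_invariant_mono[OF inv]; simp)+
      ultimately have "f F / card F \<le> c + \<eta> / 2" "f F / card F \<ge> h - \<eta>"
        by (simp_all add: field_simps)
      then show "\<bar>f F / card F - h\<bar> \<le> \<eta>" using c by linarith
    qed (use 1 2 in auto)
  qed
qed

lemma folner_lim_exists:
  fixes I :: "'s set filter" and F :: "'s set \<Rightarrow> 's set"
  assumes f: "subinvariant f" and net: "right_folner_net I F"
  shows "((\<lambda>i. f (F i) / real (card (F i))) \<longlongrightarrow> folner_lim f) I"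
proof -
  obtain h where h: "\<And>\<eta>. \<eta> > 0 \<Longrightarrow> \<exists>E \<delta>. finite E \<and> \<delta> > 0 \<and>
    (\<forall>F. folner_invariant E \<delta> F \<longrightarrow> \<bar>f F / card F - h\<bar> \<le> \<eta>)" using folner_lim_uniform[OF f] by blast
  have lim: "((\<lambda>j. f (G j) / real (card (G j))) \<longlongrightarrow> h) J" if "right_folner_net J G"
    for J :: "'s set filter" and G :: "'s set \<Rightarrow> 's set"
  proof (rule tendstoI)
    fix \<eta> :: real assume "\<eta> > 0"
    then obtain E \<delta> where E: "finite E" "\<delta> > 0" and *: "\<And>F. folner_invariant E \<delta> F \<Longrightarrow> \<bar>f F / card F - h\<bar> \<le> \<eta> / 2"
      using h[of "\<eta> / 2"] by auto
    show "\<forall>\<^sub>F j in J. dist (f (G j) / real (card (G j))) h < \<eta>"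
      using folner_net_eventually[OF that E]
      by (rule eventually_mono) (use * \<open>\<eta> > 0\<close> in \<open>fastforce simp: dist_real_def\<close>)
  qed
  have "folner_lim f = h"
    unfolding folner_lim_def
  proof (rule the_equality)
    fix h' assume h': "\<forall>(I :: 's set filter) F. right_folner_net I F \<longrightarrow> ((\<lambda>i. f (F i) / real (card (F i))) \<longlongrightarrow> h') I"
    have "I \<noteq> bot" using net by (simp add: right_folner_net_def)
    then show "h' = h" using tendsto_unique[OF _ h'[rule_format, OF net] lim[OF net]] by simp
  qed (use lim in blast)
  then show ?thesis using lim[OF net] by simp
qed

text \<open>Passes from comparisons at each finite level to entropies. An error proportional to
  \<open>card F\<close> is harmless, and both main inequalities are proved with such an
  error.\<close>

lemma folner_lim_le:
  fixes \<kappa> :: real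
  assumes f: "subinvariant f" and g: "subinvariant g"
    and le: "\<And>F. finite F \<Longrightarrow> F \<noteq> {} \<Longrightarrow> f F \<le> g F + \<kappa> * card F"
  shows "folner_lim f \<le> folner_lim g + \<kappa>"
proof -
  obtain I :: "'s set filter" and F :: "'s set \<Rightarrow> 's set" where net: "right_folner_net I F"
    using amenable by (auto simp: right_amenable_def)
  have "((\<lambda>i. g (F i) / real (card (F i)) + \<kappa>) \<longlongrightarrow> folner_lim g + \<kappa>) I"
    by (intro tendsto_intros folner_lim_exists g net)
  moreover have "\<forall>\<^sub>F i in I. f (F i) / real (card (F i)) \<le> g (F i) / real (card (F i)) + \<kappa>"
  proof (rule always_eventually, rule allI)
    fix i
    have F: "finite (F i)" "F i \<noteq> {}" using net by (auto simp: right_folner_net_def)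
    then have "real (card (F i)) > 0" by (simp add: card_gt_0_iff)
    then show "f (F i) / real (card (F i)) \<le> g (F i) / real (card (F i)) + \<kappa>"
      using le[OF F] by (simp add: field_simps)
  qed
  moreover have "I \<noteq> bot" using net by (simp add: right_folner_net_def)
  ultimately show ?thesis
    by (intro tendsto_le[OF _ _ folner_lim_exists[OF f net]])
qed

end

section \<open>Sparse subsets and truncated products\<close>

lemma sum_power_card_Pow: "finite F \<Longrightarrow> (\<Sum>A\<in>Pow F. x ^ card A) = (1 + x :: real) ^ card F"
  using prod_add[of F "\<lambda>_. x" "\<lambda>_. 1"] by (simp add: add.commute)

text \<open>Exponential Chebyshev: weight \<open>q ^ card A\<close> by \<open>t ^ card A\<close> with \<open>t\<close> small.\<close>

lemma sum_small_subsets_le: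
  fixes q \<kappa> :: real
  assumes q: "q \<ge> 0" and \<kappa>: "\<kappa> > 0"
  obtains \<delta> :: real where "\<delta> > 0" "\<And>F :: 'a set. finite F \<Longrightarrow>
    (\<Sum>A | A \<subseteq> F \<and> real (card A) \<le> \<delta> * card F. q ^ card A) \<le> exp (\<kappa> * card F)"
proof -
  \<comment> \<open>Chosen so that \<open>(1 + t * q) ^ card F\<close> is at most
    \<open>exp (\<kappa> / 2 * card F)\<close>.\<close>
  define t where "t = min 1 (\<kappa> / (2 * (q + 1)))"
  have t: "0 < t" "t \<le> 1" using q \<kappa> by (auto simp: t_def)
  have "t * q \<le> \<kappa> / (2 * (q + 1)) * q" using q by (intro mult_right_mono) (simp_all add: t_def)
  also have "\<dots> \<le> \<kappa> / 2" using q \<kappa> by (simp add: field_simps)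
  finally have tq: "t * q \<le> \<kappa> / 2" .
  \<comment> \<open>\<open>L\<close> dominates \<open>- ln t\<close> and is positive even for
    \<open>t = 1\<close>. With \<open>\<delta> = \<kappa> / (2 * L)\<close>, undoing the weight
    \<open>t ^ card A\<close> costs at most \<open>exp (\<kappa> / 2 * card F)\<close>.\<close>
  define L where "L = 1 - ln t"
  have L: "L \<ge> 1" using t by (simp add: L_def)
  define \<delta> where "\<delta> = \<kappa> / (2 * L)"
  have \<delta>: "\<delta> > 0" using \<kappa> L by (simp add: \<delta>_def)
  have \<delta>t: "\<delta> * - ln t \<le> \<kappa> / 2"
  proof -
    have "\<delta> * - ln t \<le> \<delta> * L" using \<delta> by (intro mult_left_mono) (auto simp: L_def)
    then show ?thesis using L by (simp add: \<delta>_def)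
  qed
  show thesis
  proof (rule that[OF \<delta>])
    fix F :: "'a set" assume F: "finite F"
    have "(\<Sum>A | A \<subseteq> F \<and> real (card A) \<le> \<delta> * card F. q ^ card A) \<le>
      (\<Sum>A | A \<subseteq> F \<and> real (card A) \<le> \<delta> * card F. exp (\<kappa> / 2 * card F) * (t * q) ^ card A)"
    proof (rule sum_mono)
      fix A assume A: "A \<in> {A. A \<subseteq> F \<and> real (card A) \<le> \<delta> * card F}"
      have "card A * - ln t \<le> (\<delta> * card F) * - ln t"
        using A t by (intro mult_right_mono) auto
      also have "\<dots> = (\<delta> * - ln t) * card F" by simp
      also have "\<dots> \<le> \<kappa> / 2 * card F" using \<delta>t by (intro mult_right_mono) auto
      finally have "exp (- (card A * ln t)) \<le> exp (\<kappa> / 2 * card F)" by simp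
      also have "exp (- (card A * ln t)) = 1 / t ^ card A"
        using t by (simp add: exp_minus exp_of_nat_mult inverse_eq_divide)
      finally have "1 / t ^ card A * (t * q) ^ card A \<le> exp (\<kappa> / 2 * card F) * (t * q) ^ card A"
        using t q by (intro mult_right_mono) auto
      then show "q ^ card A \<le> exp (\<kappa> / 2 * card F) * (t * q) ^ card A"
        using t by (simp add: power_mult_distrib)
    qed
    also have "\<dots> \<le> (\<Sum>A\<in>Pow F. exp (\<kappa> / 2 * card F) * (t * q) ^ card A)"
      using F t q by (intro sum_mono2) auto
    also have "\<dots> = exp (\<kappa> / 2 * card F) * (1 + t * q) ^ card F"
      using F by (simp add: sum_power_card_Pow flip: sum_distrib_left)
    also have "\<dots> \<le> exp (\<kappa> / 2 * card F) * exp (\<kappa> / 2 * card F)"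
    proof (rule mult_left_mono)
      have "(1 + t * q) ^ card F \<le> exp (\<kappa> / 2) ^ card F"
        using mult_nonneg_nonneg[of t q] t q tq exp_ge_add_one_self[of "\<kappa> / 2"]
        by (intro power_mono) linarith+
      then show "(1 + t * q) ^ card F \<le> exp (\<kappa> / 2 * card F)"
        by (simp add: exp_of_nat_mult[symmetric] mult.commute)
    qed simp
    also have "\<dots> = exp (\<kappa> * card F)" by (simp flip: exp_add)
    finally show "(\<Sum>A | A \<subseteq> F \<and> real (card A) \<le> \<delta> * card F. q ^ card A) \<le> exp (\<kappa> * card F)" .
  qed
qed

text \<open>At most \<open>2 ^ card F\<close> terms are discarded, each with more than
  \<open>\<delta> * card F\<close> factors of modulus at most \<open>r\<close>. For fixed
  \<open>\<delta>\<close> a small \<open>r\<close> makes the base \<open>2 * r powr \<delta>\<close>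
  as small as desired.\<close>

lemma norm_prod_one_plus_truncation:
  fixes z :: "'a \<Rightarrow> complex" and \<delta> r :: real
  assumes F: "finite F" and z: "\<And>s. s \<in> F \<Longrightarrow> norm (z s) \<le> r" and r: "0 < r" "r \<le> 1" and \<delta>: "\<delta> > 0"
  shows "norm ((\<Prod>s\<in>F. 1 + z s) - (\<Sum>A | A \<subseteq> F \<and> real (card A) \<le> \<delta> * card F. \<Prod>s\<in>A. z s))
    \<le> (2 * r powr \<delta>) ^ card F"
proof -
  have "(\<Prod>s\<in>F. 1 + z s) = (\<Sum>A\<in>Pow F. \<Prod>s\<in>A. z s)"
    using prod_add[OF F, of z "\<lambda>_. 1"] by (simp add: add.commute)
  also have "Pow F = {A. A \<subseteq> F \<and> real (card A) \<le> \<delta> * card F} \<union> {A. A \<subseteq> F \<and> \<not> real (card A) \<le> \<delta> * card F}"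
    by auto
  finally have "(\<Prod>s\<in>F. 1 + z s) - (\<Sum>A | A \<subseteq> F \<and> real (card A) \<le> \<delta> * card F. \<Prod>s\<in>A. z s)
     = (\<Sum>A | A \<subseteq> F \<and> \<not> real (card A) \<le> \<delta> * card F. \<Prod>s\<in>A. z s)"
    using F by (subst (asm) sum.union_disjoint) auto
  also have "norm \<dots> \<le> (\<Sum>A | A \<subseteq> F \<and> \<not> real (card A) \<le> \<delta> * card F. r powr (\<delta> * card F))"
  proof (rule sum_norm_le)
    fix A assume A: "A \<in> {A. A \<subseteq> F \<and> \<not> real (card A) \<le> \<delta> * card F}"
    have "norm (\<Prod>s\<in>A. z s) \<le> (\<Prod>s\<in>A. r)"
      unfolding prod_norm[symmetric] using A z by (intro prod_mono) auto
    also have "\<dots> = r powr card A" using r by (simp add: powr_realpow)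
    also have "\<dots> \<le> r powr (\<delta> * card F)" using A r by (intro powr_mono') auto
    finally show "norm (\<Prod>s\<in>A. z s) \<le> r powr (\<delta> * card F)" .
  qed
  also have "\<dots> \<le> (\<Sum>A\<in>Pow F. r powr (\<delta> * card F))"
    using F by (intro sum_mono2) auto
  also have "\<dots> = (2 * r powr \<delta>) ^ card F"
    using F r by (simp add: card_Pow power_mult_distrib powr_powr[symmetric] powr_realpow)
  finally show ?thesis .
qed

section \<open>Covers\<close>

lemma cover_number_le:
  assumes "finite \<W>" "\<Union>\<W> = UNIV" "\<And>W. W \<in> \<W> \<Longrightarrow> \<exists>V\<in>\<V>. W \<subseteq> V"
  shows "cover_number \<V> \<le> card \<W>"
proof -
  obtain g where g: "\<And>W. W \<in> \<W> \<Longrightarrow> g W \<in> \<V> \<and> W \<subseteq> g W" using assms(3) by metis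
  have "\<Union> (g ` \<W>) = UNIV" using assms(2) g by blast
  then have "cover_number \<V> \<le> card (g ` \<W>)"
    unfolding cover_number_def using assms(1) g by (intro cInf_lower) auto
  also have "\<dots> \<le> card \<W>" using assms(1) by (rule card_image_le)
  finally show ?thesis .
qed

lemma cover_number_attained:
  assumes "\<W> \<subseteq> \<V>" "finite \<W>" "\<Union>\<W> = UNIV"
  obtains \<W>' where "\<W>' \<subseteq> \<V>" "finite \<W>'" "\<Union>\<W>' = UNIV" "card \<W>' = cover_number \<V>"
proof -
  let ?C = "{card \<V>' | \<V>'. \<V>' \<subseteq> \<V> \<and> finite \<V>' \<and> \<Union>\<V>' = UNIV}"
  have "?C \<noteq> {}" using assms by auto
  then have "cover_number \<V> \<in> ?C" unfolding cover_number_def by (rule Inf_nat_def1)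
  then show thesis using that by auto
qed


section \<open>Almost orthonormal families\<close>

text \<open>The inner product of L2 for the uniform measure on a finite sample. Such a sample stands
  in for an invariant measure, at the price that characters become only almost orthogonal.\<close>

definition mean_inner :: "'j set \<Rightarrow> ('j \<Rightarrow> 'v::real_inner) \<Rightarrow> ('j \<Rightarrow> 'v) \<Rightarrow> real" where
  "mean_inner J f g = (\<Sum>j\<in>J. f j \<bullet> g j) / card J"

lemma mean_inner_commute: "mean_inner J f g = mean_inner J g f"
  by (simp add: mean_inner_def inner_commute)

lemma mean_inner_add_left: "mean_inner J (\<lambda>j. f j + g j) h = mean_inner J f h + mean_inner J g h"
  by (simp add: mean_inner_def inner_add_left sum.distrib add_divide_distrib)

lemma mean_inner_diff_left: "mean_inner J (\<lambda>j. f j - g j) h = mean_inner J f h - mean_inner J g h"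
  by (simp add: mean_inner_def inner_diff_left sum_subtractf diff_divide_distrib)

lemma mean_inner_scale_left: "mean_inner J (\<lambda>j. a *\<^sub>R f j) h = a * mean_inner J f h"
  by (simp add: mean_inner_def sum_distrib_left)

lemma mean_inner_sum_left: "mean_inner J (\<lambda>j. \<Sum>i\<in>I. f i j) h = (\<Sum>i\<in>I. mean_inner J (f i) h)"
  by (simp add: mean_inner_def inner_sum_left sum.swap[of _ I J] sum_divide_distrib)

lemma mean_inner_add_right: "mean_inner J h (\<lambda>j. f j + g j) = mean_inner J h f + mean_inner J h g"
  by (metis mean_inner_commute mean_inner_add_left)

lemma mean_inner_diff_right: "mean_inner J h (\<lambda>j. f j - g j) = mean_inner J h f - mean_inner J h g"
  by (metis mean_inner_commute mean_inner_diff_left)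

lemma mean_inner_scale_right: "mean_inner J h (\<lambda>j. a *\<^sub>R f j) = a * mean_inner J h f"
  by (metis mean_inner_commute mean_inner_scale_left)

lemma mean_inner_sum_right: "mean_inner J h (\<lambda>j. \<Sum>i\<in>I. f i j) = (\<Sum>i\<in>I. mean_inner J h (f i))"
  using mean_inner_sum_left[of J f I h] by (simp add: mean_inner_commute[of J h])

lemmas mean_inner_simps = mean_inner_add_left mean_inner_diff_left mean_inner_scale_left
  mean_inner_add_right mean_inner_diff_right mean_inner_scale_right

lemma mean_inner_nonneg: "mean_inner J f f \<ge> 0"
  by (simp add: mean_inner_def sum_nonneg)

lemma mean_inner_cong:
  "(\<And>j. j \<in> J \<Longrightarrow> f j = f' j) \<Longrightarrow> (\<And>j. j \<in> J \<Longrightarrow> g j = g' j) \<Longrightarrow> mean_inner J f g = mean_inner J f' g'"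
  by (simp add: mean_inner_def)

lemma mean_inner_eq_0:
  assumes "finite J" "mean_inner J f f = 0" "j \<in> J"
  shows "f j = 0"
proof -
  have "card J \<noteq> 0" using assms by auto
  then have "(\<Sum>j\<in>J. f j \<bullet> f j) = 0" using assms(2) by (simp add: mean_inner_def)
  then show ?thesis using assms by (simp add: sum_nonneg_eq_0_iff)
qed

text \<open>The left side is \<open>\<Sum>\<^sub>i (\<parallel>v\<^sub>i\<parallel>\<^sup>2 - \<parallel>v\<^sub>i - u\<^sub>i\<parallel>\<^sup>2)\<close>, which is largest when \<open>u\<^sub>i\<close> is the projection
  of \<open>v\<^sub>i\<close> to the span of the \<open>w\<^sub>b\<close>; each orthogonal direction contributes at most \<open>C\<close>.\<close>

lemma bessel_rank_bound:
  fixes v :: "'i \<Rightarrow> 'j \<Rightarrow> 'v::real_inner" and w :: "'b \<Rightarrow> 'j \<Rightarrow> 'v"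
  assumes fin: "finite J" "finite I" "finite Bs"
    and bessel: "\<And>f. (\<Sum>i\<in>I. (mean_inner J f (v i))\<^sup>2) \<le> C * mean_inner J f f"
    and u: "\<And>i j. u i j = (\<Sum>b\<in>Bs. a i b *\<^sub>R w b j)" and C: "C \<ge> 0"
  shows "(\<Sum>i\<in>I. 2 * mean_inner J (v i) (u i) - mean_inner J (u i) (u i)) \<le> C * card Bs"
  using fin(3) u
proof (induction Bs arbitrary: w u)
  case empty
  then have "u i = (\<lambda>_. 0)" for i by (auto simp: fun_eq_iff)
  then show ?case by (simp add: mean_inner_def)
next
  case (insert b0 Bs)
  define w0 where "w0 = w b0"
  let ?n = "mean_inner J w0 w0"
  show ?case
  proof (cases "?n = 0")
    case True
    then have w0: "w0 j = 0" if "j \<in> J" for j using mean_inner_eq_0[OF fin(1)] that by blast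
    define u' where "u' i j = (\<Sum>b\<in>Bs. a i b *\<^sub>R w b j)" for i j
    have "u i j = u' i j" if "j \<in> J" for i j
      using insert w0[OF that] by (simp add: u'_def w0_def)
    then have "mean_inner J (v i) (u i) = mean_inner J (v i) (u' i)"
      "mean_inner J (u i) (u i) = mean_inner J (u' i) (u' i)" for i
      by (auto intro: mean_inner_cong)
    then have "(\<Sum>i\<in>I. 2 * mean_inner J (v i) (u i) - mean_inner J (u i) (u i)) \<le> C * card Bs"
      using insert.IH[of u' w, OF u'_def] by simp
    also have "\<dots> \<le> C * card (insert b0 Bs)"
      using C insert by (intro mult_left_mono) auto
    finally show ?thesis .
  next
    case False
    then have n: "?n > 0" using mean_inner_nonneg[of J w0] by linarith
    \<comment> \<open>A Gram-Schmidt step: \<open>w'\<close> is orthogonal to \<open>w0\<close>, and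
      \<open>\<alpha>\<close> below collects the coefficients along \<open>w0\<close>, so the left
      side splits into a quadratic in \<open>\<alpha> i\<close> and the same expression for one
      vector less.\<close>
    define c where "c b = mean_inner J (w b) w0 / ?n" for b
    define w' where "w' b j = w b j - c b *\<^sub>R w0 j" for b j
    define u' where "u' i j = (\<Sum>b\<in>Bs. a i b *\<^sub>R w' b j)" for i j
    define \<alpha> where "\<alpha> i = a i b0 + (\<Sum>b\<in>Bs. a i b * c b)" for i
    have u_eq: "u i = (\<lambda>j. \<alpha> i *\<^sub>R w0 j + u' i j)" for i
    proof
      fix j
      have "u i j = a i b0 *\<^sub>R w0 j + (\<Sum>b\<in>Bs. a i b *\<^sub>R w b j)"
        using insert by (simp add: w0_def)
      also have "(\<Sum>b\<in>Bs. a i b *\<^sub>R w b j) = (\<Sum>b\<in>Bs. (a i b * c b) *\<^sub>R w0 j + a i b *\<^sub>R w' b j)"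
        by (intro sum.cong) (auto simp: w'_def algebra_simps)
      also have "\<dots> = (\<Sum>b\<in>Bs. a i b * c b) *\<^sub>R w0 j + u' i j"
        by (simp add: sum.distrib u'_def scaleR_left.sum)
      finally show "u i j = \<alpha> i *\<^sub>R w0 j + u' i j" by (simp add: \<alpha>_def algebra_simps)
    qed
    have "mean_inner J (w' b) w0 = 0" for b
      unfolding w'_def using False by (simp add: mean_inner_simps c_def)
    then have orth: "mean_inner J (u' i) w0 = 0" for i
      unfolding u'_def by (simp add: mean_inner_sum_left mean_inner_scale_left)
    have one: "2 * mean_inner J (v i) (u i) - mean_inner J (u i) (u i) \<le>
       (mean_inner J w0 (v i))\<^sup>2 / ?n + (2 * mean_inner J (v i) (u' i) - mean_inner J (u' i) (u' i))" for i
    proof -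
      let ?m = "mean_inner J w0 (v i)"
      have "2 * mean_inner J (v i) (u i) - mean_inner J (u i) (u i) =
        (2 * \<alpha> i * ?m - (\<alpha> i)\<^sup>2 * ?n) + (2 * mean_inner J (v i) (u' i) - mean_inner J (u' i) (u' i))"
        unfolding u_eq using orth[of i]
        by (simp add: mean_inner_simps mean_inner_commute[of J w0 "u' i"] mean_inner_commute[of J "v i" w0]
            power2_eq_square algebra_simps)
      moreover have "2 * \<alpha> i * ?m - (\<alpha> i)\<^sup>2 * ?n \<le> ?m\<^sup>2 / ?n"
      proof -
        have "0 \<le> (?m - \<alpha> i * ?n)\<^sup>2 / ?n" using n by simp
        also have "\<dots> = ?m\<^sup>2 / ?n - (2 * \<alpha> i * ?m - (\<alpha> i)\<^sup>2 * ?n)"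
          using n by (simp add: power2_eq_square field_simps)
        finally show ?thesis by simp
      qed
      ultimately show ?thesis by simp
    qed
    have "(\<Sum>i\<in>I. 2 * mean_inner J (v i) (u i) - mean_inner J (u i) (u i)) \<le>
      (\<Sum>i\<in>I. (mean_inner J w0 (v i))\<^sup>2) / ?n +
      (\<Sum>i\<in>I. 2 * mean_inner J (v i) (u' i) - mean_inner J (u' i) (u' i))"
      using sum_mono[where K = I, OF one] by (simp only: sum.distrib sum_divide_distrib)
    also have "\<dots> \<le> C + C * card Bs"
    proof (rule add_mono)
      show "(\<Sum>i\<in>I. (mean_inner J w0 (v i))\<^sup>2) / ?n \<le> C"
        using bessel[of w0] n by (simp add: field_simps)
      show "(\<Sum>i\<in>I. 2 * mean_inner J (v i) (u' i) - mean_inner J (u' i) (u' i)) \<le> C * card Bs"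
        by (rule insert.IH[of u' w']) (simp add: u'_def)
    qed
    also have "\<dots> = C * card (insert b0 Bs)" using insert by (simp add: algebra_simps)
    finally show ?thesis .
  qed
qed

text \<open>Expands the square of \<open>f - t * g\<close>, where \<open>g\<close> is what would be
  the projection of \<open>f\<close> if the family were orthonormal. The off-diagonal terms of the
  square of \<open>g\<close> cost at most \<open>\<tau> * card I * S\<close> by
  Cauchy-Schwarz.\<close>

lemma almost_orthonormal_bessel:
  fixes v :: "'i \<Rightarrow> 'j \<Rightarrow> 'v::real_inner" and \<tau> :: real
  assumes fin: "finite I" and \<tau>: "\<tau> \<ge> 0"
    and unit: "\<And>i. i \<in> I \<Longrightarrow> mean_inner J (v i) (v i) = 1"
    and orth: "\<And>i i'. i \<in> I \<Longrightarrow> i' \<in> I \<Longrightarrow> i \<noteq> i' \<Longrightarrow> \<bar>mean_inner J (v i) (v i')\<bar> \<le> \<tau>"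
  shows "(\<Sum>i\<in>I. (mean_inner J f (v i))\<^sup>2) \<le> (1 + \<tau> * card I) * mean_inner J f f"
proof -
  define c where "c i = mean_inner J f (v i)" for i
  define S where "S = (\<Sum>i\<in>I. (c i)\<^sup>2)"
  define g where "g j = (\<Sum>i\<in>I. c i *\<^sub>R v i j)" for j
  \<comment> \<open>The minimiser of
    \<open>S * (1 + \<tau> * card I) * t\<^sup>2 - 2 * S * t\<close>.\<close>
  define t where "t = 1 / (1 + \<tau> * card I)"
  have pos: "1 + \<tau> * card I > 0" using \<tau> by (simp add: add_pos_nonneg)
  have S: "S \<ge> 0" by (simp add: S_def sum_nonneg)
  have fg: "mean_inner J f g = S"
    unfolding g_def S_def by (simp add: mean_inner_sum_right mean_inner_scale_right c_def power2_eq_square)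
  have "mean_inner J g g = (\<Sum>i\<in>I. \<Sum>i'\<in>I. c i * c i' * mean_inner J (v i) (v i'))"
  proof -
    have "mean_inner J g g = (\<Sum>i\<in>I. c i * mean_inner J (v i) g)"
      using mean_inner_sum_left[of J "\<lambda>i j. c i *\<^sub>R v i j" I g]
      by (simp add: g_def[abs_def] mean_inner_sum_left mean_inner_scale_left)
    also have "\<dots> = (\<Sum>i\<in>I. c i * (\<Sum>i'\<in>I. c i' * mean_inner J (v i) (v i')))"
      by (simp add: g_def[abs_def] mean_inner_sum_right mean_inner_scale_right)
    finally show ?thesis by (simp add: sum_distrib_left mult.assoc)
  qed
  also have "\<dots> \<le> (\<Sum>i\<in>I. \<Sum>i'\<in>I. (if i = i' then (c i)\<^sup>2 else 0) + \<tau> * (\<bar>c i\<bar> * \<bar>c i'\<bar>))"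
  proof (intro sum_mono)
    fix i i' assume i: "i \<in> I" "i' \<in> I"
    show "c i * c i' * mean_inner J (v i) (v i') \<le> (if i = i' then (c i)\<^sup>2 else 0) + \<tau> * (\<bar>c i\<bar> * \<bar>c i'\<bar>)"
    proof (cases "i = i'")
      case True
      then show ?thesis using unit[OF i(1)] \<tau> by (simp add: power2_eq_square)
    next
      case False
      have "c i * c i' * mean_inner J (v i) (v i') \<le> \<bar>c i * c i'\<bar> * \<bar>mean_inner J (v i) (v i')\<bar>"
        by (metis abs_ge_self abs_mult)
      also have "\<dots> \<le> \<bar>c i * c i'\<bar> * \<tau>" using orth[OF i False] by (intro mult_left_mono) auto
      finally show ?thesis using False by (simp add: abs_mult algebra_simps)
    qed
  qed
  also have "\<dots> = S + \<tau> * (\<Sum>i\<in>I. \<bar>c i\<bar>)\<^sup>2"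
    using fin
    by (simp add: sum.distrib S_def power2_eq_square sum_product flip: sum_distrib_left)
  also have "\<dots> \<le> S + \<tau> * (S * card I)"
    using \<tau> sum_squared_le_sum_of_squares[of "\<lambda>i. \<bar>c i\<bar>" I]
    by (intro add_left_mono mult_left_mono) (auto simp: S_def)
  finally have gg: "mean_inner J g g \<le> S * (1 + \<tau> * card I)" by (simp add: algebra_simps)
  have "0 \<le> mean_inner J (\<lambda>j. f j - t *\<^sub>R g j) (\<lambda>j. f j - t *\<^sub>R g j)" by (rule mean_inner_nonneg)
  also have "\<dots> = mean_inner J f f - 2 * t * S + t\<^sup>2 * mean_inner J g g"
    using fg by (simp add: mean_inner_simps mean_inner_commute[of J g f] power2_eq_square algebra_simps)
  also have "\<dots> \<le> mean_inner J f f - 2 * t * S + t\<^sup>2 * (S * (1 + \<tau> * card I))"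
    using gg by (intro add_left_mono mult_left_mono) auto
  also have "\<dots> = mean_inner J f f - t * S"
    using pos by (simp add: t_def power2_eq_square)
  finally have "t * S \<le> mean_inner J f f" by simp
  then have "S \<le> (1 + \<tau> * card I) * mean_inner J f f"
    using pos by (simp add: t_def field_simps)
  then show ?thesis by (simp add: S_def c_def)
qed

text \<open>Each \<open>i\<close> contributes at least \<open>1 - \<eta>\<^sup>2\<close> to the left
  side of \<open>bessel_rank_bound\<close>, because \<open>v i\<close> is a unit vector within
  \<open>\<eta>\<close> of \<open>u i\<close>.\<close>

lemma almost_orthonormal_rank_bound:
  fixes v :: "'i \<Rightarrow> 'j \<Rightarrow> 'v::real_inner" and w :: "'b \<Rightarrow> 'j \<Rightarrow> 'v" and \<tau> \<eta> :: real
  assumes fin: "finite J" "finite I" "finite Bs" and \<tau>: "\<tau> \<ge> 0"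
    and unit: "\<And>i. i \<in> I \<Longrightarrow> mean_inner J (v i) (v i) = 1"
    and orth: "\<And>i i'. i \<in> I \<Longrightarrow> i' \<in> I \<Longrightarrow> i \<noteq> i' \<Longrightarrow> \<bar>mean_inner J (v i) (v i')\<bar> \<le> \<tau>"
    and u: "\<And>i j. u i j = (\<Sum>b\<in>Bs. a i b *\<^sub>R w b j)"
    and near: "\<And>i j. i \<in> I \<Longrightarrow> j \<in> J \<Longrightarrow> norm (v i j - u i j) \<le> \<eta>"
  shows "card I * (1 - \<eta>\<^sup>2) \<le> (1 + \<tau> * card I) * card Bs"
proof -
  have "(\<Sum>i\<in>I. 1 - \<eta>\<^sup>2) \<le> (\<Sum>i\<in>I. 2 * mean_inner J (v i) (u i) - mean_inner J (u i) (u i))"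
  proof (rule sum_mono)
    fix i assume i: "i \<in> I"
    have "card J \<noteq> 0" using unit[OF i] by (auto simp: mean_inner_def)
    have "mean_inner J (\<lambda>j. v i j - u i j) (\<lambda>j. v i j - u i j) \<le> (\<Sum>j\<in>J. \<eta>\<^sup>2) / card J"
      unfolding mean_inner_def
    proof (intro divide_right_mono sum_mono)
      fix j assume "j \<in> J"
      show "(v i j - u i j) \<bullet> (v i j - u i j) \<le> \<eta>\<^sup>2"
        using near[OF i \<open>j \<in> J\<close>] by (simp add: dot_square_norm power_mono)
    qed simp
    also have "\<dots> = \<eta>\<^sup>2" using \<open>card J \<noteq> 0\<close> by simp
    finally have "mean_inner J (\<lambda>j. v i j - u i j) (\<lambda>j. v i j - u i j) \<le> \<eta>\<^sup>2" .
    moreover have "mean_inner J (\<lambda>j. v i j - u i j) (\<lambda>j. v i j - u i j) =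
        mean_inner J (v i) (v i) - 2 * mean_inner J (v i) (u i) + mean_inner J (u i) (u i)"
      by (simp add: mean_inner_simps mean_inner_commute[of J "u i" "v i"])
    ultimately show "1 - \<eta>\<^sup>2 \<le> 2 * mean_inner J (v i) (u i) - mean_inner J (u i) (u i)"
      using unit[OF i] by simp
  qed
  also have "\<dots> \<le> (1 + \<tau> * card I) * card Bs"
    using \<tau> by (intro bessel_rank_bound[OF fin almost_orthonormal_bessel[OF fin(2) \<tau> unit orth] u]) auto
  finally show ?thesis by simp
qed

section \<open>Dual pairs\<close>

lemma trajectory_empty [simp]: "trajectory l {} E = {0}"
  by (simp add: trajectory_def)

lemma trajectory_insert:
  "finite F \<Longrightarrow> s \<notin> F \<Longrightarrow> trajectory l (insert s F) E = l s ` E + trajectory l F E"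
  by (simp add: trajectory_def)

lemma finite_trajectory: "finite F \<Longrightarrow> finite E \<Longrightarrow> finite (trajectory l F E)"
  by (induction F rule: finite_induct) (auto simp: trajectory_insert intro!: finite_set_plus)

lemma trajectory_alt:
  "finite F \<Longrightarrow> trajectory l F E = {\<Sum>s\<in>F. l s (x s) | x. x \<in> F \<rightarrow>\<^sub>E E}"
proof -
  assume F: "finite F"
  have "trajectory l F E = {\<Sum>s\<in>F. y s | y. \<forall>s\<in>F. y s \<in> l s ` E}"
    unfolding trajectory_def using F by (simp add: set_sum_alt)
  also have "\<dots> = {\<Sum>s\<in>F. l s (x s) | x. x \<in> F \<rightarrow>\<^sub>E E}" (is "?A = ?B")
  proof (intro equalityI subsetI)
    fix z assume "z \<in> ?A"
    then obtain y where y: "z = (\<Sum>s\<in>F. y s)" "\<forall>s\<in>F. y s \<in> l s ` E" by blast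
    then have "\<forall>s\<in>F. \<exists>x\<in>E. y s = l s x" by blast
    then obtain x where "\<forall>s\<in>F. x s \<in> E \<and> y s = l s (x s)" by metis
    then have "z = (\<Sum>s\<in>F. l s (restrict x F s))" "restrict x F \<in> F \<rightarrow>\<^sub>E E"
      using y(1) by auto
    then show "z \<in> ?B" by blast
  next
    fix z assume "z \<in> ?B"
    then obtain x where x: "z = (\<Sum>s\<in>F. l s (x s))" "x \<in> F \<rightarrow>\<^sub>E E" by blast
    show "z \<in> ?A" using x by (intro CollectI exI[of _ "\<lambda>s. l s (x s)"]) auto
  qed
  finally show ?thesis .
qed

lemma zero_in_trajectory:
  assumes "left_action l" "0 \<in> E" "finite F"
  shows "0 \<in> trajectory l F E"
proof -
  have l0: "l s 0 = 0" for s
    using assms(1) by (simp add: left_action_def Modules.additive.zero)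
  have "(\<Sum>s\<in>F. l s (restrict (\<lambda>_. 0) F s)) = 0" by (simp add: l0)
  moreover have "restrict (\<lambda>_. 0) F \<in> F \<rightarrow>\<^sub>E E" using assms(2) by auto
  ultimately show ?thesis unfolding trajectory_alt[OF assms(3)]
    by (intro CollectI exI[of _ "restrict (\<lambda>_. 0) F"]) auto
qed

lemma trajectory_Un_disjoint:
  "finite A \<Longrightarrow> finite B \<Longrightarrow> A \<inter> B = {} \<Longrightarrow> trajectory l (A \<union> B) E = trajectory l A E + trajectory l B E"
  by (simp add: trajectory_def sum.union_disjoint)

lemma trajectory_mono:
  assumes "left_action l" "0 \<in> E" "finite B" "A \<subseteq> B"
  shows "trajectory l A E \<subseteq> trajectory l B E"
proof -
  have "finite A" "finite (B - A)" "A \<union> (B - A) = B" using assms finite_subset by auto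
  then have "trajectory l B E = trajectory l (B - A) E + trajectory l A E"
    using trajectory_Un_disjoint[of A "B - A" l E] by (simp add: add.commute Diff_disjoint)
  then show ?thesis
    using set_zero_plus2[OF zero_in_trajectory[OF assms(1,2) \<open>finite (B - A)\<close>]] by auto
qed

lemma card_set_plus_le:
  assumes "finite A" "finite B"
  shows "card (A + B) \<le> card A * card B"
proof -
  have "card (A + B) \<le> card (A \<times> B)"
    unfolding set_plus_image using assms by (intro card_image_le) auto
  then show ?thesis by (simp add: card_cartesian_product)
qed

lemma card_trajectory_pos:
  assumes "left_action l" "0 \<in> E" "finite F" "finite E"
  shows "card (trajectory l F E) > 0"
  using zero_in_trajectory[OF assms(1-3)] finite_trajectory[OF assms(3,4)]
  by (auto simp: card_gt_0_iff)

text \<open>The pairing has complex values of modulus 1 instead of values in R/Z, because its values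
  get added and averaged. The sort of \<open>'k\<close> asks for a topology and a group structure,
  which is what the type of duals provides.\<close>

locale dual_pair =
  fixes \<rho> :: "'s::monoid_mult \<Rightarrow> 'k::{topological_space, ab_group_add} \<Rightarrow> 'k"
    and l :: "'s \<Rightarrow> 'x::ab_group_add \<Rightarrow> 'x"
    and e :: "'x \<Rightarrow> 'k \<Rightarrow> complex"
  assumes left_cancel: "\<And>a b c :: 's. a * b = a * c \<Longrightarrow> b = c"
    and right_cancel: "\<And>a b c :: 's. b * a = c * a \<Longrightarrow> b = c"
    and amenable: "right_amenable TYPE('s)"
    and compact: "compact (UNIV :: 'k set)"
    and cont_\<rho>: "\<And>s. continuous_on UNIV (\<rho> s)"
    and \<rho>_mult: "\<And>s t. \<rho> (s * t) = \<rho> t \<circ> \<rho> s"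
    and left: "left_action l"
    and e_add: "\<And>x y k. e (x + y) k = e x k * e y k"
    and e_add_right: "\<And>x k k'. e x (k + k') = e x k * e x k'"
    and norm_e: "\<And>x k. norm (e x k) = 1"
    and cont_e: "\<And>x. continuous_on UNIV (e x)"
    and faithful: "\<And>x. (\<And>k. e x k = 1) \<Longrightarrow> x = 0"
    and separating: "\<And>k. (\<And>x. e x k = 1) \<Longrightarrow> k = 0"
    and adjoint: "\<And>s x k. e (l s x) k = e x (\<rho> s k)"
begin

sublocale amenable_cancel_monoid "TYPE('s)"
  using left_cancel right_cancel amenable by unfold_locales

lemma e_nz [simp]: "e x k \<noteq> 0"
  using norm_e[of x k] by auto

lemma e_zero [simp]: "e 0 k = 1"
  using e_add[of 0 0 k] by simp

lemma e_zero_right [simp]: "e x 0 = 1"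
  using e_add_right[of x 0 0] by simp

lemma e_diff_right: "e x (k - k') = e x k / e x k'"
  using e_add_right[of x "k - k'" k'] by (simp add: field_simps)

lemma e_diff: "e (x - y) k = e x k / e y k"
  using e_add[of "x - y" y k] by (simp add: field_simps)

lemma e_sum: "e (\<Sum>i\<in>I. f i) k = (\<Prod>i\<in>I. e (f i) k)"
  by (induction I rule: infinite_finite_induct) (auto simp: e_add)

lemma e_sum_right: "e x (\<Sum>i\<in>I. f i) = (\<Prod>i\<in>I. e x (f i))"
  by (induction I rule: infinite_finite_induct) (auto simp: e_add_right)

lemma norm_e_diff: "norm (e x k - e x k') = norm (e x (k - k') - 1)"
proof -
  have "e x k - e x k' = e x k' * (e x (k - k') - 1)" by (simp add: e_diff_right field_simps)
  then show ?thesis by (simp add: norm_mult norm_e)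
qed

subsection \<open>Subadditivity\<close>

text \<open>The trajectory over a translate by \<open>s\<close> lies in the image under
  \<open>l s\<close> of the original one. Over \<open>A \<union> B\<close> it is the sum of those
  over \<open>A\<close> and \<open>B - A\<close>, and \<open>0 \<in> E\<close> makes trajectories
  grow with the index set.\<close>

lemma subinvariant_trajectory:
  assumes E: "finite E" "0 \<in> E"
  shows "subinvariant (\<lambda>F. ln (real (card (trajectory l F E))))"
  unfolding subinvariant_def
proof (intro conjI allI impI)
  note fin = finite_trajectory[OF _ E(1), of _ l] and pos = card_trajectory_pos[OF left E(2) _ E(1)]
  show "ln (real (card (trajectory l {} E))) = 0" by simp
  fix A :: "'s set" assume A: "finite A"
  show "0 \<le> ln (real (card (trajectory l A E)))" using pos[OF A] by simp
  show "ln (real (card (trajectory l ((*) s ` A) E))) \<le> ln (real (card (trajectory l A E)))" for s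
  proof -
    have "trajectory l ((*) s ` A) E = (\<Sum>t\<in>A. l (s * t) ` E)"
      unfolding trajectory_def by (subst sum.reindex) (auto intro!: inj_onI dest: left_cancel)
    also have "\<dots> = (\<Sum>t\<in>A. l s ` l t ` E)"
      using left by (simp add: left_action_def image_comp)
    also have "\<dots> \<subseteq> l s ` trajectory l A E"
    proof
      fix y assume "y \<in> (\<Sum>t\<in>A. l s ` l t ` E)"
      then obtain z where z: "y = (\<Sum>t\<in>A. z t)" "\<forall>t\<in>A. z t \<in> l s ` l t ` E"
        using A by (auto simp: set_sum_alt)
      have "\<forall>t\<in>A. \<exists>w. z t = l s w \<and> w \<in> l t ` E" using z(2) by blast
      then obtain w where w: "\<forall>t\<in>A. z t = l s (w t) \<and> w t \<in> l t ` E" by metis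
      have "y = l s (\<Sum>t\<in>A. w t)"
        using left w z(1) by (simp add: left_action_def Modules.additive.sum)
      moreover have "(\<Sum>t\<in>A. w t) \<in> trajectory l A E"
        unfolding trajectory_def using A w by (auto simp: set_sum_alt)
      ultimately show "y \<in> l s ` trajectory l A E" by blast
    qed
    finally have "card (trajectory l ((*) s ` A) E) \<le> card (trajectory l A E)"
      using fin[OF A] by (meson card_image_le card_mono finite_imageI le_trans)
    then show ?thesis using pos[of "(*) s ` A"] A by simp
  qed
  fix B :: "'s set" assume B: "finite B"
  have "trajectory l (A \<union> B) E = trajectory l A E + trajectory l (B - A) E"
    using trajectory_Un_disjoint[of A "B - A" l E] A B by simp
  then have "card (trajectory l (A \<union> B) E) \<le> card (trajectory l A E) * card (trajectory l (B - A) E)"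
    using card_set_plus_le[OF fin[OF A] fin[of "B - A"]] B by simp
  also have "\<dots> \<le> card (trajectory l A E) * card (trajectory l B E)"
    using trajectory_mono[OF left E(2) B, of "B - A"] fin[OF B] by (simp add: card_mono)
  finally have "real (card (trajectory l (A \<union> B) E)) \<le> card (trajectory l A E) * card (trajectory l B E)"
    by (simp only: of_nat_le_iff flip: of_nat_mult)
  then have "ln (real (card (trajectory l (A \<union> B) E))) \<le> ln (real (card (trajectory l A E) * card (trajectory l B E)))"
    using pos[of "A \<union> B"] A B by (intro ln_mono) auto
  then show "ln (real (card (trajectory l (A \<union> B) E))) \<le>
      ln (real (card (trajectory l A E))) + ln (real (card (trajectory l B E)))"
    using pos[OF A] pos[OF B] by (simp add: ln_mult)
qed

lemma cover_refineI: "(\<And>s. s \<in> F \<Longrightarrow> V s \<in> \<U>) \<Longrightarrow> (\<Inter>s\<in>F. \<rho> s -` V s) \<in> cover_refine \<rho> F \<U>"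
  by (auto simp: cover_refine_def cover_join_def)

lemma cover_refineE:
  assumes "W \<in> cover_refine \<rho> F \<U>"
  obtains V where "W = (\<Inter>s\<in>F. \<rho> s -` V s)" "\<forall>s\<in>F. V s \<in> \<U>"
proof -
  obtain V where V: "W = (\<Inter>s\<in>F. V s)" "\<forall>s\<in>F. V s \<in> (\<lambda>U. \<rho> s -` U) ` \<U>"
    using assms by (force simp: cover_refine_def cover_join_def)
  then have "\<forall>s\<in>F. \<exists>U. U \<in> \<U> \<and> V s = \<rho> s -` U" by blast
  then obtain U where "\<forall>s\<in>F. U s \<in> \<U> \<and> V s = \<rho> s -` U s" by (rule bchoice[THEN exE])
  then show thesis using that[of U] V(1) by auto
qed

text \<open>Compactness keeps the infimum in \<open>cover_number\<close> from ranging over the empty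
  set, where its value would be 0.\<close>

lemma cover_refine_subcover:
  assumes U: "open_cover \<U>" and F: "finite F"
  obtains \<W> where "\<W> \<subseteq> cover_refine \<rho> F \<U>" "finite \<W>" "\<Union>\<W> = UNIV"
    "card \<W> = cover_number (cover_refine \<rho> F \<U>)"
proof -
  have "open W" if W: "W \<in> cover_refine \<rho> F \<U>" for W
  proof -
    obtain V where V: "W = (\<Inter>s\<in>F. \<rho> s -` V s)" "\<forall>s\<in>F. V s \<in> \<U>"
      using W by (rule cover_refineE)
    have "open (\<rho> s -` V s)" if "s \<in> F" for s
      using U bspec[OF V(2) that] cont_\<rho>[of s] by (intro open_vimage) (auto simp: open_cover_def)
    then show ?thesis using V F by (simp add: open_INT)
  qed
  moreover have "UNIV \<subseteq> \<Union> (cover_refine \<rho> F \<U>)"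
  proof
    fix k
    have "\<forall>s. \<exists>U\<in>\<U>. \<rho> s k \<in> U" using U by (auto simp: open_cover_def)
    then obtain V where "\<And>s. V s \<in> \<U> \<and> \<rho> s k \<in> V s" by metis
    then have "k \<in> (\<Inter>s\<in>F. \<rho> s -` V s)" "(\<Inter>s\<in>F. \<rho> s -` V s) \<in> cover_refine \<rho> F \<U>"
      by (auto simp: cover_refine_def cover_join_def)
    then show "k \<in> \<Union> (cover_refine \<rho> F \<U>)" by blast
  qed
  ultimately obtain \<W> where "\<W> \<subseteq> cover_refine \<rho> F \<U>" "finite \<W>" "UNIV \<subseteq> \<Union>\<W>"
    using compactE[OF compact] by metis
  then have "\<W> \<subseteq> cover_refine \<rho> F \<U>" "finite \<W>" "\<Union>\<W> = UNIV" by auto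
  then show thesis by (rule cover_number_attained) (rule that)
qed

lemma cover_number_refine_pos:
  assumes "open_cover \<U>" "finite F"
  shows "cover_number (cover_refine \<rho> F \<U>) > 0"
proof -
  obtain \<W> where \<W>: "finite \<W>" "\<Union>\<W> = (UNIV :: 'k set)" "card \<W> = cover_number (cover_refine \<rho> F \<U>)"
    by (rule cover_refine_subcover[OF assms])
  have "\<W> \<noteq> {}" using \<W>(2) by auto
  then show ?thesis using \<W> by (simp add: card_gt_0_iff flip: \<W>(3))
qed

text \<open>Pulling a subcover for \<open>A\<close> back along \<open>\<rho> s\<close> gives one for
  the translate, because \<open>\<rho> (s * t)\<close> first applies \<open>\<rho> s\<close>;
  pairwise intersections of subcovers serve the union.\<close>

lemma subinvariant_cover:
  assumes U: "open_cover \<U>"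
  shows "subinvariant (\<lambda>F. ln (real (cover_number (cover_refine \<rho> F \<U>))))"
  unfolding subinvariant_def
proof (intro conjI allI impI)
  note pos = cover_number_refine_pos[OF U]
  have "cover_number (cover_refine \<rho> {} \<U>) \<le> card {UNIV :: 'k set}"
    by (rule cover_number_le) (auto simp: cover_refine_def cover_join_def)
  then have "cover_number (cover_refine \<rho> {} \<U>) = 1" using pos[of "{}"] by simp
  then show "ln (real (cover_number (cover_refine \<rho> {} \<U>))) = 0" by simp
  fix A :: "'s set" assume A: "finite A"
  show "0 \<le> ln (real (cover_number (cover_refine \<rho> A \<U>)))" using pos[OF A] by simp
  obtain \<W> where \<W>: "\<W> \<subseteq> cover_refine \<rho> A \<U>" "finite \<W>" "\<Union>\<W> = UNIV"
    "card \<W> = cover_number (cover_refine \<rho> A \<U>)"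
    by (rule cover_refine_subcover[OF U A])
  show "ln (real (cover_number (cover_refine \<rho> ((*) s ` A) \<U>))) \<le>
      ln (real (cover_number (cover_refine \<rho> A \<U>)))" for s
  proof -
    have "cover_number (cover_refine \<rho> ((*) s ` A) \<U>) \<le> card ((\<lambda>W. \<rho> s -` W) ` \<W>)"
    proof (rule cover_number_le)
      show "\<Union> ((\<lambda>W. \<rho> s -` W) ` \<W>) = UNIV" using \<W>(3) by (metis vimage_UNIV vimage_Union)
      fix W' assume "W' \<in> (\<lambda>W. \<rho> s -` W) ` \<W>"
      then obtain W where W: "W \<in> \<W>" "W' = \<rho> s -` W" by (rule imageE)
      obtain V where V: "W = (\<Inter>t\<in>A. \<rho> t -` V t)" "\<forall>t\<in>A. V t \<in> \<U>"
        by (rule cover_refineE[OF subsetD[OF \<W>(1) W(1)]])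
      \<comment> \<open>Left cancellation recovers \<open>t\<close> from \<open>s * t\<close>, so
        the choice \<open>V\<close> can be carried over to the translate.\<close>
      define V' where "V' u = V (THE t. u = s * t)" for u
      have the: "(THE t. s * t' = s * t) = t'" for t'
        by (rule the_equality) (auto dest: left_cancel)
      have "W' = (\<Inter>u\<in>(*) s ` A. \<rho> u -` V' u)"
        using W(2) V(1) by (auto simp: V'_def the \<rho>_mult)
      moreover have "(\<Inter>u\<in>(*) s ` A. \<rho> u -` V' u) \<in> cover_refine \<rho> ((*) s ` A) \<U>"
        using V(2) by (intro cover_refineI) (auto simp: V'_def the)
      ultimately show "\<exists>V\<in>cover_refine \<rho> ((*) s ` A) \<U>. W' \<subseteq> V" by blast
    qed (use \<W> in auto)
    also have "\<dots> \<le> card \<W>" using \<W> by (intro card_image_le)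
    finally show ?thesis using \<W>(4) pos[of "(*) s ` A"] A by simp
  qed
  fix B :: "'s set" assume B: "finite B"
  obtain \<W>' where \<W>': "\<W>' \<subseteq> cover_refine \<rho> B \<U>" "finite \<W>'" "\<Union>\<W>' = UNIV"
    "card \<W>' = cover_number (cover_refine \<rho> B \<U>)"
    by (rule cover_refine_subcover[OF U B])
  have "cover_number (cover_refine \<rho> (A \<union> B) \<U>) \<le> card ((\<lambda>(V, W). V \<inter> W) ` (\<W> \<times> \<W>'))"
  proof (rule cover_number_le)
    show "finite ((\<lambda>(V, W). V \<inter> W) ` (\<W> \<times> \<W>'))" using \<W> \<W>' by simp
    show "\<Union> ((\<lambda>(V, W). V \<inter> W) ` (\<W> \<times> \<W>')) = UNIV"
    proof (intro equalityI subsetI UNIV_I)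
      fix k
      have "k \<in> \<Union>\<W>" "k \<in> \<Union>\<W>'" using \<W>(3) \<W>'(3) by simp_all
      then obtain V W where "k \<in> V" "V \<in> \<W>" "k \<in> W" "W \<in> \<W>'" by (elim UnionE)
      then show "k \<in> \<Union> ((\<lambda>(V, W). V \<inter> W) ` (\<W> \<times> \<W>'))" by auto
    qed
    fix Q assume "Q \<in> (\<lambda>(V, W). V \<inter> W) ` (\<W> \<times> \<W>')"
    then obtain V W where VW: "V \<in> \<W>" "W \<in> \<W>'" "Q = V \<inter> W" by auto
    obtain f where f: "V = (\<Inter>t\<in>A. \<rho> t -` f t)" "\<forall>t\<in>A. f t \<in> \<U>"
      by (rule cover_refineE[OF subsetD[OF \<W>(1) VW(1)]])
    obtain g where g: "W = (\<Inter>t\<in>B. \<rho> t -` g t)" "\<forall>t\<in>B. g t \<in> \<U>"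
      by (rule cover_refineE[OF subsetD[OF \<W>'(1) VW(2)]])
    \<comment> \<open>A refined cover has one chosen set per coordinate; on the common part of
      \<open>A\<close> and \<open>B\<close> the second choice is dropped, hence an inclusion instead
      of an equality.\<close>
    have "Q \<subseteq> (\<Inter>t\<in>A \<union> B. \<rho> t -` (if t \<in> A then f t else g t))"
      using VW(3) f(1) g(1) by auto
    moreover have "(\<Inter>t\<in>A \<union> B. \<rho> t -` (if t \<in> A then f t else g t)) \<in> cover_refine \<rho> (A \<union> B) \<U>"
      using f(2) g(2) by (intro cover_refineI) auto
    ultimately show "\<exists>V\<in>cover_refine \<rho> (A \<union> B) \<U>. Q \<subseteq> V" by blast
  qed
  also have "\<dots> \<le> card (\<W> \<times> \<W>')" using \<W> \<W>' by (intro card_image_le) auto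
  also have "\<dots> = cover_number (cover_refine \<rho> A \<U>) * cover_number (cover_refine \<rho> B \<U>)"
    using \<W>(4) \<W>'(4) by (simp add: card_cartesian_product)
  finally have "real (cover_number (cover_refine \<rho> (A \<union> B) \<U>)) \<le>
      cover_number (cover_refine \<rho> A \<U>) * cover_number (cover_refine \<rho> B \<U>)"
    by (simp only: of_nat_le_iff flip: of_nat_mult)
  then have "ln (real (cover_number (cover_refine \<rho> (A \<union> B) \<U>))) \<le>
      ln (real (cover_number (cover_refine \<rho> A \<U>) * cover_number (cover_refine \<rho> B \<U>)))"
    using pos[of "A \<union> B"] A B by (intro ln_mono) auto
  then show "ln (real (cover_number (cover_refine \<rho> (A \<union> B) \<U>))) \<le>
      ln (real (cover_number (cover_refine \<rho> A \<U>))) + ln (real (cover_number (cover_refine \<rho> B \<U>)))"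
    using pos[OF A] pos[OF B] by (simp add: ln_mult)
qed

end

context dual_pair
begin

subsection \<open>Bohr neighbourhoods\<close>

definition bohr :: "real \<Rightarrow> 'x set \<Rightarrow> 'k \<Rightarrow> 'k set" where
  "bohr \<epsilon> E k = {k'. \<forall>x\<in>E. norm (e x k - e x k') < \<epsilon>}"

lemma open_bohr:
  assumes "finite E"
  shows "open (bohr \<epsilon> E k)"
proof -
  have "open {k'. norm (e x k - e x k') < \<epsilon>}" for x
    by (intro open_Collect_less continuous_intros cont_e)
  then have "open (\<Inter>x\<in>E. {k'. norm (e x k - e x k') < \<epsilon>})"
    using assms by (intro open_INT) auto
  also have "(\<Inter>x\<in>E. {k'. norm (e x k - e x k') < \<epsilon>}) = bohr \<epsilon> E k" by (auto simp: bohr_def)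
  finally show ?thesis .
qed

lemma bohr_self: "\<epsilon> > 0 \<Longrightarrow> k \<in> bohr \<epsilon> E k"
  by (simp add: bohr_def)

lemma bohr_mono: "\<epsilon> \<le> \<epsilon>' \<Longrightarrow> E' \<subseteq> E \<Longrightarrow> bohr \<epsilon> E k \<subseteq> bohr \<epsilon>' E' k"
  by (force simp: bohr_def)

lemma bohr_triangle:
  assumes "k' \<in> bohr \<epsilon> E k" "k'' \<in> bohr \<epsilon>' E k'"
  shows "k'' \<in> bohr (\<epsilon> + \<epsilon>') E k"
  unfolding bohr_def
proof (intro CollectI ballI)
  fix x assume "x \<in> E"
  then have "norm (e x k - e x k') < \<epsilon>" "norm (e x k' - e x k'') < \<epsilon>'"
    using assms by (auto simp: bohr_def)
  then show "norm (e x k - e x k'') < \<epsilon> + \<epsilon>'"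
    using norm_triangle_ineq[of "e x k - e x k'" "e x k' - e x k''"] by simp
qed

lemma bohr_commute: "k' \<in> bohr \<epsilon> E k \<longleftrightarrow> k \<in> bohr \<epsilon> E k'"
  by (simp add: bohr_def norm_minus_commute)

text \<open>Each point of the compact complement of \<open>U\<close> is separated from
  \<open>k\<close> by a character, strictly and hence on an open set; finitely many such characters
  suffice. The topology is thus the one induced by the characters.\<close>

lemma ex_bohr_subset:
  assumes "open U" "k \<in> U"
  shows "\<exists>E \<epsilon>. finite E \<and> \<epsilon> > 0 \<and> bohr \<epsilon> E k \<subseteq> U"
proof -
  have comp: "compact (- U)" using compact_Int_closed[OF compact, of "- U"] assms(1)
    by (simp add: closed_def)
  define N where "N p = {k'. norm (e (fst p) k - e (fst p) k') > snd p}" for p :: "'x \<times> real"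
  obtain P where P: "P \<subseteq> {p. snd p > 0}" "finite P" "- U \<subseteq> (\<Union>p\<in>P. N p)"
  proof (rule compactE_image[OF comp, of "{p. snd p > 0}" N])
    show "open (N p)" for p
      unfolding N_def by (intro open_Collect_less continuous_intros cont_e)
    show "- U \<subseteq> (\<Union>p\<in>{p. snd p > 0}. N p)"
    proof
      fix k' assume "k' \<in> - U"
      then have "k - k' \<noteq> 0" using assms(2) by auto
      then obtain x where "e x (k - k') \<noteq> 1" using separating by blast
      then have "norm (e x k - e x k') > 0" unfolding norm_e_diff by simp
      then have "k' \<in> N (x, norm (e x k - e x k') / 2)" "norm (e x k - e x k') / 2 > 0"
        by (simp_all add: N_def)
      then show "k' \<in> (\<Union>p\<in>{p. snd p > 0}. N p)"
        by (intro UN_I[of "(x, norm (e x k - e x k') / 2)"]) auto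
    qed
  qed
  \<comment> \<open>The inserted 1 keeps \<open>Min\<close> meaningful when \<open>P\<close> is
    empty.\<close>
  define \<epsilon> where "\<epsilon> = Min (insert 1 (snd ` P))"
  have \<epsilon>: "\<epsilon> > 0" "\<And>p. p \<in> P \<Longrightarrow> \<epsilon> \<le> snd p"
    using P by (auto simp: \<epsilon>_def)
  have "bohr \<epsilon> (fst ` P) k \<subseteq> U"
  proof (rule ccontr)
    assume "\<not> bohr \<epsilon> (fst ` P) k \<subseteq> U"
    then obtain k' where k': "k' \<in> bohr \<epsilon> (fst ` P) k" "k' \<in> - U" by auto
    from subsetD[OF P(3) k'(2)] obtain p where p: "p \<in> P" "k' \<in> N p" by (rule UN_E)
    have "norm (e (fst p) k - e (fst p) k') < \<epsilon>" using k'(1) p(1) by (auto simp: bohr_def)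
    then show False using p \<epsilon>(2)[OF p(1)] by (simp add: N_def)
  qed
  then show ?thesis using P \<epsilon> by (intro exI[of _ "fst ` P"] exI[of _ \<epsilon>]) simp
qed

text \<open>The Lebesgue number argument with Bohr neighbourhoods in the place of balls, since the
  group need not be metrizable.\<close>

lemma bohr_Lebesgue:
  assumes U: "open_cover \<U>"
  obtains E \<epsilon> where "finite E" "\<epsilon> > 0" "\<epsilon> \<le> 1" "\<And>k. \<exists>U\<in>\<U>. bohr \<epsilon> E k \<subseteq> U"
proof -
  have "\<exists>E \<epsilon> U. finite E \<and> \<epsilon> > 0 \<and> U \<in> \<U> \<and> bohr \<epsilon> E k \<subseteq> U" for k
  proof -
    have "k \<in> \<Union>\<U>" using U by (simp add: open_cover_def)
    then obtain U where "U \<in> \<U>" "k \<in> U" by (elim UnionE)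
    then show ?thesis using ex_bohr_subset[of U k] U by (auto simp: open_cover_def)
  qed
  then obtain E \<epsilon> U where E: "\<And>k. finite (E k)" "\<And>k. \<epsilon> k > 0" "\<And>k. U k \<in> \<U>"
    "\<And>k. bohr (\<epsilon> k) (E k) k \<subseteq> U k" by metis
  obtain C where C: "finite C" "(UNIV :: 'k set) \<subseteq> (\<Union>k\<in>C. bohr (\<epsilon> k / 2) (E k) k)"
  proof (rule compactE_image[OF compact, of UNIV "\<lambda>k. bohr (\<epsilon> k / 2) (E k) k"])
    show "UNIV \<subseteq> (\<Union>k. bohr (\<epsilon> k / 2) (E k) k)"
      using E(2) bohr_self[of "\<epsilon> _ / 2"] by (intro subsetI UN_I) auto
  qed (auto intro: open_bohr E)
  \<comment> \<open>Half radii leave room for the triangle inequality below; the inserted 1 yields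
    \<open>\<epsilon>' \<le> 1\<close>.\<close>
  define \<epsilon>' where "\<epsilon>' = Min (insert 1 ((\<lambda>k. \<epsilon> k / 2) ` C))"
  have \<epsilon>': "\<epsilon>' > 0" "\<epsilon>' \<le> 1" using C(1) E(2) by (auto simp: \<epsilon>'_def)
  have \<epsilon>'_le: "\<epsilon>' \<le> \<epsilon> k / 2" if "k \<in> C" for k
    unfolding \<epsilon>'_def using C(1) that by (intro Min_le) auto
  show thesis
  proof (rule that[of "\<Union>k\<in>C. E k" \<epsilon>'])
    fix k
    obtain c where c: "c \<in> C" "k \<in> bohr (\<epsilon> c / 2) (E c) c" using subsetD[OF C(2) UNIV_I, of k] by (rule UN_E)
    have "bohr \<epsilon>' (\<Union>k\<in>C. E k) k \<subseteq> bohr (\<epsilon> c / 2) (E c) k"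
      using c \<epsilon>'_le by (intro bohr_mono) auto
    also have "\<dots> \<subseteq> bohr (\<epsilon> c) (E c) c"
      using bohr_triangle[OF c(2), of _ "\<epsilon> c / 2"] by auto
    also have "\<dots> \<subseteq> U c" by (rule E(4))
    finally show "\<exists>U\<in>\<U>. bohr \<epsilon>' (\<Union>k\<in>C. E k) k \<subseteq> U" using E(3) by blast
  qed (use C E \<epsilon>' in auto)
qed

lemma ex_cells:
  assumes "finite E" "\<epsilon> > 0"
  obtains C c where "finite C" "\<And>k. c k \<in> C" "\<And>k. k \<in> bohr \<epsilon> E (c k)"
proof -
  obtain C where C: "finite C" "(UNIV :: 'k set) \<subseteq> (\<Union>k\<in>C. bohr \<epsilon> E k)"
  proof (rule compactE_image[OF compact, of UNIV "bohr \<epsilon> E"])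
    show "UNIV \<subseteq> (\<Union>k. bohr \<epsilon> E k)"
      using assms(2) bohr_self by (intro subsetI UN_I) auto
  qed (auto intro: open_bohr assms)
  have "\<exists>c\<in>C. k \<in> bohr \<epsilon> E c" for k using subsetD[OF C(2) UNIV_I[of k]] by (rule UN_E) (rule bexI)
  then obtain c where "\<And>k. c k \<in> C \<and> k \<in> bohr \<epsilon> E (c k)" by metis
  then show thesis using that[of C c] C(1) by blast
qed

subsection \<open>The algebraic entropy is at most the topological one\<close>

text \<open>Each nonzero \<open>\<xi>\<close> has a point \<open>b \<xi>\<close> where it differs
  from 1. Over the box of all combinations of these points with coefficients below \<open>n\<close>,
  the sum of \<open>\<xi>\<close> factors into geometric sums, and the factor of
  \<open>b \<xi>\<close> stays bounded as \<open>n\<close> grows. One box serves all of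
  \<open>\<Xi>\<close>.\<close>

lemma ex_averaging:
  fixes \<tau> :: real
  assumes \<Xi>: "finite \<Xi>" "0 \<notin> \<Xi>" and \<tau>: "\<tau> > 0"
  obtains J :: "('x \<Rightarrow> nat) set" and p where "finite J" "J \<noteq> {}"
    "\<And>\<xi>. \<xi> \<in> \<Xi> \<Longrightarrow> norm (\<Sum>j\<in>J. e \<xi> (p j)) \<le> \<tau> * card J"
proof -
  have "\<exists>k. e \<xi> k \<noteq> 1" if "\<xi> \<in> \<Xi>" for \<xi> using faithful[of \<xi>] that \<Xi>(2) by blast
  then obtain b where b: "\<And>\<xi>. \<xi> \<in> \<Xi> \<Longrightarrow> e \<xi> (b \<xi>) \<noteq> 1" by metis
  \<comment> \<open>A bound, independent of \<open>n\<close>, for the geometric sum with ratio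
    \<open>e \<xi> (b \<xi>)\<close>.\<close>
  define g where "g \<xi> = 2 / norm (e \<xi> (b \<xi>) - 1)" for \<xi>
  have g: "g \<xi> \<ge> 0" for \<xi> by (simp add: g_def)
  obtain n :: nat where n: "(\<Sum>\<xi>\<in>\<Xi>. g \<xi>) / \<tau> < n" using reals_Archimedean2 by blast
  have sum_g: "(\<Sum>\<xi>\<in>\<Xi>. g \<xi>) < \<tau> * n" using n \<tau> by (simp add: field_simps)
  have n0: "n > 0"
  proof (rule ccontr)
    assume "\<not> n > 0"
    then show False using sum_g sum_nonneg[of \<Xi> g] g by simp
  qed
  define J where "J = (\<Pi>\<^sub>E \<xi>\<in>\<Xi>. {..<n})"
  define p where "p j = (\<Sum>x\<in>\<Xi>. \<Sum>i<j x. b x)" for j :: "'x \<Rightarrow> nat"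
  have cardJ: "card J = n ^ card \<Xi>" unfolding J_def using \<Xi> by (simp add: card_PiE)
  show thesis
  proof (rule that[of J p])
    show "finite J" unfolding J_def using \<Xi> by (intro finite_PiE) auto
    show "J \<noteq> {}" unfolding J_def using n0 by (auto simp: PiE_eq_empty_iff)
    fix \<xi> assume \<xi>: "\<xi> \<in> \<Xi>"
    have "(\<Sum>j\<in>J. e \<xi> (p j)) = (\<Sum>j\<in>J. \<Prod>x\<in>\<Xi>. e \<xi> (b x) ^ j x)"
      by (simp add: p_def e_sum_right)
    also have "\<dots> = (\<Prod>x\<in>\<Xi>. \<Sum>i<n. e \<xi> (b x) ^ i)"
      unfolding J_def using \<Xi> by (subst prod_sum_PiE) auto
    also have "norm \<dots> = (\<Prod>x\<in>\<Xi>. norm (\<Sum>i<n. e \<xi> (b x) ^ i))" by (simp add: prod_norm)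
    also have "\<dots> = norm (\<Sum>i<n. e \<xi> (b \<xi>) ^ i) * (\<Prod>x\<in>\<Xi> - {\<xi>}. norm (\<Sum>i<n. e \<xi> (b x) ^ i))"
      using \<Xi> \<xi> by (simp add: prod.remove)
    also have "\<dots> \<le> (\<tau> * n) * (\<Prod>x\<in>\<Xi> - {\<xi>}. real n)"
    proof (intro mult_mono prod_mono conjI norm_ge_zero prod_nonneg)
      have "norm (\<Sum>i<n. e \<xi> (b \<xi>) ^ i) = norm (e \<xi> (b \<xi>) ^ n - 1) / norm (e \<xi> (b \<xi>) - 1)"
        using b[OF \<xi>] by (simp add: geometric_sum norm_divide)
      also have "\<dots> \<le> g \<xi>"
        unfolding g_def
        by (intro divide_right_mono order_trans[OF norm_triangle_ineq4]) (auto simp: norm_power norm_e)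
      also have "\<dots> \<le> (\<Sum>\<xi>\<in>\<Xi>. g \<xi>)" using \<Xi> \<xi> g by (intro member_le_sum) auto
      finally show "norm (\<Sum>i<n. e \<xi> (b \<xi>) ^ i) \<le> \<tau> * n" using sum_g by simp
      fix x
      have "norm (\<Sum>i<n. e \<xi> (b x) ^ i) \<le> (\<Sum>i<n. 1)"
        by (intro sum_norm_le) (simp add: norm_power norm_e)
      then show "norm (\<Sum>i<n. e \<xi> (b x) ^ i) \<le> n" by simp
    qed (use \<tau> in auto)
    also have "\<dots> = \<tau> * card J"
      using card.remove[OF \<Xi>(1) \<xi>] by (simp add: cardJ)
    finally show "norm (\<Sum>j\<in>J. e \<xi> (p j)) \<le> \<tau> * card J" .
  qed
qed

lemma e_inner: "(a * e \<xi> k) \<bullet> (b * e \<xi>' k) = Re (a * cnj b * e (\<xi> - \<xi>') k)"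
proof -
  have "e \<xi>' k * cnj (e \<xi>' k) = 1" by (simp add: complex_norm_square[symmetric] norm_e)
  then have "cnj (e \<xi>' k) = 1 / e \<xi>' k" by (simp add: field_simps)
  then have "e \<xi> k * cnj (e \<xi>' k) = e (\<xi> - \<xi>') k" by (simp add: e_diff)
  then have "Re (a * cnj b * e (\<xi> - \<xi>') k) = Re ((a * e \<xi> k) * cnj (b * e \<xi>' k))"
    by (metis complex_cnj_mult mult.assoc mult.left_commute)
  then show ?thesis by (simp add: inner_complex_def algebra_simps)
qed

text \<open>The real rank bound is applied after doubling both sides by the factors \<open>1\<close> and \<open>\<i>\<close>, which avoids
  the loss of a factor 2; constants matter here because the monoid may be finite.\<close>

lemma card_characters_le_rank:
  fixes \<eta> :: real
  assumes fin: "finite T" "finite Bs"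
    and near: "\<And>\<xi> k. \<xi> \<in> T \<Longrightarrow> norm (e \<xi> k - (\<Sum>b\<in>Bs. a \<xi> b * w b k)) \<le> \<eta>"
  shows "card T * (1 - \<eta>\<^sup>2) \<le> card Bs"
proof -
  define \<theta> where "\<theta> c = (if c then 1 else \<i>)" for c :: bool
  have \<theta>: "norm (\<theta> c) = 1" for c by (simp add: \<theta>_def)
  have bound: "card T * (1 - \<eta>\<^sup>2) \<le> card Bs * (1 + \<tau> * (2 * card T))" if \<tau>: "\<tau> > 0" for \<tau> :: real
  proof -
    define \<Xi> where "\<Xi> = (\<lambda>(\<xi>, \<xi>'). \<xi> - \<xi>') ` (T \<times> T) - {0}"
    have "finite \<Xi>" "0 \<notin> \<Xi>" using fin by (auto simp: \<Xi>_def)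
    then obtain J :: "('x \<Rightarrow> nat) set" and p where J: "finite J" "J \<noteq> {}"
      "\<And>\<xi>. \<xi> \<in> \<Xi> \<Longrightarrow> norm (\<Sum>j\<in>J. e \<xi> (p j)) \<le> \<tau> * card J"
      using ex_averaging[OF _ _ \<tau>] by blast
    have cJ: "card J > 0" using J by (simp add: card_gt_0_iff)
    define v where "v i j = \<theta> (snd i) * e (fst i) (p j)" for i and j :: "'x \<Rightarrow> nat"
    define w' where "w' b j = \<theta> (snd b) * w (fst b) (p j)" for b and j :: "'x \<Rightarrow> nat"
    \<comment> \<open>A complex multiple of \<open>w\<close> is a real combination of
      \<open>w\<close> and \<open>\<i> * w\<close>, with the real and imaginary parts as
      coefficients.\<close>
    define a' where "a' i b = (if snd b then Re else Im) (\<theta> (snd i) * a (fst i) (fst b))" for i b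
    define u where "u i j = (\<Sum>b\<in>Bs \<times> (UNIV :: bool set). a' i b *\<^sub>R w' b j)" for i j
    have inner_v: "v i j \<bullet> v i' j = Re (\<theta> (snd i) * cnj (\<theta> (snd i')) * e (fst i - fst i') (p j))" for i i' j
      unfolding v_def by (rule e_inner)
    have u_eq: "u i j = \<theta> (snd i) * (\<Sum>b\<in>Bs. a (fst i) b * w b (p j))" for i j
    proof -
      have "u i j = (\<Sum>b\<in>Bs. \<Sum>c\<in>UNIV. a' i (b, c) *\<^sub>R w' (b, c) j)"
        unfolding u_def by (simp add: sum.cartesian_product)
      also have "\<dots> = (\<Sum>b\<in>Bs. \<theta> (snd i) * a (fst i) b * w b (p j))"
      proof (rule sum.cong[OF refl])
        fix b
        let ?z = "\<theta> (snd i) * a (fst i) b"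
        have "(\<Sum>c\<in>UNIV. a' i (b, c) *\<^sub>R w' (b, c) j) = (of_real (Re ?z) + \<i> * of_real (Im ?z)) * w b (p j)"
          by (simp add: UNIV_bool a'_def w'_def \<theta>_def scaleR_conv_of_real algebra_simps)
        also have "of_real (Re ?z) + \<i> * of_real (Im ?z) = ?z" by (rule complex_eq[symmetric])
        finally show "(\<Sum>c\<in>UNIV. a' i (b, c) *\<^sub>R w' (b, c) j) = ?z * w b (p j)" .
      qed
      finally show ?thesis by (simp add: sum_distrib_left mult.assoc)
    qed
    have "card (T \<times> (UNIV :: bool set)) * (1 - \<eta>\<^sup>2) \<le>
        (1 + \<tau> * card (T \<times> (UNIV :: bool set))) * card (Bs \<times> (UNIV :: bool set))"
    proof (rule almost_orthonormal_rank_bound[where J = J and v = v and u = u and a = a' and w = w'])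
      show "mean_inner J (v i) (v i) = 1" for i
      proof -
        have "v i j \<bullet> v i j = 1" for j
          using \<theta>[of "snd i"] by (simp add: inner_v complex_norm_square[symmetric])
        then show ?thesis using cJ by (simp add: mean_inner_def)
      qed
      fix i i' assume i: "i \<in> T \<times> (UNIV :: bool set)" "i' \<in> T \<times> (UNIV :: bool set)" "i \<noteq> i'"
      let ?c = "\<theta> (snd i) * cnj (\<theta> (snd i'))"
      have m: "mean_inner J (v i) (v i') = Re (?c * (\<Sum>j\<in>J. e (fst i - fst i') (p j))) / card J"
        unfolding mean_inner_def inner_v by (simp add: sum_distrib_left)
      show "\<bar>mean_inner J (v i) (v i')\<bar> \<le> \<tau>"
      proof (cases "fst i = fst i'")
        case True
        \<comment> \<open>The same character with the factors \<open>1\<close> and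
          \<open>\<i>\<close>: exactly orthogonal for the real inner product.\<close>
        then have "snd i \<noteq> snd i'" using i(3) by (simp add: prod_eq_iff)
        then have "Re ?c = 0" by (auto simp: \<theta>_def)
        then have "mean_inner J (v i) (v i') = 0" using True unfolding m by simp
        then show ?thesis using \<tau> by simp
      next
        case False
        then have "fst i - fst i' \<in> \<Xi>" using i by (force simp: \<Xi>_def)
        have "\<bar>Re (?c * (\<Sum>j\<in>J. e (fst i - fst i') (p j)))\<bar> \<le> norm (?c * (\<Sum>j\<in>J. e (fst i - fst i') (p j)))"
          by (rule abs_Re_le_cmod)
        also have "\<dots> = norm (\<Sum>j\<in>J. e (fst i - fst i') (p j))" using \<theta> by (simp add: norm_mult)
        also have "\<dots> \<le> \<tau> * card J" by (rule J(3)) fact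
        finally show ?thesis unfolding m using cJ by (simp add: field_simps)
      qed
    next
      fix i j assume i: "i \<in> T \<times> (UNIV :: bool set)"
      have "v i j - u i j = \<theta> (snd i) * (e (fst i) (p j) - (\<Sum>b\<in>Bs. a (fst i) b * w b (p j)))"
        by (simp add: v_def u_eq algebra_simps)
      then show "norm (v i j - u i j) \<le> \<eta>" using near[of "fst i" "p j"] i \<theta> by (auto simp: norm_mult)
    qed (use fin J \<tau> in \<open>auto simp: u_def\<close>)
    then have "2 * (card T * (1 - \<eta>\<^sup>2)) \<le> 2 * (card Bs * (1 + \<tau> * (2 * card T)))"
      by (simp add: card_cartesian_product algebra_simps)
    then show ?thesis by simp
  qed
  show ?thesis
  \<comment> \<open>The sample depends on \<open>\<tau>\<close>, but the bound obtained from it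
    mentions only cardinalities, so \<open>\<tau>\<close> can tend to 0.\<close>
  proof (rule field_le_epsilon)
    fix \<epsilon> :: real assume \<epsilon>: "\<epsilon> > 0"
    let ?D = "real (card Bs) * (2 * card T) + 1"
    have D: "?D > 0" by (simp add: add_nonneg_pos)
    have "card T * (1 - \<eta>\<^sup>2) \<le> card Bs * (1 + \<epsilon> / ?D * (2 * card T))"
      using D \<epsilon> by (intro bound) simp
    also have "\<dots> = card Bs + \<epsilon> * ((real (card Bs) * (2 * card T)) / ?D)"
      by (simp add: algebra_simps)
    also have "\<dots> \<le> card Bs + \<epsilon> * 1"
      using D \<epsilon> by (intro add_left_mono mult_left_mono) auto
    finally show "card T * (1 - \<eta>\<^sup>2) \<le> card Bs + \<epsilon>" by simp
  qed
qed

end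

context dual_pair
begin

text \<open>\<open>\<delta>\<close>, \<open>\<eta>\<close>, \<open>r\<close> and the cover depend on
  \<open>E\<close> and \<open>\<kappa>\<close> alone. One half of \<open>\<kappa>\<close> pays for
  the sparse sets of coordinates, the other for the factor \<open>1 - \<eta>\<^sup>2\<close> of the
  rank bound.\<close>

lemma card_trajectory_le_cover_number:
  fixes \<kappa> :: real
  assumes E: "finite E" "0 \<in> E" and \<kappa>: "\<kappa> > 0"
  obtains \<U> where "open_cover \<U>" "\<And>F. finite F \<Longrightarrow> F \<noteq> {} \<Longrightarrow>
    ln (real (card (trajectory l F E))) \<le> ln (real (cover_number (cover_refine \<rho> F \<U>))) + \<kappa> * card F"
proof -
  have "real (card E) \<ge> 0" "\<kappa> / 2 > 0" using \<kappa> by auto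
  then obtain \<delta> :: real where \<delta>: "\<delta> > 0" and small: "\<And>F :: 's set. finite F \<Longrightarrow>
    (\<Sum>A | A \<subseteq> F \<and> real (card A) \<le> \<delta> * card F. real (card E) ^ card A) \<le> exp (\<kappa> / 2 * card F)"
    using sum_small_subsets_le[where 'a = 's, of "real (card E)" "\<kappa> / 2"] by blast
  \<comment> \<open>Makes \<open>1 - \<eta>\<^sup>2\<close> equal to
    \<open>exp (- \<kappa> / 2)\<close>, a loss that is affordable since
    \<open>card F \<ge> 1\<close>.\<close>
  define \<eta> where "\<eta> = sqrt (1 - exp (- \<kappa> / 2))"
  have \<eta>: "0 < \<eta>" "\<eta> < 1" using \<kappa> by (auto simp: \<eta>_def)
  have \<eta>2: "1 - \<eta>\<^sup>2 = exp (- \<kappa> / 2)" using \<kappa> by (simp add: \<eta>_def)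
  \<comment> \<open>Solves \<open>2 * r powr \<delta> = \<eta>\<close>, so that the truncation error
    is at most \<open>\<eta> ^ card F\<close>.\<close>
  define r where "r = (\<eta> / 2) powr (1 / \<delta>)"
  have r: "0 < r" "r \<le> 1" "2 * r powr \<delta> = \<eta>"
    using \<eta> \<delta> by (auto simp: r_def powr_powr intro!: powr_le1)
  \<comment> \<open>Two points in one Bohr set of radius \<open>r / 2\<close> are within
    \<open>r\<close> of each other.\<close>
  define \<U> where "\<U> = range (bohr (r / 2) E)"
  have \<U>: "open_cover \<U>"
    unfolding open_cover_def \<U>_def using open_bohr[OF E(1)] bohr_self[of "r / 2"] r(1) by auto
  show thesis
  proof (rule that[OF \<U>])
    fix F :: "'s set" assume F: "finite F" "F \<noteq> {}"
    define T where "T = trajectory l F E"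
    have finT: "finite T" using F E by (simp add: T_def finite_trajectory)
    define \<A> where "\<A> = {A. A \<subseteq> F \<and> real (card A) \<le> \<delta> * card F}"
    have fin\<A>: "finite \<A>" using F by (simp add: \<A>_def)
    obtain \<V> where \<V>: "\<V> \<subseteq> cover_refine \<rho> F \<U>" "finite \<V>" "\<Union>\<V> = UNIV"
      "card \<V> = cover_number (cover_refine \<rho> F \<U>)"
      by (rule cover_refine_subcover[OF \<U> F(1)])
    have "\<exists>V\<in>\<V>. k \<in> V" for k using UNIV_I[of k] by (simp flip: \<V>(3))
    then obtain i where i: "\<And>k. i k \<in> \<V>" "\<And>k. k \<in> i k" by metis
    define b where "b V = (SOME k. k \<in> V)" for V :: "'k set"
    have b: "b (i k) \<in> i k" for k unfolding b_def using i(2) by (rule someI)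
    \<comment> \<open>The deviation at coordinate \<open>s\<close> from the base point of the piece
      containing \<open>k\<close>. It depends on the element \<open>x\<close> used at
      \<open>s\<close> but not on the whole character, and so it can enter a basis common to all
      characters.\<close>
    define z where "z s x k = e (l s x) (k - b (i k)) - 1" for s x k
    have z: "norm (z s x k) \<le> r" if "s \<in> F" "x \<in> E" for s x k
    proof -
      obtain V where V: "i k = (\<Inter>s\<in>F. \<rho> s -` V s)" "\<forall>s\<in>F. V s \<in> \<U>"
        by (rule cover_refineE[OF subsetD[OF \<V>(1) i(1)]])
      obtain c where c: "V s = bohr (r / 2) E c" using V(2) \<open>s \<in> F\<close> unfolding \<U>_def by blast
      have "\<rho> s k \<in> bohr (r / 2) E c" "\<rho> s (b (i k)) \<in> bohr (r / 2) E c"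
        using i(2)[of k] b[of k] \<open>s \<in> F\<close> unfolding V(1) c[symmetric] by auto
      then have "\<rho> s (b (i k)) \<in> bohr (r / 2 + r / 2) E (\<rho> s k)"
        by (intro bohr_triangle) (simp_all add: bohr_commute)
      moreover have "norm (z s x k) = norm (e (l s x) k - e (l s x) (b (i k)))"
        by (simp only: z_def norm_e_diff)
      ultimately show ?thesis
        using \<open>x \<in> E\<close> by (simp add: bohr_def adjoint less_imp_le)
    qed
    have "\<exists>R. R \<in> F \<rightarrow>\<^sub>E E \<and> \<xi> = (\<Sum>s\<in>F. l s (R s))" if "\<xi> \<in> T" for \<xi>
      using that unfolding T_def trajectory_alt[OF F(1)] by blast
    then obtain R where R: "\<And>\<xi>. \<xi> \<in> T \<Longrightarrow> R \<xi> \<in> F \<rightarrow>\<^sub>E E" "\<And>\<xi>. \<xi> \<in> T \<Longrightarrow> \<xi> = (\<Sum>s\<in>F. l s (R \<xi> s))"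
      by metis
    define \<S> where "\<S> = (SIGMA A:\<A>. A \<rightarrow>\<^sub>E E)"
    have finPi: "finite (A \<rightarrow>\<^sub>E E)" if "A \<in> \<A>" for A
      using that E F finite_subset by (intro finite_PiE) (auto simp: \<A>_def)
    have fin\<S>: "finite \<S>" unfolding \<S>_def using fin\<A> finPi by (intro finite_SigmaI) auto
    \<comment> \<open>An index is \<open>(V, A, y)\<close>: a piece, a sparse set of coordinates and
      a choice of elements of \<open>E\<close> on it. The coefficients \<open>a\<close> below pick
      the choice that agrees with the summands of \<open>\<xi>\<close>.\<close>
    define w where "w q k = (if i k = fst q then \<Prod>s\<in>fst (snd q). z s (snd (snd q) s) k else 0)" for q k
    define a where "a \<xi> q = (if snd (snd q) = restrict (R \<xi>) (fst (snd q)) then e \<xi> (b (fst q)) else 0)" for \<xi> q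
    have combo: "(\<Sum>q\<in>\<V> \<times> \<S>. a \<xi> q * w q k) = e \<xi> (b (i k)) * (\<Sum>A\<in>\<A>. \<Prod>s\<in>A. z s (R \<xi> s) k)"
      if "\<xi> \<in> T" for \<xi> k
    proof -
      have "(\<Sum>q\<in>\<V> \<times> \<S>. a \<xi> q * w q k) = (\<Sum>V\<in>\<V>. \<Sum>p\<in>\<S>. a \<xi> (V, p) * w (V, p) k)"
        by (simp add: sum.cartesian_product)
      also have "\<dots> = (\<Sum>V\<in>\<V>. if V = i k then \<Sum>p\<in>\<S>. a \<xi> (V, p) * w (V, p) k else 0)"
        by (intro sum.cong) (auto simp: w_def)
      also have "\<dots> = (\<Sum>p\<in>\<S>. a \<xi> (i k, p) * w (i k, p) k)"
        using \<V>(2) i(1) by simp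
      also have "\<dots> = (\<Sum>A\<in>\<A>. \<Sum>y\<in>A \<rightarrow>\<^sub>E E. a \<xi> (i k, A, y) * w (i k, A, y) k)"
        unfolding \<S>_def using fin\<A> finPi by (subst sum.Sigma) auto
      also have "\<dots> = (\<Sum>A\<in>\<A>. e \<xi> (b (i k)) * (\<Prod>s\<in>A. z s (R \<xi> s) k))"
      proof (rule sum.cong[OF refl])
        fix A assume A: "A \<in> \<A>"
        have mem: "restrict (R \<xi>) A \<in> A \<rightarrow>\<^sub>E E" using R(1)[OF that] A by (auto simp: \<A>_def)
        have "(\<Sum>y\<in>A \<rightarrow>\<^sub>E E. a \<xi> (i k, A, y) * w (i k, A, y) k) =
          (\<Sum>y\<in>A \<rightarrow>\<^sub>E E. if y = restrict (R \<xi>) A then e \<xi> (b (i k)) * (\<Prod>s\<in>A. z s (y s) k) else 0)"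
          by (intro sum.cong) (auto simp: a_def w_def)
        also have "\<dots> = e \<xi> (b (i k)) * (\<Prod>s\<in>A. z s (restrict (R \<xi>) A s) k)"
          using finPi[OF A] mem by (subst sum.delta) auto
        also have "(\<Prod>s\<in>A. z s (restrict (R \<xi>) A s) k) = (\<Prod>s\<in>A. z s (R \<xi> s) k)"
          by (intro prod.cong) auto
        finally show "(\<Sum>y\<in>A \<rightarrow>\<^sub>E E. a \<xi> (i k, A, y) * w (i k, A, y) k) = e \<xi> (b (i k)) * (\<Prod>s\<in>A. z s (R \<xi> s) k)" .
      qed
      finally show ?thesis by (simp add: sum_distrib_left)
    qed
    have "card T * (1 - \<eta>\<^sup>2) \<le> card (\<V> \<times> \<S>)"
    proof (rule card_characters_le_rank[where a = a and w = w])
      fix \<xi> k assume \<xi>: "\<xi> \<in> T"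
      have "e \<xi> (k - b (i k)) = (\<Prod>s\<in>F. 1 + z s (R \<xi> s) k)"
        by (subst R(2)[OF \<xi>]) (simp add: e_sum z_def)
      then have "e \<xi> k = e \<xi> (b (i k)) * (\<Prod>s\<in>F. 1 + z s (R \<xi> s) k)"
        by (simp add: e_diff_right field_simps)
      then have "e \<xi> k - (\<Sum>q\<in>\<V> \<times> \<S>. a \<xi> q * w q k) =
        e \<xi> (b (i k)) * ((\<Prod>s\<in>F. 1 + z s (R \<xi> s) k) - (\<Sum>A\<in>\<A>. \<Prod>s\<in>A. z s (R \<xi> s) k))"
        by (simp add: combo[OF \<xi>] right_diff_distrib)
      also have "norm \<dots> \<le> (2 * r powr \<delta>) ^ card F"
        using norm_prod_one_plus_truncation[OF F(1) z r(1,2) \<delta>, OF _ PiE_mem[OF R(1)[OF \<xi>]]]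
        by (simp add: norm_mult norm_e \<A>_def)
      also have "\<dots> = \<eta> ^ card F" using r(3) by simp
      also have "\<dots> \<le> \<eta> ^ 1" using \<eta> F by (intro power_decreasing) (auto simp: Suc_le_eq card_gt_0_iff)
      finally show "norm (e \<xi> k - (\<Sum>q\<in>\<V> \<times> \<S>. a \<xi> q * w q k)) \<le> \<eta>" by simp
    qed (use finT \<V>(2) fin\<S> in auto)
    also have "real (card (\<V> \<times> \<S>)) = card \<V> * (\<Sum>A\<in>\<A>. real (card E) ^ card A)"
    proof -
      have "card \<S> = (\<Sum>A\<in>\<A>. card (A \<rightarrow>\<^sub>E E))" unfolding \<S>_def using fin\<A> finPi by (simp add: card_SigmaI)
      also have "\<dots> = (\<Sum>A\<in>\<A>. card E ^ card A)"
        using finite_subset[OF _ F(1)] by (intro sum.cong refl) (simp add: \<A>_def card_PiE)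
      finally show ?thesis by (simp add: card_cartesian_product)
    qed
    also have "\<dots> \<le> card \<V> * exp (\<kappa> / 2 * card F)"
      using small[OF F(1)] by (intro mult_left_mono) (auto simp: \<A>_def)
    finally have "card T * exp (- \<kappa> / 2) \<le> card \<V> * exp (\<kappa> / 2 * card F)" by (simp add: \<eta>2)
    moreover have "card T > 0" unfolding T_def by (rule card_trajectory_pos[OF left E(2) F(1) E(1)])
    moreover have V0: "card \<V> > 0" using cover_number_refine_pos[OF \<U> F(1)] by (simp add: \<V>(4))
    ultimately have "ln (card T * exp (- \<kappa> / 2)) \<le> ln (card \<V> * exp (\<kappa> / 2 * card F))"
      by (intro ln_mono) auto
    then have "ln (card T) - \<kappa> / 2 \<le> ln (card \<V>) + \<kappa> / 2 * card F"
      using \<open>card T > 0\<close> V0 by (simp add: ln_mult_pos)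
    moreover have "\<kappa> / 2 * 1 \<le> \<kappa> / 2 * card F"
      using \<kappa> F by (intro mult_left_mono) (auto simp: Suc_le_eq card_gt_0_iff)
    ultimately have "ln (card T) \<le> ln (card \<V>) + \<kappa> * card F" by simp
    then show "ln (real (card (trajectory l F E))) \<le> ln (real (cover_number (cover_refine \<rho> F \<U>))) + \<kappa> * card F"
      by (simp add: T_def \<V>(4))
  qed
qed


subsection \<open>The topological entropy is at most the algebraic one\<close>

text \<open>Only the set of frequencies is tracked, since it alone bounds the rank; the coefficients
  stay anonymous.\<close>

definition char_span :: "'x set \<Rightarrow> ('k \<Rightarrow> complex) \<Rightarrow> bool" where
  "char_span A f \<longleftrightarrow> (\<exists>\<gamma>. \<forall>k. f k = (\<Sum>\<xi>\<in>A. \<gamma> \<xi> * e \<xi> k))"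

lemma char_span_mult:
  assumes fin: "finite A" "finite B" and f: "char_span A f" and g: "char_span B g"
  shows "char_span (A + B) (\<lambda>k. f k * g k)"
proof -
  obtain \<gamma> \<gamma>' where \<gamma>: "\<And>k. f k = (\<Sum>\<xi>\<in>A. \<gamma> \<xi> * e \<xi> k)" "\<And>k. g k = (\<Sum>\<xi>\<in>B. \<gamma>' \<xi> * e \<xi> k)"
    using f g by (auto simp: char_span_def)
  let ?S = "\<lambda>\<xi>. {p \<in> A \<times> B. fst p + snd p = \<xi>}"
  have "f k * g k = (\<Sum>\<xi>\<in>A + B. (\<Sum>p\<in>?S \<xi>. \<gamma> (fst p) * \<gamma>' (snd p)) * e \<xi> k)" for k
  proof -
    have "f k * g k = (\<Sum>p\<in>A \<times> B. \<gamma> (fst p) * \<gamma>' (snd p) * e (fst p + snd p) k)"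
      unfolding \<gamma> sum_product sum.cartesian_product
      by (intro sum.cong) (auto simp: e_add mult_ac)
    also have "\<dots> = (\<Sum>\<xi>\<in>A + B. \<Sum>p\<in>?S \<xi>. \<gamma> (fst p) * \<gamma>' (snd p) * e (fst p + snd p) k)"
      using fin by (intro sum.group[symmetric]) (auto intro: finite_set_plus)
    also have "\<dots> = (\<Sum>\<xi>\<in>A + B. (\<Sum>p\<in>?S \<xi>. \<gamma> (fst p) * \<gamma>' (snd p)) * e \<xi> k)"
      by (intro sum.cong refl) (simp add: sum_distrib_right)
    finally show ?thesis .
  qed
  then show ?thesis unfolding char_span_def by (intro exI allI)
qed

lemma char_span_prod:
  assumes "finite I" "\<And>i. i \<in> I \<Longrightarrow> finite (A i)" "\<And>i. i \<in> I \<Longrightarrow> char_span (A i) (f i)"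
  shows "finite (\<Sum>i\<in>I. A i) \<and> char_span (\<Sum>i\<in>I. A i) (\<lambda>k. \<Prod>i\<in>I. f i k)"
  using assms
proof (induction I)
  case empty
  then show ?case by (auto simp: char_span_def intro!: exI[of _ "\<lambda>_. 1"])
next
  case (insert i I)
  then show ?case using char_span_mult[of "A i" "\<Sum>i\<in>I. A i" "f i"]
    by (simp add: finite_set_plus)
qed

lemma char_span_base: "char_span {0, y} (\<lambda>k. (1 + e y k) / 2)"
proof (cases "y = 0")
  case True
  then show ?thesis by (auto simp: char_span_def intro!: exI[of _ "\<lambda>_. 1"])
next
  case False
  then show ?thesis
    by (auto simp: char_span_def add_divide_distrib intro!: exI[of _ "\<lambda>_. 1 / 2"])
qed

end

section \<open>Linear systems and diagonal dominance\<close>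

text \<open>Gaussian elimination: the pivot \<open>z0\<close> removes the equation \<open>t0\<close>
  together with one unknown.\<close>

lemma ex_nontrivial_solution:
  fixes u :: "'z \<Rightarrow> 't \<Rightarrow> 'f::field"
  assumes "finite T" "finite Z" "card T < card Z"
  shows "\<exists>c. (\<exists>z\<in>Z. c z \<noteq> 0) \<and> (\<forall>t\<in>T. (\<Sum>z\<in>Z. c z * u z t) = 0)"
  using assms
proof (induction T arbitrary: Z u)
  case empty
  then have "Z \<noteq> {}" by auto
  then show ?case by (intro exI[of _ "\<lambda>_. 1"]) auto
next
  case (insert t0 T)
  show ?case
  proof (cases "\<exists>z0\<in>Z. u z0 t0 \<noteq> 0")
    case False
    have "card T < card Z" using insert by simp
    from insert.IH[OF insert.prems(1) this, of u]
    obtain c where c: "\<exists>z\<in>Z. c z \<noteq> 0" "\<forall>t\<in>T. (\<Sum>z\<in>Z. c z * u z t) = 0" by (elim exE conjE)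
    have "(\<Sum>z\<in>Z. c z * u z t0) = 0" using False by (intro sum.neutral) auto
    then show ?thesis using c by (intro exI[of _ c]) auto
  next
    case True
    then obtain z0 where z0: "z0 \<in> Z" "u z0 t0 \<noteq> 0" by blast
    define u' where "u' z t = u z t - u z t0 / u z0 t0 * u z0 t" for z t
    have "finite (Z - {z0})" "card T < card (Z - {z0})" using insert z0 by simp_all
    from insert.IH[OF this, of u']
    obtain c where c: "\<exists>z\<in>Z - {z0}. c z \<noteq> 0" "\<forall>t\<in>T. (\<Sum>z\<in>Z - {z0}. c z * u' z t) = 0"
      by (elim exE conjE)
    define d where "d = - (\<Sum>z\<in>Z - {z0}. c z * (u z t0 / u z0 t0))"
    define c' where "c' = c(z0 := d)"
    have eq: "(\<Sum>z\<in>Z. c' z * u z t) = (\<Sum>z\<in>Z - {z0}. c z * u' z t)" for t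
    proof -
      have "(\<Sum>z\<in>Z. c' z * u z t) = d * u z0 t + (\<Sum>z\<in>Z - {z0}. c z * u z t)"
        using insert.prems z0 by (subst sum.remove[of _ z0]) (auto simp: c'_def intro!: sum.cong)
      also have "d * u z0 t = - (\<Sum>z\<in>Z - {z0}. c z * (u z t0 / u z0 t0) * u z0 t)"
        by (simp add: d_def sum_distrib_right)
      finally show ?thesis by (simp add: u'_def sum_subtractf algebra_simps)
    qed
    have "(\<Sum>z\<in>Z. c' z * u z t) = 0" if "t \<in> insert t0 T" for t
    proof (cases "t = t0")
      case True
      then show ?thesis unfolding eq using z0 by (simp add: u'_def)
    qed (use that c(2) eq in auto)
    moreover have "\<exists>z\<in>Z. c' z \<noteq> 0" using c(1) by (auto simp: c'_def)
    ultimately show ?thesis by blast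
  qed
qed

text \<open>If \<open>T\<close> were smaller, some nontrivial combination of the rows would vanish.
  In the column of its largest coefficient the diagonal entry 1 outweighs all the other
  terms.\<close>

lemma card_le_of_diagonally_dominant:
  fixes a :: "'z \<Rightarrow> 'z \<Rightarrow> complex" and \<beta> :: real
  assumes fin: "finite T" "finite Z"
    and rank: "\<And>z z'. z \<in> Z \<Longrightarrow> z' \<in> Z \<Longrightarrow> a z z' = (\<Sum>t\<in>T. u z t * v t z')"
    and diag: "\<And>z. z \<in> Z \<Longrightarrow> a z z = 1"
    and off: "\<And>z z'. z \<in> Z \<Longrightarrow> z' \<in> Z \<Longrightarrow> z \<noteq> z' \<Longrightarrow> norm (a z z') \<le> \<beta>"
    and \<beta>: "card Z * \<beta> < 1" "\<beta> \<ge> 0"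
  shows "card Z \<le> card T"
proof (rule ccontr)
  assume "\<not> card Z \<le> card T"
  then obtain c where c: "\<exists>z\<in>Z. c z \<noteq> 0" "\<forall>t\<in>T. (\<Sum>z\<in>Z. c z * u z t) = 0"
    using ex_nontrivial_solution[OF fin, of u] by auto
  have zero: "(\<Sum>z\<in>Z. c z * a z z') = 0" if "z' \<in> Z" for z'
  proof -
    have "(\<Sum>z\<in>Z. c z * a z z') = (\<Sum>z\<in>Z. \<Sum>t\<in>T. c z * u z t * v t z')"
      using that by (intro sum.cong refl) (simp add: rank sum_distrib_left mult.assoc)
    also have "\<dots> = (\<Sum>t\<in>T. (\<Sum>z\<in>Z. c z * u z t) * v t z')"
      by (subst sum.swap) (simp add: sum_distrib_right)
    also have "\<dots> = 0" using c(2) by (intro sum.neutral) auto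
    finally show ?thesis .
  qed
  have ne: "Z \<noteq> {}" using c(1) by auto
  define M where "M = Max ((\<lambda>z. norm (c z)) ` Z)"
  have "M \<in> (\<lambda>z. norm (c z)) ` Z" unfolding M_def using ne fin by (intro Max_in) auto
  then obtain z0 where z0: "z0 \<in> Z" "M = norm (c z0)" by auto
  have M: "norm (c z) \<le> M" if "z \<in> Z" for z unfolding M_def using fin that by (intro Max_ge) auto
  have "M > 0"
  proof -
    obtain z where "z \<in> Z" "c z \<noteq> 0" using c(1) by auto
    then show ?thesis using M[of z] by (meson less_le_trans zero_less_norm_iff)
  qed
  have "(\<Sum>z\<in>Z. c z * a z z0) = c z0 + (\<Sum>z\<in>Z - {z0}. c z * a z z0)"
    using fin z0 diag by (simp add: sum.remove)
  then have "c z0 = - (\<Sum>z\<in>Z - {z0}. c z * a z z0)" using zero[OF z0(1)] by (simp add: eq_neg_iff_add_eq_0)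
  then have "M = norm (\<Sum>z\<in>Z - {z0}. c z * a z z0)" using z0 by simp
  also have "\<dots> \<le> (\<Sum>z\<in>Z - {z0}. M * \<beta>)"
    using z0 M off \<open>M > 0\<close> by (intro sum_norm_le) (auto simp: norm_mult intro!: mult_mono)
  also have "\<dots> = card (Z - {z0}) * (M * \<beta>)" by simp
  also have "\<dots> \<le> card Z * (M * \<beta>)"
    using fin \<beta> \<open>M > 0\<close> by (intro mult_right_mono) (auto intro!: card_mono)
  also have "\<dots> = M * (card Z * \<beta>)" by simp
  also have "\<dots> < M * 1" using \<beta> \<open>M > 0\<close> by (intro mult_strict_left_mono) auto
  finally show False by simp
qed

text \<open>The parallelogram law: the squares of the moduli of \<open>1 + z\<close> and
  \<open>z - 1\<close> add up to 4.\<close>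

lemma norm_average_with_one:
  fixes z :: complex
  assumes "norm z = 1"
  shows "norm ((1 + z) / 2) \<le> 1"
    and "0 \<le> \<epsilon> \<Longrightarrow> norm (z - 1) \<ge> \<epsilon> \<Longrightarrow> norm ((1 + z) / 2) \<le> sqrt (1 - \<epsilon>\<^sup>2 / 4)"
proof -
  have z: "(Re z)\<^sup>2 + (Im z)\<^sup>2 = 1" using assms by (metis cmod_power2 power_one)
  have eq: "(norm ((1 + z) / 2))\<^sup>2 = 1 - (norm (z - 1))\<^sup>2 / 4"
  proof -
    have "(norm (1 + z))\<^sup>2 = 4 - (norm (z - 1))\<^sup>2"
      using z unfolding cmod_power2 by (simp add: power2_eq_square algebra_simps)
    then show ?thesis by (simp add: norm_divide power_divide)
  qed
  have "(norm ((1 + z) / 2))\<^sup>2 \<le> 1\<^sup>2" unfolding eq by simp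
  then show "norm ((1 + z) / 2) \<le> 1" by (rule power2_le_imp_le) simp
  assume "0 \<le> \<epsilon>" "norm (z - 1) \<ge> \<epsilon>"
  then have "\<epsilon>\<^sup>2 \<le> (norm (z - 1))\<^sup>2" by (intro power_mono)
  then have "(norm ((1 + z) / 2))\<^sup>2 \<le> 1 - \<epsilon>\<^sup>2 / 4" using eq by simp
  then show "norm ((1 + z) / 2) \<le> sqrt (1 - \<epsilon>\<^sup>2 / 4)" by (rule real_le_rsqrt)
qed

lemma image_sum_additive:
  assumes "Modules.additive h" "finite I"
  shows "h ` (\<Sum>i\<in>I. A i) = (\<Sum>i\<in>I. h ` A i)"
  using assms(2)
proof (induction I)
  case empty
  then show ?case using Modules.additive.zero[OF assms(1)] by simp
next
  case (insert i I)
  have "h ` (A i + (\<Sum>i\<in>I. A i)) = h ` A i + h ` (\<Sum>i\<in>I. A i)"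
    unfolding set_plus_image image_image
    using Modules.additive.add[OF assms(1)] by (force simp: image_iff)
  then show ?case using insert by simp
qed


section \<open>Peaked trigonometric polynomials and separated sets\<close>

context dual_pair
begin

text \<open>A trigonometric polynomial with value 1 at 0, of modulus at most 1, and small wherever many
  of the coordinates \<open>\<rho> s k\<close> lie outside the Bohr neighbourhood of 0.\<close>

definition peak :: "nat \<Rightarrow> 'x set \<Rightarrow> 's set \<Rightarrow> 'k \<Rightarrow> complex" where
  "peak m E F k = (\<Prod>s\<in>F. \<Prod>x\<in>E. \<Prod>i<m. (1 + e (l s x) k) / 2)"

text \<open>Contains the frequencies of the product over \<open>x \<in> E\<close> of the
  \<open>m\<close>-th powers of \<open>(1 + e x) / 2\<close>. Repeated summands instead of multiples
  let the frequencies of a product be read off factor by factor.\<close>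

definition box :: "nat \<Rightarrow> 'x set \<Rightarrow> 'x set" where
  "box m E = (\<Sum>x\<in>E. \<Sum>i<m. {0, x})"

lemma box: "finite E \<Longrightarrow> finite (box m E) \<and> 0 \<in> box m E"
proof -
  assume E: "finite E"
  have zero: "0 \<in> A + B" if "0 \<in> A" "0 \<in> B" for A B :: "'x set"
    using set_plus_intro[OF that] by simp
  have S: "finite (\<Sum>i<m. {0, x}) \<and> 0 \<in> (\<Sum>i<m. {0, x})" for x :: 'x
    by (induction m) (auto intro!: finite_set_plus zero)
  show ?thesis
    unfolding box_def using E
    by (induction E rule: finite_induct) (auto intro!: finite_set_plus zero simp: S)
qed

lemma char_span_peak:
  assumes "finite E" "finite F"
  shows "char_span (trajectory l F (box m E)) (peak m E F)"
proof -
  have "l s ` box m E = (\<Sum>x\<in>E. \<Sum>i<m. {0, l s x})" for s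
  proof -
    have add: "Modules.additive (l s)" using left by (simp add: left_action_def)
    show ?thesis
      unfolding box_def using assms(1)
      by (simp add: image_sum_additive[OF add] Modules.additive.zero[OF add])
  qed
  then have T: "trajectory l F (box m E) = (\<Sum>s\<in>F. \<Sum>x\<in>E. \<Sum>i<m. {0, l s x})"
    by (simp add: trajectory_def)
  have 1: "finite (\<Sum>i<m. {0, y}) \<and> char_span (\<Sum>i<m. {0, y}) (\<lambda>k. \<Prod>i<m. (1 + e y k) / 2)" for y
    by (rule char_span_prod) (auto simp: char_span_base)
  have 2: "finite (\<Sum>x\<in>E. \<Sum>i<m. {0, l s x}) \<and>
      char_span (\<Sum>x\<in>E. \<Sum>i<m. {0, l s x}) (\<lambda>k. \<Prod>x\<in>E. \<Prod>i<m. (1 + e (l s x) k) / 2)" for s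
    using 1 assms by (intro char_span_prod) blast+
  have "char_span (\<Sum>s\<in>F. \<Sum>x\<in>E. \<Sum>i<m. {0, l s x}) (peak m E F)"
    unfolding peak_def[abs_def]
    by (rule char_span_prod[THEN conjunct2, OF assms(2)]) (use 2 in blast)+
  then show ?thesis by (simp only: T)
qed

lemma peak_zero: "peak m E F 0 = 1"
  by (simp add: peak_def)

text \<open>All factors have modulus at most 1. At each coordinate where the two points are
  separated, some \<open>x \<in> E\<close> contributes \<open>m\<close> factors bounded by the
  square root.\<close>

lemma norm_peak_le:
  assumes fin: "finite E" "finite F" and \<epsilon>: "0 < \<epsilon>" "\<epsilon> \<le> 1"
  shows "norm (peak m E F (k - k')) \<le>
    (sqrt (1 - \<epsilon>\<^sup>2 / 4) ^ m) ^ card {s\<in>F. \<rho> s k' \<notin> bohr \<epsilon> E (\<rho> s k)}"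
proof -
  let ?r = "sqrt (1 - \<epsilon>\<^sup>2 / 4)"
  let ?g = "\<lambda>s. norm (\<Prod>x\<in>E. \<Prod>i<m. (1 + e (l s x) (k - k')) / 2)"
  have le1: "norm ((1 + e (l s x) (k - k')) / 2) \<le> 1" for s x
    by (rule norm_average_with_one(1)[OF norm_e])
  have g1: "?g s \<le> 1" for s
    using le1 by (simp add: prod_norm[symmetric] prod_le_1 power_le_one norm_power)
  have gr: "?g s \<le> ?r ^ m" if s: "\<rho> s k' \<notin> bohr \<epsilon> E (\<rho> s k)" for s
  proof -
    obtain x where x: "x \<in> E" "\<not> norm (e x (\<rho> s k) - e x (\<rho> s k')) < \<epsilon>"
      using s unfolding bohr_def by blast
    have "norm (e (l s x) k - e (l s x) k') \<ge> \<epsilon>"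
      using x(2) by (simp add: adjoint)
    then have "norm (e (l s x) (k - k') - 1) \<ge> \<epsilon>" by (simp only: norm_e_diff)
    then have "norm ((1 + e (l s x) (k - k')) / 2) \<le> ?r"
      using \<epsilon> by (intro norm_average_with_one(2)[OF norm_e]) auto
    then have "norm (\<Prod>i<m. (1 + e (l s x) (k - k')) / 2) \<le> ?r ^ m"
      by (simp add: norm_power power_mono)
    moreover have "?g s = norm (\<Prod>i<m. (1 + e (l s x) (k - k')) / 2) *
        (\<Prod>x\<in>E - {x}. norm (\<Prod>i<m. (1 + e (l s x) (k - k')) / 2))"
      by (simp only: prod.remove[OF fin(1) x(1)] norm_mult prod_norm)
    moreover have "(\<Prod>x\<in>E - {x}. norm (\<Prod>i<m. (1 + e (l s x) (k - k')) / 2)) \<le> 1"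
      using le1 by (intro prod_le_1) (simp add: norm_power power_le_one)
    moreover have "\<epsilon>\<^sup>2 \<le> 1" using \<epsilon> by (simp add: power_le_one)
    then have "0 \<le> ?r ^ m" by simp
    ultimately show ?thesis
      using mult_mono[of "norm (\<Prod>i<m. (1 + e (l s x) (k - k')) / 2)" "?r ^ m"
          "\<Prod>x\<in>E - {x}. norm (\<Prod>i<m. (1 + e (l s x) (k - k')) / 2)" 1]
      by (simp add: prod_nonneg)
  qed
  let ?B = "{s\<in>F. \<rho> s k' \<notin> bohr \<epsilon> E (\<rho> s k)}"
  have "norm (peak m E F (k - k')) = (\<Prod>s\<in>F. ?g s)" by (simp add: peak_def prod_norm)
  also have "\<dots> \<le> (\<Prod>s\<in>F. if s \<in> ?B then ?r ^ m else 1)"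
    using g1 gr by (intro prod_mono) auto
  also have "\<dots> = (\<Prod>s\<in>?B. ?r ^ m)"
    using fin by (simp add: prod.If_cases Int_def)
  finally show ?thesis by simp
qed

end

context dual_pair
begin

text \<open>\<open>\<epsilon>\<close>, the cells, \<open>\<delta>\<close> and \<open>m\<close>
  depend on the cover and \<open>\<kappa>\<close> alone, so a single set \<open>box m E0\<close>
  serves every \<open>F\<close>.\<close>

lemma cover_number_le_card_trajectory:
  fixes \<kappa> :: real
  assumes \<U>: "open_cover \<U>" and \<kappa>: "\<kappa> > 0"
  obtains E where "finite E" "0 \<in> E" "\<And>F. finite F \<Longrightarrow> F \<noteq> {} \<Longrightarrow>
    ln (real (cover_number (cover_refine \<rho> F \<U>))) \<le> ln (real (card (trajectory l F E))) + \<kappa> * card F"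
proof -
  obtain E0 \<epsilon> where E0: "finite E0" and \<epsilon>: "\<epsilon> > 0" "\<epsilon> \<le> 1" and leb: "\<And>k. \<exists>U\<in>\<U>. bohr \<epsilon> E0 k \<subseteq> U"
    using bohr_Lebesgue[OF \<U>] by blast
  obtain C c where C: "finite C" "\<And>k. c k \<in> C" "\<And>k. k \<in> bohr (\<epsilon> / 2) E0 (c k)"
    using ex_cells[OF E0, of "\<epsilon> / 2"] \<epsilon> by auto
  have cell: "k' \<in> bohr \<epsilon> E0 k" if "c k = c k'" for k k'
    using bohr_triangle[of "c k" "\<epsilon> / 2" E0 k k' "\<epsilon> / 2"] C(3)[of k] C(3)[of k'] that
    by (simp add: bohr_commute)
  define q where "q = card C"
  have "C \<noteq> {}" using C(2) by auto
  then have q: "q > 0" using C(1) by (simp add: q_def card_gt_0_iff)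
  obtain \<delta> :: real where \<delta>: "\<delta> > 0" and small: "\<And>F :: 's set. finite F \<Longrightarrow>
    (\<Sum>A | A \<subseteq> F \<and> real (card A) \<le> \<delta> * card F. real q ^ card A) \<le> exp (\<kappa> * card F)"
    using sum_small_subsets_le[where 'a = 's, of "real q" \<kappa>] \<kappa> by auto
  define r where "r = sqrt (1 - \<epsilon>\<^sup>2 / 4)"
  have "\<epsilon>\<^sup>2 \<le> 1" using \<epsilon> by (simp add: power_le_one)
  then have r: "0 < r" "r < 1" using \<epsilon> by (auto simp: r_def)
  have "r powr \<delta> < 1" using powr_less_mono2[of \<delta> r 1] r \<delta> by simp
  \<comment> \<open>Then \<open>q * (r powr \<delta>) ^ m < 1\<close>: the smallness of the peak
    beats the number of itineraries through the \<open>q\<close> cells.\<close>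
  then obtain m where m: "(r powr \<delta>) ^ m < 1 / q"
    using real_arch_pow_inv[of "1 / q" "r powr \<delta>"] q by auto
  define E where "E = box m E0"
  show thesis
  proof (rule that[of E])
    show "finite E" "0 \<in> E" using box[OF E0] by (auto simp: E_def)
    fix F :: "'s set" assume F: "finite F" "F \<noteq> {}"
    define T where "T = trajectory l F E"
    have finT: "finite T" using F box[OF E0] by (simp add: T_def E_def finite_trajectory)
    define bad where "bad k k' = {s\<in>F. \<rho> s k' \<notin> bohr \<epsilon> E0 (\<rho> s k)}" for k k'
    \<comment> \<open>Finiteness is part of \<open>sep\<close> because \<open>card\<close> of an
      infinite set is 0.\<close>
    define sep where "sep Z \<longleftrightarrow> finite Z \<and> (\<forall>k\<in>Z. \<forall>k'\<in>Z. k \<noteq> k' \<longrightarrow> \<delta> * card F < card (bad k k'))" for Z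
    have bad_commute: "bad k k' = bad k' k" for k k' by (simp add: bad_def bohr_commute)
    have sep_le: "card Z \<le> card T" if Z: "sep Z" for Z
    proof -
      have finZ: "finite Z" using Z by (simp add: sep_def)
      define \<beta> where "\<beta> = ((r powr \<delta>) ^ m) ^ card F"
      \<comment> \<open>Two points whose coordinates lie in the same cells are separated nowhere, so
        \<open>Z\<close> has at most \<open>q ^ card F\<close> points.\<close>
      have "inj_on (\<lambda>k. \<lambda>s\<in>F. c (\<rho> s k)) Z"
      proof (rule inj_onI, rule ccontr)
        fix k k' assume k: "k \<in> Z" "k' \<in> Z" "k \<noteq> k'"
          and eq: "(\<lambda>s\<in>F. c (\<rho> s k)) = (\<lambda>s\<in>F. c (\<rho> s k'))"
        have "c (\<rho> s k) = c (\<rho> s k')" if "s \<in> F" for s using fun_cong[OF eq, of s] that by simp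
        then have "bad k k' = {}" using cell by (auto simp: bad_def)
        then have "\<delta> * card F < 0" using Z k unfolding sep_def by fastforce
        then show False using \<delta> by (simp add: mult_less_0_iff)
      qed
      moreover have "(\<lambda>k. \<lambda>s\<in>F. c (\<rho> s k)) ` Z \<subseteq> F \<rightarrow>\<^sub>E C" using C(2) by auto
      ultimately have "card Z \<le> card (F \<rightarrow>\<^sub>E C)" using F C(1) by (intro card_inj_on_le finite_PiE)
      also have "\<dots> = q ^ card F" using F by (simp add: card_PiE q_def)
      finally have "real (card Z) \<le> real q ^ card F" by (metis of_nat_le_iff of_nat_power)
      then have "card Z * \<beta> \<le> real q ^ card F * \<beta>"
        unfolding \<beta>_def by (intro mult_right_mono) auto
      also have "\<dots> = (q * (r powr \<delta>) ^ m) ^ card F" by (simp add: \<beta>_def power_mult_distrib)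
      also have "\<dots> < 1"
        using m q F by (intro power_Suc_less_one[THEN less_le_trans] power_less_one_iff[THEN iffD2])
          (auto simp: field_simps card_gt_0_iff)
      finally have Z\<beta>: "card Z * \<beta> < 1" .
      obtain \<gamma> where \<gamma>: "\<And>k. peak m E0 F k = (\<Sum>\<xi>\<in>T. \<gamma> \<xi> * e \<xi> k)"
        using char_span_peak[OF E0 F(1), of m] unfolding char_span_def T_def E_def by blast
      show ?thesis
      proof (rule card_le_of_diagonally_dominant[OF finT finZ, where a = "\<lambda>k k'. peak m E0 F (k - k')"
            and u = "\<lambda>k \<xi>. \<gamma> \<xi> * e \<xi> k" and v = "\<lambda>\<xi> k. 1 / e \<xi> k" and \<beta> = \<beta>])
        show "peak m E0 F (k - k') = (\<Sum>\<xi>\<in>T. \<gamma> \<xi> * e \<xi> k * (1 / e \<xi> k'))" for k k'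
          by (simp add: \<gamma> e_diff_right)
        show "peak m E0 F (k - k) = 1" for k by (simp add: peak_zero)
        fix k k' assume k: "k \<in> Z" "k' \<in> Z" "k \<noteq> k'"
        then have "\<delta> * card F \<le> card (bad k k')" using Z k by (auto simp: sep_def less_imp_le)
        have "norm (peak m E0 F (k - k')) \<le> (r ^ m) ^ card (bad k k')"
          using norm_peak_le[OF E0 F(1) \<epsilon>] by (simp add: r_def bad_def)
        also have "\<dots> = (r powr card (bad k k')) ^ m"
          using r by (simp add: powr_realpow power_mult[symmetric] mult.commute)
        also have "\<dots> \<le> (r powr (\<delta> * card F)) ^ m"
          using r \<open>\<delta> * card F \<le> card (bad k k')\<close> by (intro power_mono powr_mono') auto
        also have "\<dots> = \<beta>"
          using r by (simp add: \<beta>_def powr_powr[symmetric] powr_realpow power_mult[symmetric] mult.commute)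
        finally show "norm (peak m E0 F (k - k')) \<le> \<beta>" .
      qed (use Z\<beta> in \<open>auto simp: \<beta>_def\<close>)
    qed
    have "sep {}" by (simp add: sep_def)
    moreover have "\<forall>Z. sep Z \<longrightarrow> card Z < Suc (card T)" using sep_le by (auto simp: less_Suc_eq_le)
    ultimately obtain Z where Z: "sep Z" and max: "\<And>Z'. sep Z' \<Longrightarrow> card Z' \<le> card Z"
      using ex_has_greatest_nat[of sep "{}" card] by metis
    have finZ: "finite Z" using Z by (simp add: sep_def)
    have near: "\<exists>z\<in>Z. card (bad z k) \<le> \<delta> * card F" for k
    proof (rule ccontr)
      assume no: "\<not> ?thesis"
      then have far: "\<delta> * card F < card (bad z k)" if "z \<in> Z" for z using that by auto
      have "k \<notin> Z"
      proof
        assume "k \<in> Z"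
        moreover have "bad k k = {}" using \<epsilon> by (auto simp: bad_def bohr_self)
        ultimately show False using far[of k] \<delta> by (simp add: mult_less_0_iff)
      qed
      moreover have "sep (insert k Z)"
        using Z far far[unfolded bad_commute[of _ k]] unfolding sep_def by simp
      ultimately show False using max[of "insert k Z"] finZ by simp
    qed
    define \<A> where "\<A> = {A. A \<subseteq> F \<and> real (card A) \<le> \<delta> * card F}"
    have fin\<A>: "finite \<A>" using F by (simp add: \<A>_def)
    define \<S> where "\<S> = (SIGMA A:\<A>. A \<rightarrow>\<^sub>E C)"
    have finPi: "finite (A \<rightarrow>\<^sub>E C)" if "A \<in> \<A>" for A
      using that C F finite_subset by (intro finite_PiE) (auto simp: \<A>_def)
    have fin\<S>: "finite \<S>" unfolding \<S>_def using fin\<A> finPi by (intro finite_SigmaI) auto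
    \<comment> \<open>An index is \<open>(z, A, y)\<close>: outside \<open>A\<close> the coordinates
      follow those of \<open>z\<close>, and on the sparse set \<open>A\<close> the cell of each
      coordinate is recorded in \<open>y\<close>.\<close>
    define W where "W p = {k. \<forall>s\<in>F. if s \<in> fst (snd p) then \<rho> s k \<in> bohr (\<epsilon> / 2) E0 (snd (snd p) s)
      else \<rho> s k \<in> bohr \<epsilon> E0 (\<rho> s (fst p))}" for p :: "'k \<times> 's set \<times> ('s \<Rightarrow> 'k)"
    have "cover_number (cover_refine \<rho> F \<U>) \<le> card (W ` (Z \<times> \<S>))"
    proof (rule cover_number_le)
      show "finite (W ` (Z \<times> \<S>))" using finZ fin\<S> by simp
      show "\<Union> (W ` (Z \<times> \<S>)) = UNIV"
      proof (intro equalityI subsetI UNIV_I)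
        fix k
        obtain z where z: "z \<in> Z" "card (bad z k) \<le> \<delta> * card F" using near by blast
        have "bad z k \<in> \<A>" using z(2) by (auto simp: \<A>_def bad_def)
        moreover have "(\<lambda>s\<in>bad z k. c (\<rho> s k)) \<in> bad z k \<rightarrow>\<^sub>E C" using C(2) by auto
        ultimately have "(z, bad z k, \<lambda>s\<in>bad z k. c (\<rho> s k)) \<in> Z \<times> \<S>"
          using z(1) by (simp add: \<S>_def)
        moreover have "k \<in> W (z, bad z k, \<lambda>s\<in>bad z k. c (\<rho> s k))"
          using C(3) by (auto simp: W_def bad_def)
        ultimately show "k \<in> \<Union> (W ` (Z \<times> \<S>))" by (rule UN_I)
      qed
      fix Q assume "Q \<in> W ` (Z \<times> \<S>)"
      then obtain p where p: "Q = W p" by (rule imageE)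
      have "\<forall>k. \<exists>U. U \<in> \<U> \<and> bohr \<epsilon> E0 k \<subseteq> U" using leb by blast
      then obtain V where V: "\<forall>k. V k \<in> \<U> \<and> bohr \<epsilon> E0 k \<subseteq> V k" by (rule choice[THEN exE])
      define V' where "V' s = (if s \<in> fst (snd p) then V (snd (snd p) s) else V (\<rho> s (fst p)))" for s
      have "bohr (\<epsilon> / 2) E0 k \<subseteq> V k" for k
        using V bohr_mono[of "\<epsilon> / 2" \<epsilon> E0 E0 k] \<epsilon> by auto
      then have "Q \<subseteq> (\<Inter>s\<in>F. \<rho> s -` V' s)"
        using V unfolding p W_def V'_def by (fastforce split: if_splits)
      moreover have "(\<Inter>s\<in>F. \<rho> s -` V' s) \<in> cover_refine \<rho> F \<U>"
        using V by (intro cover_refineI) (auto simp: V'_def)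
      ultimately show "\<exists>V\<in>cover_refine \<rho> F \<U>. Q \<subseteq> V" by blast
    qed
    also have "\<dots> \<le> card (Z \<times> \<S>)" using finZ fin\<S> by (intro card_image_le) auto
    also have "\<dots> = card Z * (\<Sum>A\<in>\<A>. q ^ card A)"
    proof -
      have "card \<S> = (\<Sum>A\<in>\<A>. card (A \<rightarrow>\<^sub>E C))" unfolding \<S>_def using fin\<A> finPi by (simp add: card_SigmaI)
      also have "\<dots> = (\<Sum>A\<in>\<A>. q ^ card A)"
        using finite_subset[OF _ F(1)] by (intro sum.cong refl) (simp add: \<A>_def card_PiE q_def)
      finally show ?thesis by (simp add: card_cartesian_product)
    qed
    finally have "real (cover_number (cover_refine \<rho> F \<U>)) \<le> real (card Z * (\<Sum>A\<in>\<A>. q ^ card A))"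
      by (simp only: of_nat_le_iff)
    also have "\<dots> = card Z * (\<Sum>A\<in>\<A>. real q ^ card A)" by simp
    also have "\<dots> \<le> card T * exp (\<kappa> * card F)"
      using sep_le[OF Z] small[OF F(1)] by (intro mult_mono) (auto simp: \<A>_def sum_nonneg)
    finally have le: "real (cover_number (cover_refine \<rho> F \<U>)) \<le> card T * exp (\<kappa> * card F)" .
    have "card T > 0"
      unfolding T_def E_def using box[OF E0] by (intro card_trajectory_pos left F) auto
    have "ln (real (cover_number (cover_refine \<rho> F \<U>))) \<le> ln (card T * exp (\<kappa> * card F))"
      using le cover_number_refine_pos[OF \<U> F(1)] by (intro ln_mono) auto
    also have "\<dots> = ln (card T) + \<kappa> * card F" using \<open>card T > 0\<close> by (simp add: ln_mult_pos)
    finally show "ln (real (cover_number (cover_refine \<rho> F \<U>))) \<le>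
        ln (real (card (trajectory l F E))) + \<kappa> * card F" by (simp add: T_def)
  qed
qed

theorem h_top_eq_h_alg: "h_top \<rho> = h_alg l"
proof (rule antisym)
  show "h_top \<rho> \<le> h_alg l"
    unfolding h_top_def
  proof (rule SUP_least, rule ereal_le_epsilon2)
    fix \<U> :: "'k set set" and \<kappa> :: real assume "\<U> \<in> {\<U>. open_cover \<U>}" and \<kappa>: "\<kappa> > 0"
    then have \<U>: "open_cover \<U>" by simp
    obtain E where E: "finite E" "0 \<in> E" and le: "\<And>F. finite F \<Longrightarrow> F \<noteq> {} \<Longrightarrow>
      ln (real (cover_number (cover_refine \<rho> F \<U>))) \<le> ln (real (card (trajectory l F E))) + \<kappa> * card F"
      using cover_number_le_card_trajectory[OF \<U> \<kappa>] by blast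
    have "H_top \<rho> \<U> \<le> H_alg l E + \<kappa>"
      unfolding H_top_def H_alg_def
      by (rule folner_lim_le[OF subinvariant_cover[OF \<U>] subinvariant_trajectory[OF E] le])
    then have "ereal (H_top \<rho> \<U>) \<le> ereal (H_alg l E) + ereal \<kappa>" by simp
    also have "\<dots> \<le> h_alg l + ereal \<kappa>"
      unfolding h_alg_def using E by (intro add_right_mono SUP_upper) auto
    finally show "ereal (H_top \<rho> \<U>) \<le> h_alg l + ereal \<kappa>" .
  qed
  show "h_alg l \<le> h_top \<rho>"
    unfolding h_alg_def
  proof (rule SUP_least, rule ereal_le_epsilon2)
    fix E :: "'x set" and \<kappa> :: real assume "E \<in> {E. finite E \<and> 0 \<in> E}" and \<kappa>: "\<kappa> > 0"
    then have E: "finite E" "0 \<in> E" by auto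
    obtain \<U> where \<U>: "open_cover \<U>" and le: "\<And>F. finite F \<Longrightarrow> F \<noteq> {} \<Longrightarrow>
      ln (real (card (trajectory l F E))) \<le> ln (real (cover_number (cover_refine \<rho> F \<U>))) + \<kappa> * card F"
      using card_trajectory_le_cover_number[OF E \<kappa>] by blast
    have "H_alg l E \<le> H_top \<rho> \<U> + \<kappa>"
      unfolding H_top_def H_alg_def
      by (rule folner_lim_le[OF subinvariant_trajectory[OF E] subinvariant_cover[OF \<U>] le])
    then have "ereal (H_alg l E) \<le> ereal (H_top \<rho> \<U>) + ereal \<kappa>" by simp
    also have "\<dots> \<le> h_top \<rho> + ereal \<kappa>"
      unfolding h_top_def using \<U> by (intro add_right_mono SUP_upper) auto
    finally show "ereal (H_alg l E) \<le> h_top \<rho> + ereal \<kappa>" .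
  qed
qed

end

section \<open>Characters of the circle group\<close>

definition circle_exp :: "circle \<Rightarrow> complex" where
  "circle_exp a = cis (2 * pi * rep_circle a)"

lemma to_circle_rep: "to_circle (rep_circle a) = a"
  by (rule Quotient3_abs_rep[OF Quotient3_circle])

lemma circle_exp_to_circle: "circle_exp (to_circle x) = cis (2 * pi * x)"
proof -
  have "rep_circle (to_circle x) - x \<in> \<int>"
    using to_circle_rep[of "to_circle x"] by (simp add: to_circle_eq_iff)
  then have "cis (2 * pi * (rep_circle (to_circle x) - x)) = 1" by (rule cis_multiple_2pi)
  moreover have "cis (2 * pi * rep_circle (to_circle x)) =
      cis (2 * pi * (rep_circle (to_circle x) - x)) * cis (2 * pi * x)"
    by (simp add: cis_mult algebra_simps)
  ultimately show ?thesis by (simp add: circle_exp_def)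
qed

lemma circle_exp_add: "circle_exp (a + b) = circle_exp a * circle_exp b"
proof -
  obtain x y where "a = to_circle x" "b = to_circle y" using to_circle_surj by metis
  then show ?thesis
    by (simp add: circle_exp_to_circle cis_mult distrib_left flip: to_circle_add)
qed

lemma norm_circle_exp: "norm (circle_exp a) = 1"
  by (simp add: circle_exp_def)

lemma circle_exp_eq_1_iff: "circle_exp a = 1 \<longleftrightarrow> a = 0"
proof
  obtain x where x: "a = to_circle x" using to_circle_surj by metis
  assume "circle_exp a = 1"
  then have "exp (\<i> * (2 * pi * x)) = 1" using x by (simp add: circle_exp_to_circle cis_conv_exp)
  then obtain n :: int where "2 * pi * x = of_int (2 * n) * pi" by (auto simp: exp_eq_1)
  then have "x = of_int n" by simp
  then have "x \<in> \<int>" by simp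
  then show "a = 0" using x by (simp add: zero_circle_def to_circle_eq_iff)
next
  assume "a = 0"
  then show "circle_exp a = 1" by (simp add: zero_circle_def circle_exp_to_circle)
qed

lemma circle_exp_diff: "circle_exp (a - b) = circle_exp a / circle_exp b"
  using circle_exp_add[of "a - b" b] norm_circle_exp[of b] by (auto simp: field_simps)

lemma circle_exp_eq_iff: "circle_exp a = circle_exp b \<longleftrightarrow> a = b"
  using circle_exp_eq_1_iff[of "a - b"] norm_circle_exp[of b] by (auto simp: circle_exp_diff)

lemma circle_exp_surj:
  assumes "norm z = 1"
  shows "\<exists>a. circle_exp a = z"
proof -
  have "z \<noteq> 0" using assms by auto
  then have "circle_exp (to_circle (Arg z / (2 * pi))) = z"
    using assms by (simp add: circle_exp_to_circle cis_Arg sgn_div_norm)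
  then show ?thesis ..
qed

lemma continuous_to_circle: "continuous_on UNIV to_circle"
  by (simp add: continuous_on_open_vimage open_circle_def)

lemma continuous_circle_exp: "continuous_on UNIV circle_exp"
proof -
  have "open (circle_exp -` U)" if "open U" for U
  proof -
    have "to_circle -` circle_exp -` U = (\<lambda>x. cis (2 * pi * x)) -` U"
      by (auto simp: circle_exp_to_circle)
    moreover have "open ((\<lambda>x. cis (2 * pi * x)) -` U)"
      by (intro open_vimage that continuous_intros)
    ultimately show ?thesis by (simp add: open_circle_def)
  qed
  then show ?thesis by (simp add: continuous_on_open_vimage)
qed

lemma compact_circle: "compact (UNIV :: circle set)"
proof -
  have "a \<in> to_circle ` {0..1}" for a
  proof -
    obtain x where x: "a = to_circle x" using to_circle_surj by metis
    have "x - frac x \<in> \<int>" by (simp add: frac_def)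
    then have "a = to_circle (frac x)" by (simp add: x to_circle_eq_iff)
    then show ?thesis using frac_ge_0[of x] frac_lt_1[of x] by auto
  qed
  then have "to_circle ` {0..1} = UNIV" by auto
  moreover have "compact (to_circle ` {0..1})"
    using continuous_on_subset[OF continuous_to_circle] by (intro compact_continuous_image) auto
  ultimately show ?thesis by simp
qed

text \<open>The lift to R/Z is continuous because \<open>circle_exp\<close> is injective and
  continuous on a compact space, hence has a continuous inverse on its range.\<close>

lemma circle_character_of_complex:
  fixes f :: "'k::topological_ab_group_add \<Rightarrow> complex"
  assumes mult: "\<And>x y. f (x + y) = f x * f y" and norm: "\<And>x. norm (f x) = 1"
    and cont: "continuous_on UNIV f"
  obtains \<xi> :: "'k dual" where "\<And>x. circle_exp (character \<xi> x) = f x"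
proof -
  have "\<exists>a. circle_exp a = f x" for x by (rule circle_exp_surj[OF norm])
  then obtain g where g: "\<And>x. circle_exp (g x) = f x" by metis
  have "Modules.additive g"
    by (simp add: Modules.additive_def g mult circle_exp_add flip: circle_exp_eq_iff)
  moreover have "continuous_on UNIV g"
  proof -
    define h where "h = inv circle_exp"
    have h: "h (circle_exp a) = a" for a
      unfolding h_def by (rule inv_f_f) (auto intro: injI simp: circle_exp_eq_iff)
    have "continuous_on (range circle_exp) h"
      using h by (intro continuous_on_inv continuous_circle_exp compact_circle) auto
    moreover have "f ` UNIV \<subseteq> range circle_exp" using g by (metis image_subsetI rangeI)
    ultimately have "continuous_on UNIV (h \<circ> f)"
      by (intro continuous_on_compose cont) (rule continuous_on_subset)
    also have "h \<circ> f = g" using h by (simp add: fun_eq_iff flip: g)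
    finally show ?thesis .
  qed
  ultimately have "character (Abs_dual g) = g" by (intro Abs_dual_inverse) simp
  then show thesis using that[of "Abs_dual g"] g by simp
qed

lemma additive_character: "Modules.additive (character \<xi>)"
  using character[of \<xi>] by simp

lemma continuous_character: "continuous_on UNIV (character \<xi>)"
  using character[of \<xi>] by simp

section \<open>Duals of discrete groups\<close>

lemma compact_discrete_finite:
  fixes C :: "'a::discrete_topology set"
  assumes "compact C"
  shows "finite C"
proof -
  obtain D where D: "D \<subseteq> C" "finite D" "C \<subseteq> (\<Union>x\<in>D. {x})"
    by (rule compactE_image[OF assms, of C "\<lambda>x. {x}"]) (auto intro: open_discrete)
  then show ?thesis by (auto intro: finite_subset)
qed

text \<open>Tychonoff's theorem for the type of functions with the product topology.\<close>

lemma compact_UNIV_fun: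
  assumes "compact (UNIV :: 'b::topological_space set)"
  shows "compact (UNIV :: ('a \<Rightarrow> 'b) set)"
proof -
  have "compactin (product_topology (\<lambda>_::'a. euclidean :: 'b topology) UNIV) (PiE UNIV (\<lambda>_. UNIV))"
    using assms by (subst compactin_PiE) auto
  then show ?thesis by (simp add: PiE_UNIV_domain euclidean_product_topology)
qed

lemma open_dual_subbasis:
  "compact C \<Longrightarrow> open U \<Longrightarrow> open {\<xi>. character \<xi> ` C \<subseteq> U}"
  unfolding open_dual_def by (rule generate_topology.Basis) blast

lemma continuous_evaluation: "continuous_on UNIV (\<lambda>\<xi>. character \<xi> x)"
proof -
  have "open ((\<lambda>\<xi>. character \<xi> x) -` U)" if "open U" for U
    using open_dual_subbasis[of "{x}" U] that by (simp add: vimage_def)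
  then show ?thesis by (simp add: continuous_on_open_vimage)
qed

text \<open>The additive maps are closed in a compact power of the circle. Compact subsets of a
  discrete group are finite, so the compact-open topology is no finer than pointwise convergence and
  \<open>Abs_dual\<close> is continuous.\<close>

lemma compact_dual_discrete:
  "compact (UNIV :: 'x::{topological_ab_group_add, discrete_topology} dual set)"
proof -
  define H where "H = {f :: 'x \<Rightarrow> circle. Modules.additive f}"
  have cont: "continuous_on UNIV (\<lambda>f :: 'x \<Rightarrow> circle. circle_exp (f x))" for x
    by (rule continuous_on_compose2[OF continuous_circle_exp continuous_on_product_coordinates]) auto
  \<comment> \<open>Equations in the circle are tested after \<open>circle_exp\<close>, so that
    closedness comes from the Hausdorff plane.\<close>
  have "H = (\<Inter>x. \<Inter>y. {f. circle_exp (f (x + y)) = circle_exp (f x) * circle_exp (f y)})"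
    by (auto simp: H_def Modules.additive_def circle_exp_eq_iff simp flip: circle_exp_add)
  moreover have "closed {f :: 'x \<Rightarrow> circle. circle_exp (f (x + y)) = circle_exp (f x) * circle_exp (f y)}" for x y
    by (intro closed_Collect_eq continuous_intros cont)
  ultimately have "closed H" by (simp add: closed_INT)
  then have "compact H"
    using compact_Int_closed[OF compact_UNIV_fun[OF compact_circle], of H] by simp
  have ch: "character (Abs_dual f) = f" if "f \<in> H" for f
    using that by (intro Abs_dual_inverse) (simp add: H_def)
  have "continuous_on H Abs_dual"
  proof (rule continuous_on_generate_topology[OF open_dual_def])
    fix B :: "'x dual set" assume "B \<in> {{\<xi>. character \<xi> ` C \<subseteq> U} |C U. compact C \<and> open U}"
    then obtain C and U :: "circle set" where B: "B = {\<xi>. character \<xi> ` C \<subseteq> U}" "compact C" "open U" by blast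
    have "open (\<Inter>x\<in>C. (\<lambda>f :: 'x \<Rightarrow> circle. f x) -` U)"
      using compact_discrete_finite[OF B(2)] B(3)
      by (intro open_INT ballI open_vimage continuous_on_product_coordinates) auto
    moreover have "(\<Inter>x\<in>C. (\<lambda>f. f x) -` U) \<inter> H = Abs_dual -` B \<inter> H"
      using ch by (auto simp: B)
    ultimately show "\<exists>W. open W \<and> W \<inter> H = Abs_dual -` B \<inter> H" by blast
  qed
  then have "compact (Abs_dual ` H)" using \<open>compact H\<close> by (rule compact_continuous_image)
  moreover have "Abs_dual ` H = UNIV"
  proof -
    have "\<xi> \<in> Abs_dual ` H" for \<xi> :: "'x dual"
      by (rule image_eqI[of _ _ "character \<xi>"]) (simp_all add: character_inverse H_def additive_character)
    then show ?thesis by blast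
  qed
  ultimately show ?thesis by simp
qed

lemma continuous_dual_map:
  fixes \<phi> :: "'g::topological_ab_group_add \<Rightarrow> 'h::topological_ab_group_add"
  assumes "Modules.additive \<phi>" "continuous_on UNIV \<phi>"
  shows "continuous_on UNIV (dual_map \<phi>)"
proof (rule continuous_on_generate_topology[OF open_dual_def])
  fix B :: "'g dual set" assume "B \<in> {{\<xi>. character \<xi> ` C \<subseteq> U} |C U. compact C \<and> open U}"
  then obtain C U where B: "B = {\<xi>. character \<xi> ` C \<subseteq> U}" "compact C" "open U" by blast
  have "compact (\<phi> ` C)"
    using assms(2) B(2) by (intro compact_continuous_image) (auto intro: continuous_on_subset)
  then have "open {\<xi>. character \<xi> ` \<phi> ` C \<subseteq> U}" using B(3) by (rule open_dual_subbasis)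
  moreover have "{\<xi>. character \<xi> ` \<phi> ` C \<subseteq> U} = dual_map \<phi> -` B"
    by (simp add: B character_dual_map[OF assms] image_comp vimage_def)
  ultimately show "\<exists>W. open W \<and> W \<inter> UNIV = dual_map \<phi> -` B \<inter> UNIV" by auto
qed

subsection \<open>Extension of characters\<close>

primrec nat_multiple :: "nat \<Rightarrow> 'a::ab_group_add \<Rightarrow> 'a" where
  "nat_multiple 0 x = 0"
| "nat_multiple (Suc n) x = x + nat_multiple n x"

lemma nat_multiple_add: "nat_multiple (m + n) x = nat_multiple m x + nat_multiple n x"
  by (induction m) (auto simp: algebra_simps)

lemma nat_multiple_mult: "nat_multiple (m * n) x = nat_multiple m (nat_multiple n x)"
  by (induction m) (auto simp: nat_multiple_add)

lemma nat_multiple_zero [simp]: "nat_multiple n 0 = 0"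
  by (induction n) auto

lemma nat_multiple_to_circle: "nat_multiple n (to_circle x) = to_circle (n * x)"
  by (induction n) (auto simp: zero_circle_def algebra_simps simp flip: to_circle_add)

text \<open>The graph of a homomorphism on a subgroup, as a subgroup of the product that meets the
  second factor trivially. In this form a chain of extensions is joined by its union.\<close>

definition partial_hom :: "('a::ab_group_add \<times> 'b::ab_group_add) set \<Rightarrow> bool" where
  "partial_hom G \<longleftrightarrow> (0, 0) \<in> G \<and>
     (\<forall>a s b t. (a, s) \<in> G \<longrightarrow> (b, t) \<in> G \<longrightarrow> (a - b, s - t) \<in> G) \<and>
     (\<forall>t. (0, t) \<in> G \<longrightarrow> t = 0)"

lemma partial_hom_zero: "partial_hom G \<Longrightarrow> (0, 0) \<in> G"
  by (simp add: partial_hom_def)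

lemma partial_hom_diff: "partial_hom G \<Longrightarrow> (a, s) \<in> G \<Longrightarrow> (b, t) \<in> G \<Longrightarrow> (a - b, s - t) \<in> G"
  by (simp add: partial_hom_def)

lemma partial_hom_uminus: "partial_hom G \<Longrightarrow> (b, t) \<in> G \<Longrightarrow> (- b, - t) \<in> G"
  using partial_hom_diff[of G 0 0 b t] by (simp add: partial_hom_def)

lemma partial_hom_add: "partial_hom G \<Longrightarrow> (a, s) \<in> G \<Longrightarrow> (b, t) \<in> G \<Longrightarrow> (a + b, s + t) \<in> G"
  using partial_hom_diff[of G a s "- b" "- t"] partial_hom_uminus[of G b t] by simp

lemma partial_hom_nat_multiple:
  "partial_hom G \<Longrightarrow> (a, s) \<in> G \<Longrightarrow> (nat_multiple n a, nat_multiple n s) \<in> G"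
  by (induction n) (auto simp: partial_hom_add partial_hom_zero)

lemma partial_hom_unique: "partial_hom G \<Longrightarrow> (a, s) \<in> G \<Longrightarrow> (a, t) \<in> G \<Longrightarrow> s = t"
  using partial_hom_diff[of G a s a t] by (auto simp: partial_hom_def)

text \<open>The consistency condition for sending \<open>y\<close> to \<open>c\<close>: it concerns
  the multiples of \<open>y\<close> that already lie in the domain.\<close>

definition extendable :: "('a::ab_group_add \<times> 'b::ab_group_add) set \<Rightarrow> 'a \<Rightarrow> 'b \<Rightarrow> bool" where
  "extendable G y c \<longleftrightarrow> (\<forall>n t. (nat_multiple n y, t) \<in> G \<longrightarrow> t = nat_multiple n c)"

lemma partial_hom_extend:
  assumes G: "partial_hom G" and c: "extendable G y c"
  obtains G' where "partial_hom G'" "G \<subseteq> G'" "(y, c) \<in> G'"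
proof -
  \<comment> \<open>Two natural multipliers \<open>i\<close> and \<open>j\<close> represent the
    integer multiple \<open>i - j\<close> of \<open>(y, c)\<close>.\<close>
  define G' where "G' = {(h + nat_multiple i y - nat_multiple j y, t + nat_multiple i c - nat_multiple j c)
    | h t i j. (h, t) \<in> G}"
  have G'I: "(a, s) \<in> G'" if "(h, t) \<in> G" "a = h + nat_multiple i y - nat_multiple j y"
    "s = t + nat_multiple i c - nat_multiple j c" for a s h t i j
    using that unfolding G'_def by blast
  have G'E: "\<exists>h t i j. (h, t) \<in> G \<and> a = h + nat_multiple i y - nat_multiple j y \<and>
     s = t + nat_multiple i c - nat_multiple j c" if "(a, s) \<in> G'" for a s
    using that unfolding G'_def by blast
  have key: "t + nat_multiple i c = nat_multiple j c"
    if "(h, t) \<in> G" "h + nat_multiple i y = nat_multiple j y" "i \<le> j" for h t i j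
  proof -
    have j: "j = (j - i) + i" using that(3) by simp
    have "h = nat_multiple (j - i) y"
      using that(2) by (subst (asm) j, subst (asm) nat_multiple_add) simp
    then have "t = nat_multiple (j - i) c" using c that(1) by (simp add: extendable_def)
    then show ?thesis by (subst j, subst nat_multiple_add) simp
  qed
  have "partial_hom G'"
    unfolding partial_hom_def
  proof (intro conjI allI impI)
    show "(0, 0) \<in> G'" using G by (intro G'I[of 0 0 _ 0 0]) (auto simp: partial_hom_def)
  next
    fix a s b t assume "(a, s) \<in> G'" "(b, t) \<in> G'"
    then obtain h u i j h' u' i' j' where
      1: "(h, u) \<in> G" "a = h + nat_multiple i y - nat_multiple j y" "s = u + nat_multiple i c - nat_multiple j c"
      and 2: "(h', u') \<in> G" "b = h' + nat_multiple i' y - nat_multiple j' y" "t = u' + nat_multiple i' c - nat_multiple j' c"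
      using G'E by metis
    show "(a - b, s - t) \<in> G'"
      by (rule G'I[OF partial_hom_diff[OF G 1(1) 2(1)], of _ "i + j'" "j + i'"])
        (simp_all add: 1 2 nat_multiple_add algebra_simps)
  next
    fix s assume "(0, s) \<in> G'"
    then obtain h t i j where 1: "(h, t) \<in> G" "0 = h + nat_multiple i y - nat_multiple j y"
      "s = t + nat_multiple i c - nat_multiple j c" using G'E by metis
    show "s = 0"
    proof (cases "i \<le> j")
      case True
      then show ?thesis using key[OF 1(1), of i j] 1 by simp
    next
      case False
      have "- h + nat_multiple j y = nat_multiple i y" using 1(2) by (simp add: algebra_simps)
      then have "- t + nat_multiple j c = nat_multiple i c"
        using key[OF partial_hom_uminus[OF G 1(1)], of j i] False by simp
      then show ?thesis using 1(3) by (simp add: algebra_simps)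
    qed
  qed
  moreover have "G \<subseteq> G'"
    by (auto intro!: G'I[of _ _ _ 0 0])
  moreover have "(y, c) \<in> G'"
    using G by (intro G'I[of 0 0 _ 1 0]) (auto simp: partial_hom_def)
  ultimately show thesis by (rule that)
qed

text \<open>The multiples of \<open>y\<close> in the domain are generated by the least positive one,
  the \<open>n\<close>-th. So only \<open>nat_multiple n c = t0\<close> has to be solved, by
  dividing a real representative of \<open>t0\<close> by \<open>n\<close>.\<close>

lemma ex_extendable:
  fixes G :: "('a::ab_group_add \<times> circle) set"
  assumes G: "partial_hom G"
  shows "\<exists>c. extendable G y c"
proof (cases "\<exists>n>0. \<exists>t. (nat_multiple n y, t) \<in> G")
  case False
  then have "extendable G y 0"
    unfolding extendable_def
    by (metis G gr0I nat_multiple.simps(1) partial_hom_def)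
  then show ?thesis ..
next
  case True
  define n where "n = (LEAST n. n > 0 \<and> (\<exists>t. (nat_multiple n y, t) \<in> G))"
  have n: "n > 0 \<and> (\<exists>t. (nat_multiple n y, t) \<in> G)"
    unfolding n_def using True by (rule LeastI_ex)
  then obtain t0 where t0: "(nat_multiple n y, t0) \<in> G" by blast
  obtain r where r: "t0 = to_circle r" using to_circle_surj by metis
  define c where "c = to_circle (r / n)"
  have nc: "nat_multiple n c = t0" using n by (simp add: c_def nat_multiple_to_circle r)
  have "t = nat_multiple m c" if m: "(nat_multiple m y, t) \<in> G" for m t
  proof -
    have q: "m = m mod n + (m div n) * n" by simp
    have "nat_multiple m y = nat_multiple (m mod n) y + nat_multiple (m div n) (nat_multiple n y)"
      by (metis q nat_multiple_add nat_multiple_mult)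
    then have mod: "(nat_multiple (m mod n) y, t - nat_multiple (m div n) t0) \<in> G"
      using partial_hom_diff[OF G m partial_hom_nat_multiple[OF G t0, of "m div n"]] by simp
    have "m mod n = 0"
    proof (rule ccontr)
      assume "m mod n \<noteq> 0"
      then have "n \<le> m mod n" unfolding n_def using mod by (intro Least_le) (auto simp: n_def)
      then show False using mod_less_divisor[of n m] n by linarith
    qed
    then have "t - nat_multiple (m div n) t0 = 0"
      using mod by (intro partial_hom_unique[OF G _ partial_hom_zero[OF G]]) simp
    then have "t = nat_multiple ((m div n) * n) c" by (simp add: nat_multiple_mult nc)
    then show ?thesis using \<open>m mod n = 0\<close> by (metis q add_0)
  qed
  then show ?thesis unfolding extendable_def by blast
qed

text \<open>Zorn's lemma: a maximal graph is defined everywhere, as any further \<open>y\<close>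
  could still be adjoined by \<open>ex_extendable\<close>.\<close>

lemma ex_additive_extension:
  fixes G0 :: "('a::ab_group_add \<times> circle) set"
  assumes "partial_hom G0"
  shows "\<exists>\<phi>. Modules.additive \<phi> \<and> (\<forall>(a, s)\<in>G0. \<phi> a = s)"
proof -
  let ?A = "{G. partial_hom G \<and> G0 \<subseteq> G}"
  have "\<exists>M\<in>?A. \<forall>X\<in>?A. M \<subseteq> X \<longrightarrow> X = M"
  proof (rule subset_Zorn_nonempty)
    show "?A \<noteq> {}" using assms by auto
    fix \<C> assume \<C>: "\<C> \<noteq> {}" "subset.chain ?A \<C>"
    have ph: "partial_hom G" "G0 \<subseteq> G" if "G \<in> \<C>" for G
      using \<C>(2) that by (auto simp: subset.chain_def)
    obtain G1 where G1: "G1 \<in> \<C>" using \<C>(1) by auto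
    have "partial_hom (\<Union>\<C>)"
      unfolding partial_hom_def
    proof (intro conjI allI impI)
      show "(0, 0) \<in> \<Union>\<C>" using ph(1)[OF G1] G1 by (auto simp: partial_hom_def)
    next
      fix a s b t assume "(a, s) \<in> \<Union>\<C>" "(b, t) \<in> \<Union>\<C>"
      then obtain G H where GH: "G \<in> \<C>" "H \<in> \<C>" "(a, s) \<in> G" "(b, t) \<in> H" by auto
      then have "G \<subset> H \<or> G = H \<or> H \<subset> G" using \<C>(2) unfolding subset.chain_def by blast
      then have "G \<subseteq> H \<or> H \<subseteq> G" by auto
      then show "(a - b, s - t) \<in> \<Union>\<C>"
        using GH partial_hom_diff[OF ph(1)] by (meson UnionI subsetD)
    next
      fix t assume "(0, t) \<in> \<Union>\<C>"
      then obtain G where "G \<in> \<C>" "(0, t) \<in> G" by auto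
      then show "t = 0" using ph(1) by (auto simp: partial_hom_def)
    qed
    moreover have "G0 \<subseteq> \<Union>\<C>" using ph(2)[OF G1] G1 by auto
    ultimately show "\<Union>\<C> \<in> ?A" by simp
  qed
  then obtain M where "M \<in> ?A" and max: "\<forall>X\<in>?A. M \<subseteq> X \<longrightarrow> X = M" by (rule bexE)
  then have M: "partial_hom M" "G0 \<subseteq> M" by simp_all
  have "\<exists>c. (y, c) \<in> M" for y
  proof -
    obtain c where c: "extendable M y c" using ex_extendable[OF M(1)] by (rule exE)
    obtain G' where "partial_hom G'" "M \<subseteq> G'" "(y, c) \<in> G'"
      by (rule partial_hom_extend[OF M(1) c])
    moreover from this have "G' = M" using M(2) max by (intro bspec[OF max, THEN mp]) simp_all
    ultimately show ?thesis by blast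
  qed
  then obtain \<phi> where \<phi>: "\<And>y. (y, \<phi> y) \<in> M" by metis
  have "Modules.additive \<phi>"
    unfolding Modules.additive_def
    by (intro allI partial_hom_unique[OF M(1) \<phi> partial_hom_add[OF M(1) \<phi> \<phi>]])
  moreover have "\<forall>(a, s)\<in>G0. \<phi> a = s"
    using partial_hom_unique[OF M(1) \<phi>] M(2) by auto
  ultimately show ?thesis by blast
qed

text \<open>The value at \<open>x\<close> must be killed by every multiplier that kills
  \<open>x\<close>: the class of \<open>1 / 2\<close> serves for infinite order, that of
  \<open>1 / n\<close> for order \<open>n\<close>. The map then extends from the subgroup generated
  by \<open>x\<close>.\<close>

lemma ex_additive_nonzero:
  fixes x :: "'a::ab_group_add"
  assumes "x \<noteq> 0"
  shows "\<exists>\<phi> :: 'a \<Rightarrow> circle. Modules.additive \<phi> \<and> \<phi> x \<noteq> 0"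
proof -
  have "\<exists>c :: circle. c \<noteq> 0 \<and> (\<forall>n. nat_multiple n x = 0 \<longrightarrow> nat_multiple n c = 0)"
  proof (cases "\<exists>n>0. nat_multiple n x = 0")
    case False
    have "(1 / 2 :: real) \<notin> \<int>" by (auto elim!: Ints_cases)
    then have "to_circle (1 / 2) \<noteq> 0" by (simp add: zero_circle_def to_circle_eq_iff)
    moreover have "n = 0" if "nat_multiple n x = 0" for n using False that by (cases n) auto
    ultimately show ?thesis by (metis nat_multiple.simps(1))
  next
    case True
    define n where "n = (LEAST n. n > 0 \<and> nat_multiple n x = 0)"
    have n: "n > 0 \<and> nat_multiple n x = 0" unfolding n_def using True by (rule LeastI_ex)
    have "n \<noteq> 1" using n assms by auto
    then have n2: "n \<ge> 2" using n by simp
    have "(1 / n :: real) \<notin> \<int>"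
    proof
      assume "(1 / n :: real) \<in> \<int>"
      moreover have "\<bar>1 / real n\<bar> < 1" using n2 by simp
      ultimately have "1 / real n = 0" using Ints_nonzero_abs_less1 by blast
      then show False using n2 by simp
    qed
    then have "to_circle (1 / n) \<noteq> 0" by (simp add: zero_circle_def to_circle_eq_iff)
    moreover have "nat_multiple m (to_circle (1 / n)) = 0" if m: "nat_multiple m x = 0" for m
    proof -
      have q: "m = m mod n + (m div n) * n" by simp
      have "nat_multiple m x = nat_multiple (m mod n) x + nat_multiple (m div n) (nat_multiple n x)"
        by (metis q nat_multiple_add nat_multiple_mult)
      then have mod: "nat_multiple (m mod n) x = 0" using m n by simp
      have "m mod n = 0"
      proof (rule ccontr)
        assume "m mod n \<noteq> 0"
        then have "n \<le> m mod n" unfolding n_def using mod by (intro Least_le) (auto simp: n_def)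
        then show False using mod_less_divisor[of n m] n by linarith
      qed
      then obtain k where "m = n * k" by (auto simp: mod_eq_0_iff_dvd)
      then show ?thesis using n by (simp add: nat_multiple_to_circle zero_circle_def to_circle_eq_iff)
    qed
    ultimately show ?thesis by blast
  qed
  then obtain c :: circle where c: "c \<noteq> 0" "\<And>n. nat_multiple n x = 0 \<Longrightarrow> nat_multiple n c = 0" by blast
  have "partial_hom {(0 :: 'a, 0 :: circle)}" by (simp add: partial_hom_def)
  moreover have "extendable {(0 :: 'a, 0 :: circle)} x c" using c(2) by (auto simp: extendable_def)
  ultimately obtain G where G: "partial_hom G" "(x, c) \<in> G" by (rule partial_hom_extend)
  obtain \<phi> where \<phi>: "Modules.additive \<phi>" "\<forall>(a, s)\<in>G. \<phi> a = s"
    using ex_additive_extension[OF G(1)] by (elim exE conjE)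
  from \<phi>(2) G(2) have "\<phi> x = c" by fastforce
  with \<phi>(1) show ?thesis using c(1) by blast
qed

section \<open>The mean of a continuous function on a compact Abelian group\<close>

subsection \<open>Finite averages of translates\<close>

text \<open>Operators rather than averaged functions, so that the same average can be applied to
  several functions and two averages can be composed.\<close>

inductive_set averages :: "(('k::ab_group_add \<Rightarrow> complex) \<Rightarrow> 'k \<Rightarrow> complex) set" where
  id: "(\<lambda>f. f) \<in> averages"
| step: "P \<in> averages \<Longrightarrow> finite A \<Longrightarrow> A \<noteq> {} \<Longrightarrow> (\<lambda>f x. (\<Sum>a\<in>A. P f (x + a)) / of_nat (card A)) \<in> averages"

lemma averages_add:
  "P \<in> averages \<Longrightarrow> P (\<lambda>x. f x + g x) = (\<lambda>x. P f x + P g x)"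
  by (induction rule: averages.induct) (auto simp: sum.distrib add_divide_distrib)

lemma averages_scale:
  "P \<in> averages \<Longrightarrow> P (\<lambda>x. c * f x) = (\<lambda>x. c * P f x)"
  by (induction rule: averages.induct) (auto simp: sum_distrib_left)

lemma averages_diff:
  "P \<in> averages \<Longrightarrow> P (\<lambda>x. f x - g x) = (\<lambda>x. P f x - P g x)"
  using averages_add[of P f "\<lambda>x. -1 * g x"] averages_scale[of P "-1" g] by (simp add: fun_eq_iff)

lemma averages_const: "P \<in> averages \<Longrightarrow> P (\<lambda>x. c) = (\<lambda>x. c)"
  by (induction rule: averages.induct) (auto simp: fun_eq_iff)

lemma averages_cnj: "P \<in> averages \<Longrightarrow> P (\<lambda>x. cnj (f x)) = (\<lambda>x. cnj (P f x))"
  by (induction rule: averages.induct) auto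

lemma averages_sum:
  assumes P: "P \<in> averages" and "finite A"
  shows "P (\<lambda>x. \<Sum>a\<in>A. f a x) = (\<lambda>x. \<Sum>a\<in>A. P (f a) x)"
  using assms(2)
  by (induction A rule: finite_induct) (simp_all add: averages_const[OF P] averages_add[OF P])

lemma averages_translate:
  "P \<in> averages \<Longrightarrow> P (\<lambda>x. f (x + b)) = (\<lambda>x. P f (x + b))"
proof (induction rule: averages.induct)
  case (step P A)
  have "(\<Sum>a\<in>A. P (\<lambda>x. f (x + b)) (x + a)) = (\<Sum>a\<in>A. P f (x + b + a))" for x
    by (rule sum.cong[OF refl], subst fun_cong[OF step.IH]) (simp add: add_ac)
  then show ?case by simp
qed simp

text \<open>Averages are linear and translations of an Abelian group commute. Uniqueness and
  existence of the mean both rest on this.\<close>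

lemma averages_commute: "P \<in> averages \<Longrightarrow> Q \<in> averages \<Longrightarrow> P (Q f) = Q (P f)"
proof (induction rule: averages.induct)
  case (step P A)
  have "Q (\<lambda>x. (\<Sum>a\<in>A. P f (x + a)) / of_nat (card A)) =
    Q (\<lambda>x. (1 / of_nat (card A)) * (\<Sum>a\<in>A. P f (x + a)))" by simp
  also have "\<dots> = (\<lambda>x. (1 / of_nat (card A)) * (\<Sum>a\<in>A. Q (P f) (x + a)))"
    by (simp only: averages_scale[OF step.prems] averages_sum[OF step.prems step.hyps(2)]
        averages_translate[OF step.prems])
  finally show ?case using step by simp
qed simp

lemma averages_compose: "P \<in> averages \<Longrightarrow> Q \<in> averages \<Longrightarrow> (\<lambda>f. P (Q f)) \<in> averages"
proof (induction rule: averages.induct)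
  case (step P A)
  then show ?case using averages.step[of "\<lambda>f. P (Q f)" A] by simp
qed simp

lemma averages_uminus:
  "P \<in> averages \<Longrightarrow> \<exists>P'\<in>averages. \<forall>f x. P (\<lambda>x. f (- x)) x = P' f (- x)"
proof (induction rule: averages.induct)
  case id
  then show ?case by (intro bexI[of _ "\<lambda>f. f"]) (auto intro: averages.id)
next
  case (step P A)
  then obtain P' where P': "P' \<in> averages" "\<And>f x. P (\<lambda>x. f (- x)) x = P' f (- x)" by blast
  let ?Q = "\<lambda>f x. (\<Sum>a\<in>uminus ` A. P' f (x + a)) / of_nat (card (uminus ` A))"
  have "?Q \<in> averages" using step P' by (intro averages.step) auto
  moreover have "(\<Sum>a\<in>A. P (\<lambda>x. f (- x)) (x + a)) / of_nat (card A) = ?Q f (- x)" for f x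
  proof -
    have "(\<Sum>a\<in>A. P (\<lambda>x. f (- x)) (x + a)) = (\<Sum>a\<in>A. P' f (- x + - a))"
      by (rule sum.cong[OF refl], subst P'(2)) (simp add: algebra_simps)
    then show ?thesis by (simp add: sum.reindex card_image algebra_simps)
  qed
  ultimately show ?case by (intro bexI[of _ ?Q]) auto
qed

lemma norm_averages_le:
  "P \<in> averages \<Longrightarrow> (\<And>x. norm (f x) \<le> M) \<Longrightarrow> norm (P f x) \<le> M"
proof (induction arbitrary: x rule: averages.induct)
  case (step P A)
  have "norm (\<Sum>a\<in>A. P f (x + a)) \<le> (\<Sum>a\<in>A. M)" using step by (intro sum_norm_le) auto
  moreover have "card A > 0" using step by (simp add: card_gt_0_iff)
  ultimately show ?case by (simp add: norm_divide field_simps)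
qed simp

lemma Re_averages_ge:
  "P \<in> averages \<Longrightarrow> (\<And>x. M \<le> Re (f x)) \<Longrightarrow> M \<le> Re (P f x)"
proof (induction arbitrary: x rule: averages.induct)
  case (step P A)
  have "(\<Sum>a\<in>A. M) \<le> (\<Sum>a\<in>A. Re (P f (x + a)))" using step by (intro sum_mono) auto
  moreover have "card A > 0" using step by (simp add: card_gt_0_iff)
  ultimately show ?case by (simp add: field_simps)
qed simp

text \<open>Averages fix constants and do not increase the sup norm, so further averaging never
  spoils an approximation.\<close>

lemma averages_close:
  assumes "P \<in> averages" "\<And>x. norm (f x - c) \<le> \<epsilon>"
  shows "norm (P f x - c) \<le> \<epsilon>"
proof -
  have "P (\<lambda>x. f x - c) = (\<lambda>x. P f x - c)"
    using averages_diff[OF assms(1), of f "\<lambda>_. c"] averages_const[OF assms(1), of c] by simp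
  then show ?thesis using norm_averages_le[OF assms(1), of "\<lambda>x. f x - c" \<epsilon> x] assms(2) by simp
qed

text \<open>Von Neumann's description of the Haar integral of a continuous function.\<close>

definition has_mean :: "('k::ab_group_add \<Rightarrow> complex) \<Rightarrow> complex \<Rightarrow> bool" where
  "has_mean f c \<longleftrightarrow> (\<forall>\<epsilon>>0. \<exists>P\<in>averages. \<forall>x. norm (P f x - c) \<le> \<epsilon>)"

text \<open>Averages commute, so two averages that are almost constant have almost the same value.\<close>

lemma has_mean_unique:
  assumes "has_mean f c" "has_mean f d"
  shows "c = d"
proof (rule ccontr)
  assume "c \<noteq> d"
  then have \<epsilon>: "norm (c - d) / 3 > 0" by simp
  then obtain P Q where P: "P \<in> averages" "\<And>x. norm (P f x - c) \<le> norm (c - d) / 3"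
    and Q: "Q \<in> averages" "\<And>x. norm (Q f x - d) \<le> norm (c - d) / 3"
    using assms unfolding has_mean_def by blast
  have "norm (Q (P f) 0 - c) \<le> norm (c - d) / 3" by (rule averages_close[OF Q(1) P(2)])
  moreover have "norm (P (Q f) 0 - d) \<le> norm (c - d) / 3" by (rule averages_close[OF P(1) Q(2)])
  ultimately have "norm ((P (Q f) 0 - d) - (Q (P f) 0 - c)) \<le> norm (c - d) / 3 + norm (c - d) / 3"
    by (rule order_trans[OF norm_triangle_ineq4 add_mono, rotated])
  then show False using \<epsilon> by (simp add: averages_commute[OF P(1) Q(1)])
qed

lemma has_mean_add:
  assumes "has_mean f c" "has_mean g d"
  shows "has_mean (\<lambda>x. f x + g x) (c + d)"
  unfolding has_mean_def
proof (intro allI impI)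
  fix \<epsilon> :: real assume "\<epsilon> > 0"
  then have "\<epsilon> / 2 > 0" by simp
  then obtain P Q where P: "P \<in> averages" "\<And>x. norm (P f x - c) \<le> \<epsilon> / 2"
    and Q: "Q \<in> averages" "\<And>x. norm (Q g x - d) \<le> \<epsilon> / 2"
    using assms unfolding has_mean_def by blast
  have "norm (P (Q (\<lambda>x. f x + g x)) x - (c + d)) \<le> \<epsilon>" for x
  proof -
    have "P (Q (\<lambda>x. f x + g x)) x - (c + d) = (Q (P f) x - c) + (P (Q g) x - d)"
      by (simp only: averages_add[OF P(1)] averages_add[OF Q(1)] averages_commute[OF P(1) Q(1), of f])
        (simp add: algebra_simps)
    also have "norm \<dots> \<le> \<epsilon> / 2 + \<epsilon> / 2"
      by (rule norm_triangle_mono[OF averages_close[OF Q(1) P(2)] averages_close[OF P(1) Q(2)]])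
    finally show ?thesis by simp
  qed
  then show "\<exists>P\<in>averages. \<forall>x. norm (P (\<lambda>x. f x + g x) x - (c + d)) \<le> \<epsilon>"
    using averages_compose[OF P(1) Q(1)] by (intro bexI[of _ "\<lambda>f. P (Q f)"]) auto
qed

lemma has_mean_scale:
  assumes "has_mean f c"
  shows "has_mean (\<lambda>x. a * f x) (a * c)"
  unfolding has_mean_def
proof (intro allI impI)
  fix \<epsilon> :: real assume \<epsilon>: "\<epsilon> > 0"
  have a: "norm a + 1 > 0" by (simp add: add_nonneg_pos)
  then have "\<epsilon> / (norm a + 1) > 0" using \<epsilon> by simp
  then obtain P where P: "P \<in> averages" "\<And>x. norm (P f x - c) \<le> \<epsilon> / (norm a + 1)"
    using assms unfolding has_mean_def by blast
  have "norm (P (\<lambda>x. a * f x) x - a * c) \<le> \<epsilon>" for x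
  proof -
    have "norm (P (\<lambda>x. a * f x) x - a * c) = norm a * norm (P f x - c)"
      by (simp add: averages_scale[OF P(1)] norm_mult flip: right_diff_distrib)
    also have "\<dots> \<le> (norm a + 1) * (\<epsilon> / (norm a + 1))" by (intro mult_mono P) auto
    finally show ?thesis using a by simp
  qed
  then show "\<exists>P\<in>averages. \<forall>x. norm (P (\<lambda>x. a * f x) x - a * c) \<le> \<epsilon>" using P(1) by blast
qed

lemma has_mean_const: "has_mean (\<lambda>x. c) c"
  unfolding has_mean_def using averages.id by (auto intro!: bexI[of _ "\<lambda>f. f"])

lemma has_mean_cnj:
  assumes "has_mean f c"
  shows "has_mean (\<lambda>x. cnj (f x)) (cnj c)"
  unfolding has_mean_def
proof (intro allI impI)
  fix \<epsilon> :: real assume "\<epsilon> > 0"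
  then obtain P where P: "P \<in> averages" "\<And>x. norm (P f x - c) \<le> \<epsilon>"
    using assms unfolding has_mean_def by blast
  have "norm (P (\<lambda>x. cnj (f x)) x - cnj c) \<le> \<epsilon>" for x
    using P(2)[of x] by (simp add: averages_cnj[OF P(1)] flip: complex_cnj_diff)
  then show "\<exists>P\<in>averages. \<forall>x. norm (P (\<lambda>x. cnj (f x)) x - cnj c) \<le> \<epsilon>" using P(1) by blast
qed

lemma has_mean_translate:
  assumes "has_mean f c"
  shows "has_mean (\<lambda>x. f (x + b)) c"
  unfolding has_mean_def
proof (intro allI impI)
  fix \<epsilon> :: real assume "\<epsilon> > 0"
  then obtain P where P: "P \<in> averages" "\<And>x. norm (P f x - c) \<le> \<epsilon>"
    using assms unfolding has_mean_def by blast
  have "norm (P (\<lambda>x. f (x + b)) x - c) \<le> \<epsilon>" for x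
    using P(2) by (simp add: averages_translate[OF P(1)])
  then show "\<exists>P\<in>averages. \<forall>x. norm (P (\<lambda>x. f (x + b)) x - c) \<le> \<epsilon>" using P(1) by blast
qed

lemma has_mean_uminus:
  assumes "has_mean f c"
  shows "has_mean (\<lambda>x. f (- x)) c"
  unfolding has_mean_def
proof (intro allI impI)
  fix \<epsilon> :: real assume "\<epsilon> > 0"
  then obtain P where P: "P \<in> averages" "\<And>x. norm (P f x - c) \<le> \<epsilon>"
    using assms unfolding has_mean_def by blast
  obtain P' where P': "P' \<in> averages" "\<And>g x. P (\<lambda>x. g (- x)) x = P' g (- x)"
    using averages_uminus[OF P(1)] by blast
  have "P' (\<lambda>x. f (- x)) x = P f (- x)" for x
    using P'(2)[of "\<lambda>x. f (- x)" "- x"] by simp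
  then show "\<exists>P\<in>averages. \<forall>x. norm (P (\<lambda>x. f (- x)) x - c) \<le> \<epsilon>"
    using P' P(2) by (intro bexI[of _ P']) auto
qed

lemma has_mean_Re_ge:
  assumes "has_mean f c" "\<And>x. M \<le> Re (f x)"
  shows "M \<le> Re c"
proof (rule field_le_epsilon)
  fix \<epsilon> :: real assume "\<epsilon> > 0"
  then obtain P where P: "P \<in> averages" "\<And>x. norm (P f x - c) \<le> \<epsilon>"
    using assms unfolding has_mean_def by blast
  have "M \<le> Re (P f 0)" by (rule Re_averages_ge[OF P(1) assms(2)])
  also have "\<dots> \<le> Re c + \<epsilon>" using abs_Re_le_cmod[of "P f 0 - c"] P(2)[of 0] by simp
  finally show "M \<le> Re c + \<epsilon>" .
qed

lemma has_mean_norm_le: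
  assumes "has_mean f c" "\<And>x. norm (f x) \<le> M"
  shows "norm c \<le> M"
proof (rule field_le_epsilon)
  fix \<epsilon> :: real assume "\<epsilon> > 0"
  then obtain P where P: "P \<in> averages" "\<And>x. norm (P f x - c) \<le> \<epsilon>"
    using assms unfolding has_mean_def by blast
  have "norm c \<le> norm (P f 0) + norm (P f 0 - c)" by (metis norm_triangle_sub norm_minus_commute)
  also have "\<dots> \<le> M + \<epsilon>" by (rule add_mono[OF norm_averages_le[OF P(1) assms(2)] P(2)])
  finally show "norm c \<le> M + \<epsilon>" .
qed

subsection \<open>Existence\<close>

locale compact_abelian_group =
  fixes K :: "'k::topological_ab_group_add itself"
  assumes compact: "compact (UNIV :: 'k set)"
begin

text \<open>The tube lemma around the zero displacement; the compact factor carries both the base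
  point and the second variable.\<close>

lemma uniformly_continuous2:
  fixes F :: "'k \<Rightarrow> 'k \<Rightarrow> complex"
  assumes F: "continuous_on UNIV (\<lambda>p. F (fst p) (snd p))" and \<epsilon>: "\<epsilon> > 0"
  obtains U where "open U" "0 \<in> U" "\<And>x x' y. x - x' \<in> U \<Longrightarrow> norm (F x y - F x' y) < \<epsilon>"
proof -
  define \<Phi> where "\<Phi> q = norm (F (fst (snd q) + fst q) (snd (snd q)) - F (fst (snd q)) (snd (snd q)))"
    for q :: "'k \<times> 'k \<times> 'k"
  have "continuous_on UNIV (\<lambda>q :: 'k \<times> 'k \<times> 'k. F (fst (snd q) + fst q) (snd (snd q)))"
    using continuous_on_compose2[OF F, of UNIV "\<lambda>q. (fst (snd q) + fst q, snd (snd q))"]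
    by (simp add: continuous_intros)
  moreover have "continuous_on UNIV (\<lambda>q :: 'k \<times> 'k \<times> 'k. F (fst (snd q)) (snd (snd q)))"
    using continuous_on_compose2[OF F, of UNIV "\<lambda>q. (fst (snd q), snd (snd q))"]
    by (simp add: continuous_intros)
  ultimately have "continuous_on UNIV \<Phi>" unfolding \<Phi>_def by (intro continuous_intros)
  then have "open {q. \<Phi> q < \<epsilon>}" by (intro open_Collect_less continuous_intros)
  moreover have "compact (UNIV :: ('k \<times> 'k) set)"
    using compact_Times[OF compact compact] by (simp add: UNIV_Times_UNIV)
  moreover have "{0} \<times> UNIV \<subseteq> {q. \<Phi> q < \<epsilon>}" using \<epsilon> by (auto simp: \<Phi>_def)
  ultimately obtain U where U: "0 \<in> U" "open U" "U \<times> UNIV \<subseteq> {q. \<Phi> q < \<epsilon>}"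
    using Elementary_Topology.tube_lemma[of UNIV "{q. \<Phi> q < \<epsilon>}" 0] by (elim exE conjE meta_impE)
  show thesis
  proof (rule that[OF U(2,1)])
    fix x x' y :: 'k assume "x - x' \<in> U"
    then have "(x - x', x', y) \<in> {q. \<Phi> q < \<epsilon>}" using U(3) by blast
    then show "norm (F x y - F x' y) < \<epsilon>" by (simp add: \<Phi>_def)
  qed
qed

lemma uniformly_continuous:
  fixes f :: "'k \<Rightarrow> complex"
  assumes f: "continuous_on UNIV f" and \<epsilon>: "\<epsilon> > 0"
  obtains U where "open U" "0 \<in> U" "\<And>x x'. x - x' \<in> U \<Longrightarrow> norm (f x - f x') < \<epsilon>"
proof -
  have "continuous_on UNIV (\<lambda>p :: 'k \<times> 'k. f (fst p))"
    using continuous_on_compose2[OF f, of UNIV fst] by (simp add: continuous_intros)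
  then show thesis
  proof (rule uniformly_continuous2[OF _ \<epsilon>])
    fix U assume "open U" "0 \<in> U" "\<And>x x' (y :: 'k). x - x' \<in> U \<Longrightarrow> norm (f x - f x') < \<epsilon>"
    then show thesis by (intro that[of U])
  qed
qed

lemma open_translate: "open U \<Longrightarrow> open {z :: 'k. z - a \<in> U}"
  using open_vimage[of U "\<lambda>z. z - a"] by (simp add: vimage_def continuous_intros)

lemma continuous_of_uniformly:
  fixes f :: "'k \<Rightarrow> complex"
  assumes "\<And>\<epsilon>. \<epsilon> > 0 \<Longrightarrow> \<exists>U. open U \<and> 0 \<in> U \<and> (\<forall>x x'. x - x' \<in> U \<longrightarrow> norm (f x - f x') \<le> \<epsilon>)"
  shows "continuous_on UNIV f"
  unfolding continuous_on_def
proof (intro ballI tendstoI)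
  fix a :: 'k and \<epsilon> :: real assume "\<epsilon> > 0"
  then obtain U where U: "open U" "0 \<in> U" "\<forall>x x'. x - x' \<in> U \<longrightarrow> norm (f x - f x') \<le> \<epsilon> / 2"
    using assms[of "\<epsilon> / 2"] by auto
  have "\<forall>\<^sub>F x in at a. x \<in> {z. z - a \<in> U}"
    using U by (intro eventually_at_in_open' open_translate) auto
  then show "\<forall>\<^sub>F x in at a within UNIV. dist (f x) (f a) < \<epsilon>"
    using U(3) \<open>\<epsilon> > 0\<close> by (elim eventually_mono) (fastforce simp: dist_norm)
qed

lemma finite_translates_cover:
  assumes "open U" "(0 :: 'k) \<in> U"
  obtains A where "finite A" "A \<noteq> {}" "\<And>z. \<exists>a\<in>A. z - a \<in> U"
proof -
  obtain A where A: "finite A" "(UNIV :: 'k set) \<subseteq> (\<Union>a\<in>A. {z. z - a \<in> U})"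
  proof (rule compactE_image[OF compact, of UNIV "\<lambda>a. {z. z - a \<in> U}"])
    have "z \<in> (\<Union>a. {z. z - a \<in> U})" for z by (rule UN_I[of z]) (simp_all add: assms(2))
    then show "UNIV \<subseteq> (\<Union>a. {z. z - a \<in> U})" by blast
  qed (auto intro: open_translate assms)
  have "\<exists>a\<in>A. z - a \<in> U" for z using subsetD[OF A(2) UNIV_I[of z]] by auto
  moreover from this have "A \<noteq> {}" by blast
  ultimately show thesis using that A(1) by blast
qed

text \<open>Of the translates averaged at \<open>x\<close> and at \<open>x'\<close>, at least one
  pair is close, and a bijection matches the rest with error at most \<open>D\<close> each. So the
  oscillation \<open>D\<close> shrinks by the share \<open>1 / card A\<close>, up to the modulus of
  continuity.\<close>

lemma average_contracts:
  fixes f :: "'k \<Rightarrow> complex"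
  assumes A: "finite A" "A \<noteq> {}" "\<And>z. \<exists>a\<in>A. z - a \<in> U"
    and f: "\<And>x x'. x - x' \<in> U \<Longrightarrow> norm (f x - f x') \<le> \<epsilon>" and D: "\<And>x x'. norm (f x - f x') \<le> D"
  defines "g \<equiv> \<lambda>x. (\<Sum>a\<in>A. f (x + a)) / of_nat (card A)"
  shows "norm (g x - g x') \<le> (1 - 1 / card A) * D + \<epsilon> / card A"
proof -
  obtain a where a: "a \<in> A" using A(2) by blast
  obtain a' where a': "a' \<in> A" "x + a - x' - a' \<in> U" using A(3)[of "x + a - x'"] by blast
  have n: "card A > 0" using A by (simp add: card_gt_0_iff)
  have "card (A - {a}) = card (A - {a'})" using A(1) a a' by simp
  then obtain h where h: "bij_betw h (A - {a}) (A - {a'})"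
    using A(1) by (meson finite_Diff finite_same_card_bij)
  have "(\<Sum>b\<in>A - {a'}. f (x' + b)) = (\<Sum>b\<in>A - {a}. f (x' + h b))"
    using sum.reindex_bij_betw[OF h, of "\<lambda>b. f (x' + b)"] by simp
  then have "(\<Sum>b\<in>A. f (x + b)) - (\<Sum>b\<in>A. f (x' + b)) =
    (f (x + a) - f (x' + a')) + (\<Sum>b\<in>A - {a}. f (x + b) - f (x' + h b))"
    using A(1) a a' sum.remove[of A a "\<lambda>b. f (x + b)"] sum.remove[of A a' "\<lambda>b. f (x' + b)"]
    by (simp add: sum_subtractf)
  also have "norm \<dots> \<le> \<epsilon> + (\<Sum>b\<in>A - {a}. D)"
    using a' by (intro norm_triangle_mono f sum_norm_le D) (simp add: algebra_simps)
  also have "\<dots> = \<epsilon> + (real (card A) - 1) * D" using A(1) a n by (simp add: of_nat_diff)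
  finally have "norm ((\<Sum>b\<in>A. f (x + b)) - (\<Sum>b\<in>A. f (x' + b))) / card A \<le> (\<epsilon> + (real (card A) - 1) * D) / card A"
    by (intro divide_right_mono) auto
  moreover have "norm (g x - g x') = norm ((\<Sum>b\<in>A. f (x + b)) - (\<Sum>b\<in>A. f (x' + b))) / card A"
    by (simp only: g_def diff_divide_distrib[symmetric] norm_divide norm_of_nat)
  moreover have "(\<epsilon> + (real (card A) - 1) * D) / card A = (1 - 1 / card A) * D + \<epsilon> / card A"
    using n by (simp add: add_divide_distrib left_diff_distrib diff_divide_distrib)
  ultimately show ?thesis by simp
qed

text \<open>Iterates the contraction. Averages preserve the modulus of continuity
  \<open>(U, \<epsilon> / 2)\<close> of \<open>f\<close>, so the same \<open>A\<close> works in
  every round, and the oscillation after \<open>m\<close> rounds is at most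
  \<open>\<epsilon> / 2 + q ^ m * D\<close>.\<close>

lemma almost_constant_average:
  fixes f :: "'k \<Rightarrow> complex"
  assumes f: "continuous_on UNIV f" and \<epsilon>: "\<epsilon> > 0"
  obtains P where "P \<in> averages" "\<And>x x'. norm (P f x - P f x') \<le> \<epsilon>"
proof -
  obtain U where U: "open U" "0 \<in> U" "\<And>x x'. x - x' \<in> U \<Longrightarrow> norm (f x - f x') < \<epsilon> / 2"
    using uniformly_continuous[OF f half_gt_zero[OF \<epsilon>]] by blast
  obtain A where A: "finite A" "A \<noteq> {}" "\<And>z. \<exists>a\<in>A. z - a \<in> U"
    using finite_translates_cover[OF U(1,2)] by blast
  define n where "n = card A"
  have n: "n > 0" using A by (simp add: n_def card_gt_0_iff)
  have "compact (range f)" using f compact by (rule compact_continuous_image)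
  then obtain M where M: "\<And>x. norm (f x) \<le> M" using compact_imp_bounded bounded_iff by (metis rangeI)
  define D where "D = 2 * M"
  have D: "norm (f x - f x') \<le> D" for x x'
    using norm_triangle_ineq4[of "f x" "f x'"] M[of x] M[of x'] by (simp add: D_def)
  define q where "q = 1 - 1 / real n"
  have q: "0 \<le> q" "q < 1" using n by (auto simp: q_def)
  have *: "\<exists>P\<in>averages. \<forall>x x'. norm (P f x - P f x') \<le> \<epsilon> / 2 + q ^ m * D" for m
  proof (induction m)
    case 0
    show ?case using D \<epsilon> by (intro bexI[of _ "\<lambda>f. f"]) (auto intro: averages.id add_increasing)
  next
    case (Suc m)
    then obtain P where P: "P \<in> averages" "\<And>x x'. norm (P f x - P f x') \<le> \<epsilon> / 2 + q ^ m * D" by blast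
    have Pf: "norm (P f x - P f x') \<le> \<epsilon> / 2" if "x - x' \<in> U" for x x'
    proof -
      have "norm (P (\<lambda>z. f (z + (x - x')) - f z) x') \<le> \<epsilon> / 2"
        by (rule norm_averages_le[OF P(1)], rule less_imp_le, rule U(3)) (use that in simp)
      then show ?thesis by (simp add: averages_diff[OF P(1)] averages_translate[OF P(1)])
    qed
    let ?Q = "\<lambda>f x. (\<Sum>a\<in>A. P f (x + a)) / of_nat (card A)"
    have "norm (?Q f x - ?Q f x') \<le> \<epsilon> / 2 + q ^ Suc m * D" for x x'
    proof -
      have "norm (?Q f x - ?Q f x') \<le> (1 - 1 / card A) * (\<epsilon> / 2 + q ^ m * D) + (\<epsilon> / 2) / card A"
        by (rule average_contracts[OF A Pf P(2)])
      also have "\<dots> = \<epsilon> / 2 + q ^ Suc m * D" using n by (simp add: q_def n_def[symmetric] field_simps)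
      finally show ?thesis .
    qed
    then show ?case using averages.step[OF P(1) A(1,2)] by (intro bexI[of _ ?Q]) simp_all
  qed
  obtain m where m: "q ^ m < \<epsilon> / (2 * (D + 1))"
  proof -
    have "D \<ge> 0" using D[of 0 0] by simp
    then show thesis using real_arch_pow_inv[of "\<epsilon> / (2 * (D + 1))" q] q \<epsilon> that by auto
  qed
  have "q ^ m * D \<le> \<epsilon> / 2"
  proof -
    have D0: "D \<ge> 0" using D[of 0 0] by simp
    have "q ^ m * D \<le> \<epsilon> / (2 * (D + 1)) * (D + 1)" using m D0 q \<epsilon> by (intro mult_mono) auto
    also have "\<dots> = \<epsilon> / 2" using D0 by (simp add: divide_simps)
    finally show ?thesis .
  qed
  obtain P where "P \<in> averages" "\<And>x x'. norm (P f x - P f x') \<le> \<epsilon> / 2 + q ^ m * D"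
    using *[of m] by blast
  moreover have "\<epsilon> / 2 + q ^ m * D \<le> \<epsilon>" using \<open>q ^ m * D \<le> \<epsilon> / 2\<close> by simp
  ultimately show thesis by (intro that[of P]) (auto intro: order_trans)
qed

text \<open>Almost constant averages of \<open>f\<close> have nearly equal values: averaging each by
  the operator of the other gives the same function. The values at 0 are therefore a Cauchy
  sequence.\<close>

lemma has_mean_exists:
  fixes f :: "'k \<Rightarrow> complex"
  assumes f: "continuous_on UNIV f"
  shows "\<exists>c. has_mean f c"
proof -
  have "\<forall>n. \<exists>P. P \<in> averages \<and> (\<forall>x x'. norm (P f x - P f x') \<le> 1 / real (Suc n))"
  proof
    fix n
    have "1 / real (Suc n) > 0" by simp
    then obtain P where "P \<in> averages" "\<And>x x'. norm (P f x - P f x') \<le> 1 / real (Suc n)"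
      using almost_constant_average[OF f] by blast
    then show "\<exists>P. P \<in> averages \<and> (\<forall>x x'. norm (P f x - P f x') \<le> 1 / real (Suc n))"
      by (intro exI[of _ P] conjI allI)
  qed
  from choice[OF this] obtain P
    where P': "\<forall>n. P n \<in> averages \<and> (\<forall>x x'. norm (P n f x - P n f x') \<le> 1 / real (Suc n))"
    by (rule exE)
  have P: "P n \<in> averages" "norm (P n f x - P n f x') \<le> 1 / real (Suc n)" for n x x'
    using P'[rule_format, of n] by simp_all
  define c where "c n = P n f 0" for n
  have close: "norm (c n - c m) \<le> 1 / real (Suc n) + 1 / real (Suc m)" for n m
  proof -
    have "norm (P m (P n f) 0 - c n) \<le> 1 / real (Suc n)"
      unfolding c_def by (rule averages_close[OF P(1) P(2)])
    moreover have "norm (P n (P m f) 0 - c m) \<le> 1 / real (Suc m)"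
      unfolding c_def by (rule averages_close[OF P(1) P(2)])
    moreover have "norm (c n - c m) = norm ((P n (P m f) 0 - c m) - (P m (P n f) 0 - c n))"
      using averages_commute[OF P(1)[of n] P(1)[of m], of f] by simp
    ultimately show ?thesis
      using norm_triangle_ineq4[of "P n (P m f) 0 - c m" "P m (P n f) 0 - c n"] by linarith
  qed
  have small: "\<exists>N. \<forall>n\<ge>N. 1 / real (Suc n) < \<epsilon>" if \<epsilon>: "\<epsilon> > 0" for \<epsilon> :: real
  proof -
    obtain N where N: "inverse (real (Suc N)) < \<epsilon>" using reals_Archimedean[OF \<epsilon>] by (rule exE)
    have "1 / real (Suc n) \<le> 1 / real (Suc N)" if "n \<ge> N" for n
      using that by (intro divide_left_mono) auto
    then show ?thesis using N by (intro exI[of _ N]) (force simp: inverse_eq_divide)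
  qed
  have "Cauchy c"
  proof (rule CauchyI)
    fix \<epsilon> :: real assume "\<epsilon> > 0"
    then obtain N where N: "\<forall>n\<ge>N. 1 / real (Suc n) < \<epsilon> / 2" using small[of "\<epsilon> / 2"] by auto
    have "norm (c m - c n) < \<epsilon>" if "m \<ge> N" "n \<ge> N" for m n
      using close[of m n] N[rule_format, OF that(1)] N[rule_format, OF that(2)] by linarith
    then show "\<exists>M. \<forall>m\<ge>M. \<forall>n\<ge>M. norm (c m - c n) < \<epsilon>" by blast
  qed
  then have "convergent c" by (rule Cauchy_convergent)
  then obtain c' where c': "c \<longlonglongrightarrow> c'" unfolding convergent_def by (rule exE)
  have "has_mean f c'"
    unfolding has_mean_def
  proof (intro allI impI)
    fix \<epsilon> :: real assume "\<epsilon> > 0"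
    then obtain N where N: "\<forall>n\<ge>N. 1 / real (Suc n) < \<epsilon> / 2" using small[of "\<epsilon> / 2"] by auto
    obtain N' where N': "\<forall>n\<ge>N'. norm (c n - c') < \<epsilon> / 2"
      using LIMSEQ_D[OF c', of "\<epsilon> / 2"] \<open>\<epsilon> > 0\<close> by auto
    define n where "n = max N N'"
    have "norm (P n f x - c') \<le> \<epsilon>" for x
    proof -
      have "norm (P n f x - c') \<le> norm (P n f x - P n f 0) + norm (c n - c')"
        using norm_triangle_ineq[of "P n f x - P n f 0" "c n - c'"] by (simp add: c_def)
      also have "norm (P n f x - P n f 0) < \<epsilon> / 2"
        by (rule le_less_trans[OF P(2) N[rule_format]]) (simp add: n_def)
      also have "norm (c n - c') < \<epsilon> / 2" using N' by (simp add: n_def)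
      finally show ?thesis by simp
    qed
    then show "\<exists>P\<in>averages. \<forall>x. norm (P f x - c') \<le> \<epsilon>" using P(1) by blast
  qed
  then show ?thesis ..
qed

definition mean :: "('k \<Rightarrow> complex) \<Rightarrow> complex" where
  "mean f = (THE c. has_mean f c)"

lemma mean_eqI: "has_mean f c \<Longrightarrow> mean f = c"
  unfolding mean_def by (rule the_equality) (auto intro: has_mean_unique)

lemma has_mean_mean:
  assumes "continuous_on UNIV f"
  shows "has_mean f (mean f)"
proof -
  obtain c where "has_mean f c" using has_mean_exists[OF assms] by (rule exE)
  then show ?thesis using mean_eqI[of f c] by simp
qed

lemma mean_add: "continuous_on UNIV f \<Longrightarrow> continuous_on UNIV g \<Longrightarrow> mean (\<lambda>x. f x + g x) = mean f + mean g"
  by (intro mean_eqI has_mean_add has_mean_mean)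

lemma mean_scale: "continuous_on UNIV f \<Longrightarrow> mean (\<lambda>x. a * f x) = a * mean f"
  by (intro mean_eqI has_mean_scale has_mean_mean)

lemma mean_diff: "continuous_on UNIV f \<Longrightarrow> continuous_on UNIV g \<Longrightarrow> mean (\<lambda>x. f x - g x) = mean f - mean g"
  using mean_add[of f "\<lambda>x. -1 * g x"] mean_scale[of g "-1"] by (simp add: continuous_intros)

lemma mean_cnj: "continuous_on UNIV f \<Longrightarrow> mean (\<lambda>x. cnj (f x)) = cnj (mean f)"
  by (intro mean_eqI has_mean_cnj has_mean_mean)

lemma mean_translate: "continuous_on UNIV f \<Longrightarrow> mean (\<lambda>x. f (x + b)) = mean f"
  by (intro mean_eqI has_mean_translate has_mean_mean)

lemma mean_uminus: "continuous_on UNIV f \<Longrightarrow> mean (\<lambda>x. f (- x)) = mean f"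
  by (intro mean_eqI has_mean_uminus has_mean_mean)

lemma norm_mean_le: "continuous_on UNIV f \<Longrightarrow> (\<And>x. norm (f x) \<le> M) \<Longrightarrow> norm (mean f) \<le> M"
  by (rule has_mean_norm_le[OF has_mean_mean])

lemma Re_mean_ge: "continuous_on UNIV f \<Longrightarrow> (\<And>x. M \<le> Re (f x)) \<Longrightarrow> M \<le> Re (mean f)"
  by (rule has_mean_Re_ge[OF has_mean_mean])

lemma mean_sum:
  assumes "finite A" "\<And>a. a \<in> A \<Longrightarrow> continuous_on UNIV (f a)"
  shows "mean (\<lambda>x. \<Sum>a\<in>A. f a x) = (\<Sum>a\<in>A. mean (f a))"
  using assms
proof (induction A)
  case empty
  show ?case by (simp add: mean_eqI[OF has_mean_const])
next
  case (insert a A)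
  then show ?case by (simp add: mean_add continuous_on_sum)
qed

text \<open>Finitely many translates of \<open>f\<close> add up to a function whose real part is
  bounded below by \<open>\<delta>\<close>, and each translate has the same mean.\<close>

lemma Re_mean_pos:
  fixes f :: "'k \<Rightarrow> complex"
  assumes f: "continuous_on UNIV f" and nonneg: "\<And>x. 0 \<le> Re (f x)" and pos: "Re (f x0) > 0"
  shows "Re (mean f) > 0"
proof -
  define \<delta> where "\<delta> = Re (f x0) / 2"
  have \<delta>: "\<delta> > 0" using pos by (simp add: \<delta>_def)
  obtain U where U: "open U" "0 \<in> U" "\<And>x x'. x - x' \<in> U \<Longrightarrow> norm (f x - f x') < \<delta>"
    using uniformly_continuous[OF f \<delta>] by blast
  obtain A where A: "finite A" "A \<noteq> {}" "\<And>z. \<exists>a\<in>A. z - a \<in> U"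
    using finite_translates_cover[OF U(1,2)] by blast
  have cont: "continuous_on UNIV (\<lambda>x. f (x + (x0 - a)))" for a
    by (rule continuous_on_compose2[OF f]) (auto intro!: continuous_intros)
  have "\<delta> \<le> Re (mean (\<lambda>x. \<Sum>a\<in>A. f (x + (x0 - a))))"
  proof (rule Re_mean_ge)
    show "continuous_on UNIV (\<lambda>x. \<Sum>a\<in>A. f (x + (x0 - a)))"
      by (intro continuous_on_sum cont)
    fix x
    obtain a where a: "a \<in> A" "x - a \<in> U" using A(3) by blast
    have "norm (f (x + (x0 - a)) - f x0) < \<delta>" using a by (intro U(3)) (simp add: algebra_simps)
    then have "Re (f (x + (x0 - a))) \<ge> \<delta>"
      using abs_Re_le_cmod[of "f (x + (x0 - a)) - f x0"] by (simp add: \<delta>_def)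
    also have "Re (f (x + (x0 - a))) \<le> (\<Sum>a\<in>A. Re (f (x + (x0 - a))))"
      using A(1) a nonneg by (intro member_le_sum) auto
    finally show "\<delta> \<le> Re (\<Sum>a\<in>A. f (x + (x0 - a)))" by simp
  qed
  also have "mean (\<lambda>x. \<Sum>a\<in>A. f (x + (x0 - a))) = of_nat (card A) * mean f"
    using A(1) f cont by (simp add: mean_sum mean_translate)
  finally have "\<delta> \<le> real (card A) * Re (mean f)" by simp
  then have "0 < real (card A) * Re (mean f)" using \<delta> by linarith
  then show ?thesis by (simp add: zero_less_mult_iff)
qed

subsection \<open>Interchange of means\<close>

lemma continuous_section1:
  fixes F :: "'k \<Rightarrow> 'k \<Rightarrow> complex"
  assumes "continuous_on UNIV (\<lambda>p. F (fst p) (snd p))"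
  shows "continuous_on UNIV (\<lambda>y. F x y)"
  using continuous_on_compose2[OF assms, of UNIV "\<lambda>y. (x, y)"] by (simp add: continuous_intros)

lemma continuous_section2:
  fixes F :: "'k \<Rightarrow> 'k \<Rightarrow> complex"
  assumes "continuous_on UNIV (\<lambda>p. F (fst p) (snd p))"
  shows "continuous_on UNIV (\<lambda>x. F x y)"
  using continuous_on_compose2[OF assms, of UNIV "\<lambda>x. (x, y)"] by (simp add: continuous_intros)

lemma continuous_mean:
  fixes F :: "'k \<Rightarrow> 'k \<Rightarrow> complex"
  assumes F: "continuous_on UNIV (\<lambda>p. F (fst p) (snd p))"
  shows "continuous_on UNIV (\<lambda>x. mean (F x))"
proof (rule continuous_of_uniformly)
  fix \<epsilon> :: real assume "\<epsilon> > 0"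
  then obtain U where U: "open U" "0 \<in> U" "\<And>x x' y. x - x' \<in> U \<Longrightarrow> norm (F x y - F x' y) < \<epsilon>"
    using uniformly_continuous2[OF F] by blast
  have "norm (mean (F x) - mean (F x')) \<le> \<epsilon>" if "x - x' \<in> U" for x x'
  proof -
    have "norm (mean (\<lambda>y. F x y - F x' y)) \<le> \<epsilon>"
      using U(3)[OF that] by (intro norm_mean_le continuous_intros continuous_section1[OF F] less_imp_le)
    then show ?thesis by (simp add: mean_diff continuous_section1[OF F])
  qed
  then show "\<exists>U. open U \<and> 0 \<in> U \<and> (\<forall>x x'. x - x' \<in> U \<longrightarrow> norm (mean (F x) - mean (F x')) \<le> \<epsilon>)"
    using U by blast
qed

text \<open>Composing averages handles finitely many parameters \<open>a\<close> at once; every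
  other \<open>x\<close> is close to one of them, uniformly in \<open>y\<close>.\<close>

lemma ex_uniform_average:
  fixes F :: "'k \<Rightarrow> 'k \<Rightarrow> complex"
  assumes F: "continuous_on UNIV (\<lambda>p. F (fst p) (snd p))" and \<epsilon>: "\<epsilon> > 0"
  obtains P where "P \<in> averages" "\<And>x y. norm (P (F x) y - mean (F x)) \<le> \<epsilon>"
proof -
  note cont = continuous_section1[OF F]
  have "\<epsilon> / 3 > 0" using \<epsilon> by simp
  then obtain U where U: "open U" "0 \<in> U" "\<And>x x' y. x - x' \<in> U \<Longrightarrow> norm (F x y - F x' y) < \<epsilon> / 3"
    using uniformly_continuous2[OF F] by blast
  obtain A where A: "finite A" "A \<noteq> {}" "\<And>z. \<exists>a\<in>A. z - a \<in> U"
    using finite_translates_cover[OF U(1,2)] by blast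
  have "\<exists>P\<in>averages. \<forall>a\<in>A. \<forall>y. norm (P (F a) y - mean (F a)) \<le> \<epsilon> / 3"
    using A(1)
  proof (induction A)
    case empty
    show ?case using averages.id by blast
  next
    case (insert a A)
    then obtain P where P: "P \<in> averages" "\<And>a y. a \<in> A \<Longrightarrow> norm (P (F a) y - mean (F a)) \<le> \<epsilon> / 3" by blast
    obtain Q where Q: "Q \<in> averages" "\<And>y. norm (Q (F a) y - mean (F a)) \<le> \<epsilon> / 3"
      using has_mean_mean[OF cont[of a]] \<open>\<epsilon> / 3 > 0\<close> unfolding has_mean_def by blast
    have "norm (P (Q (F b)) y - mean (F b)) \<le> \<epsilon> / 3" if "b \<in> insert a A" for b y
    proof (cases "b = a")
      case True
      then show ?thesis using averages_close[OF P(1) Q(2)] by simp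
    next
      case False
      then show ?thesis
        using averages_close[OF Q(1) P(2)[of b]] that by (simp add: averages_commute[OF P(1) Q(1)])
    qed
    then show ?case using averages_compose[OF P(1) Q(1)] by (intro bexI[of _ "\<lambda>f. P (Q f)"]) auto
  qed
  then obtain P where P: "P \<in> averages" "\<And>a y. a \<in> A \<Longrightarrow> norm (P (F a) y - mean (F a)) \<le> \<epsilon> / 3" by blast
  have "norm (P (F x) y - mean (F x)) \<le> \<epsilon>" for x y
  proof -
    obtain a where a: "a \<in> A" "x - a \<in> U" using A(3) by blast
    have 1: "norm (P (\<lambda>y. F x y - F a y) y) \<le> \<epsilon> / 3"
      by (rule norm_averages_le[OF P(1) less_imp_le[OF U(3)[OF a(2)]]])
    have 2: "norm (mean (\<lambda>y. F x y - F a y)) \<le> \<epsilon> / 3"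
      using U(3)[OF a(2)] by (intro norm_mean_le continuous_intros cont less_imp_le)
    have "P (F x) y - mean (F x) = P (\<lambda>y. F x y - F a y) y + (P (F a) y - mean (F a)) - mean (\<lambda>y. F x y - F a y)"
      by (simp add: averages_diff[OF P(1)] mean_diff cont)
    also have "norm \<dots> \<le> \<epsilon> / 3 + \<epsilon> / 3 + \<epsilon> / 3"
      by (intro order_trans[OF norm_triangle_ineq4 add_mono] norm_triangle_mono 1 2 P a)
    finally show ?thesis by simp
  qed
  then show thesis using that P(1) by blast
qed

lemma mean_average:
  fixes F :: "'k \<Rightarrow> 'k \<Rightarrow> complex"
  assumes F: "continuous_on UNIV (\<lambda>p. F (fst p) (snd p))" and P: "P \<in> averages"
  shows "continuous_on UNIV (\<lambda>x. P (F x) y) \<and> mean (\<lambda>x. P (F x) y) = P (\<lambda>y. mean (\<lambda>x. F x y)) y"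
  using P
proof (induction arbitrary: y rule: averages.induct)
  case id
  then show ?case using continuous_section2[OF F] by simp
next
  case (step P A)
  have "mean (\<lambda>x. (1 / of_nat (card A)) * (\<Sum>a\<in>A. P (F x) (y + a))) =
    (1 / of_nat (card A)) * (\<Sum>a\<in>A. P (\<lambda>y. mean (\<lambda>x. F x y)) (y + a))"
    using step by (subst mean_scale) (auto simp: mean_sum intro!: continuous_on_sum)
  moreover have "continuous_on UNIV (\<lambda>x. (1 / of_nat (card A)) * (\<Sum>a\<in>A. P (F x) (y + a)))"
    using step by (intro continuous_intros) auto
  ultimately show ?case by simp
qed

text \<open>Fubini: one average in \<open>y\<close> approximates all the inner means simultaneously,
  and a finite average commutes with the mean in \<open>x\<close>.\<close>

theorem mean_swap:
  fixes F :: "'k \<Rightarrow> 'k \<Rightarrow> complex"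
  assumes F: "continuous_on UNIV (\<lambda>p. F (fst p) (snd p))"
  shows "mean (\<lambda>y. mean (\<lambda>x. F x y)) = mean (\<lambda>x. mean (\<lambda>y. F x y))"
proof (rule mean_eqI)
  let ?m = "mean (\<lambda>x. mean (\<lambda>y. F x y))"
  show "has_mean (\<lambda>y. mean (\<lambda>x. F x y)) ?m"
    unfolding has_mean_def
  proof (intro allI impI)
    fix \<epsilon> :: real assume "\<epsilon> > 0"
    then obtain P where P: "P \<in> averages" "\<And>x y. norm (P (F x) y - mean (F x)) \<le> \<epsilon>"
      using ex_uniform_average[OF F] by blast
    have "norm (P (\<lambda>y. mean (\<lambda>x. F x y)) y - ?m) \<le> \<epsilon>" for y
    proof -
      note PF = mean_average[OF F P(1), of y]
      have "norm (mean (\<lambda>x. P (F x) y - mean (F x))) \<le> \<epsilon>"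
        using PF by (intro norm_mean_le continuous_intros continuous_mean[OF F] P) auto
      then show ?thesis using PF by (simp add: mean_diff continuous_mean[OF F])
    qed
    then show "\<exists>P\<in>averages. \<forall>y. norm (P (\<lambda>y. mean (\<lambda>x. F x y)) y - ?m) \<le> \<epsilon>" using P(1) by blast
  qed
qed

end

section \<open>Convolution and idempotents\<close>

context compact_abelian_group
begin

definition conv :: "('k \<Rightarrow> complex) \<Rightarrow> ('k \<Rightarrow> complex) \<Rightarrow> 'k \<Rightarrow> complex" where
  "conv f g x = mean (\<lambda>y. f (x - y) * g y)"

text \<open>The involution of the convolution algebra: convolution with \<open>star f\<close> is
  adjoint to convolution with \<open>f\<close>.\<close>

definition star :: "('k \<Rightarrow> complex) \<Rightarrow> 'k \<Rightarrow> complex" where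
  "star f x = cnj (f (- x))"

text \<open>The square of the L2 norm.\<close>

definition energy :: "('k \<Rightarrow> complex) \<Rightarrow> real" where
  "energy f = Re (mean (\<lambda>x. f x * cnj (f x)))"

abbreviation cont :: "('k \<Rightarrow> complex) \<Rightarrow> bool" where
  "cont f \<equiv> continuous_on UNIV f"

lemma cont_compose: "cont f \<Longrightarrow> continuous_on UNIV h \<Longrightarrow> continuous_on UNIV (\<lambda>x. f (h x))"
  by (rule continuous_on_compose2[where t = UNIV]) auto

lemma cont_conv_integrand:
  assumes "cont f" "cont g"
  shows "continuous_on UNIV (\<lambda>p :: 'k \<times> 'k. f (fst p - snd p) * g (snd p))"
  by (intro continuous_intros cont_compose[OF assms(1)] cont_compose[OF assms(2)])

lemma cont_section:
  assumes "cont f" "cont g"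
  shows "cont (\<lambda>y. f (x - y) * g y)"
  by (intro continuous_intros cont_compose[OF assms(1)] assms(2))

lemma cont_conv [intro]: "cont f \<Longrightarrow> cont g \<Longrightarrow> cont (conv f g)"
  unfolding conv_def[abs_def]
  by (rule continuous_mean[of "\<lambda>x y. f (x - y) * g y"]) (rule cont_conv_integrand)

lemma cont_star [intro]:
  assumes "cont f"
  shows "cont (star f)"
  unfolding star_def[abs_def] by (intro continuous_intros cont_compose[OF assms])

lemma mean_reflect:
  assumes "cont f"
  shows "mean (\<lambda>y. f (x - y)) = mean f"
proof -
  have c: "cont (\<lambda>y. f (y + x))" by (intro cont_compose[OF assms] continuous_intros)
  have "mean (\<lambda>y. f (x - y)) = mean (\<lambda>y. f (- y + x))" by (simp add: algebra_simps)
  also have "\<dots> = mean (\<lambda>y. f (y + x))" by (rule mean_uminus[OF c])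
  also have "\<dots> = mean f" by (rule mean_translate[OF assms])
  finally show ?thesis .
qed

lemma conv_commute:
  assumes f: "cont f" and g: "cont g"
  shows "conv f g = conv g f"
proof
  fix x
  have "conv g f x = mean (\<lambda>y. g (x - y) * f (x - (x - y)))" by (simp add: conv_def)
  also have "\<dots> = mean (\<lambda>y. g y * f (x - y))"
    using mean_reflect[of "\<lambda>y. g y * f (x - y)" x] cont_section[OF f g, of x]
    by (simp add: mult.commute)
  finally show "conv f g x = conv g f x" by (simp add: conv_def mult.commute)
qed

lemma conv_add_right:
  assumes "cont f" "cont g" "cont h"
  shows "conv f (\<lambda>x. g x + h x) = (\<lambda>x. conv f g x + conv f h x)"
proof
  fix x
  show "conv f (\<lambda>x. g x + h x) x = conv f g x + conv f h x"
    unfolding conv_def distrib_left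
    by (rule mean_add[OF cont_section[OF assms(1,2)] cont_section[OF assms(1,3)]])
qed

lemma conv_scale_right:
  assumes "cont f" "cont g"
  shows "conv f (\<lambda>x. a * g x) = (\<lambda>x. a * conv f g x)"
proof
  fix x
  show "conv f (\<lambda>x. a * g x) x = a * conv f g x"
    using mean_scale[OF cont_section[OF assms, of x], of a] by (simp add: conv_def mult.left_commute)
qed

lemma conv_add_left:
  assumes "cont f" "cont g" "cont h"
  shows "conv (\<lambda>x. g x + h x) f = (\<lambda>x. conv g f x + conv h f x)"
proof -
  have "cont (\<lambda>x. g x + h x)" by (intro continuous_intros assms)
  then show ?thesis
    using conv_add_right[OF assms]
    by (simp add: conv_commute[of _ f] assms)
qed

lemma conv_scale_left:
  assumes "cont f" "cont g"
  shows "conv (\<lambda>x. a * g x) f = (\<lambda>x. a * conv g f x)"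
proof -
  have "cont (\<lambda>x. a * g x)" by (intro continuous_intros assms)
  then show ?thesis
    using conv_scale_right[OF assms] by (simp add: conv_commute[of _ f] assms)
qed

lemma conv_diff_left:
  assumes "cont f" "cont g" "cont h"
  shows "conv (\<lambda>x. g x - h x) f = (\<lambda>x. conv g f x - conv h f x)"
proof -
  have "cont (\<lambda>x. -1 * h x)" by (intro continuous_intros assms)
  then show ?thesis
    using conv_add_left[OF assms(1,2), of "\<lambda>x. -1 * h x"] conv_scale_left[OF assms(1,3), of "-1"]
    by simp
qed

lemma conv_assoc:
  assumes f: "cont f" and g: "cont g" and h: "cont h"
  shows "conv (conv f g) h = conv f (conv g h)"
proof
  fix x
  let ?F = "\<lambda>w y. f (x - w) * (g (w - y) * h y)"
  have F: "continuous_on UNIV (\<lambda>p :: 'k \<times> 'k. ?F (fst p) (snd p))"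
    by (intro continuous_intros cont_compose[OF f] cont_compose[OF g] cont_compose[OF h])
  have "conv (conv f g) h x = mean (\<lambda>y. mean (\<lambda>w. ?F w y))"
    unfolding conv_def[of "conv f g"]
  proof (rule arg_cong[of _ _ mean], rule ext)
    fix y
    have c: "cont (\<lambda>z. f (x - y - z) * g z)" by (rule cont_section[OF f g])
    have "cont (\<lambda>w. f (x - w) * g (w - y))"
      by (intro continuous_intros cont_compose[OF f] cont_compose[OF g])
    then have "mean (\<lambda>w. h y * (f (x - w) * g (w - y))) = h y * mean (\<lambda>w. f (x - w) * g (w - y))"
      by (rule mean_scale)
    also have "mean (\<lambda>w. f (x - w) * g (w - y)) = mean (\<lambda>z. f (x - y - z) * g z)"
      using mean_translate[OF c, of "- y"] by (simp add: algebra_simps)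
    finally show "conv f g (x - y) * h y = mean (\<lambda>w. ?F w y)"
      by (simp add: conv_def mult_ac)
  qed
  also have "\<dots> = mean (\<lambda>w. mean (\<lambda>y. ?F w y))" by (rule mean_swap[OF F])
  also have "\<dots> = conv f (conv g h) x"
    unfolding conv_def
  proof (rule arg_cong[of _ _ mean], rule ext)
    fix w
    show "mean (\<lambda>y. ?F w y) = f (x - w) * mean (\<lambda>y. g (w - y) * h y)"
      by (rule mean_scale[OF cont_section[OF g h]])
  qed
  finally show "conv (conv f g) h x = conv f (conv g h) x" .
qed

lemma star_star [simp]: "star (star f) = f"
  by (simp add: star_def fun_eq_iff)

lemma star_conv:
  assumes "cont f" "cont g"
  shows "star (conv f g) = conv (star f) (star g)"
proof
  fix x
  have c: "cont (\<lambda>y. f (- x - y) * g y)" by (rule cont_section[OF assms])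
  have c': "cont (\<lambda>y. f (- x - - y) * g (- y))"
    by (intro continuous_intros cont_compose[OF assms(1)] cont_compose[OF assms(2)])
  have "conv (star f) (star g) x = mean (\<lambda>y. cnj (f (- x - - y) * g (- y)))"
    by (simp add: conv_def star_def algebra_simps)
  also have "\<dots> = cnj (mean (\<lambda>y. f (- x - - y) * g (- y)))" by (rule mean_cnj[OF c'])
  also have "\<dots> = cnj (mean (\<lambda>y. f (- x - y) * g y))" by (subst mean_uminus[OF c]) (rule refl)
  finally show "star (conv f g) x = conv (star f) (star g) x" by (simp add: star_def conv_def)
qed

lemma mean_norm_square:
  assumes "cont f"
  shows "mean (\<lambda>x. f x * cnj (f x)) = of_real (energy f)"
proof -
  have c: "cont (\<lambda>x. f x * cnj (f x))" by (intro continuous_intros assms)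
  have "cnj (mean (\<lambda>x. f x * cnj (f x))) = mean (\<lambda>x. f x * cnj (f x))"
    using mean_cnj[OF c] by (simp add: mult.commute)
  then show ?thesis unfolding energy_def by (metis Reals_cnj_iff of_real_Re)
qed

lemma conv_star_zero:
  assumes "cont f"
  shows "conv f (star f) 0 = of_real (energy f)"
proof -
  have "cont (\<lambda>x. f x * cnj (f x))" by (intro continuous_intros assms)
  from mean_uminus[OF this] show ?thesis
    by (simp add: conv_def star_def mean_norm_square[OF assms])
qed

lemma Re_mult_cnj_nonneg: "0 \<le> Re (z * cnj z)"
  by (simp add: complex_mult_cnj)

lemma energy_nonneg: "cont f \<Longrightarrow> 0 \<le> energy f"
  unfolding energy_def by (intro Re_mean_ge Re_mult_cnj_nonneg continuous_intros)

lemma energy_pos: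
  assumes "cont f" "f x \<noteq> 0"
  shows "energy f > 0"
  unfolding energy_def
proof (rule Re_mean_pos)
  show "0 < Re (f x * cnj (f x))"
    using assms(2) by (simp add: complex_mult_cnj complex_eq_iff sum_power2_gt_zero_iff)
qed (use assms(1) in \<open>auto intro!: continuous_intros Re_mult_cnj_nonneg\<close>)

text \<open>Cauchy-Schwarz with a free weight \<open>s\<close>, obtained from positivity of the mean
  of a pointwise square.\<close>

lemma norm_mean_mult_le:
  assumes f: "cont f" and g: "cont g" and s: "s > 0"
  shows "2 * norm (mean (\<lambda>x. f x * g x)) \<le> s * energy f + energy g / s"
proof -
  let ?m = "mean (\<lambda>x. f x * g x)"
  \<comment> \<open>Rotates the mean of the product to a nonnegative real.\<close>
  define c where "c = (if ?m = 0 then 1 else cnj ?m / norm ?m)"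
  have c: "norm c = 1" "c * ?m = of_real (norm ?m)"
    by (auto simp: c_def norm_divide complex_norm_square[symmetric] power2_eq_square mult.commute[of "cnj _"])
  have "0 \<le> Re (mean (\<lambda>x. (of_real s * (f x * cnj (f x)) + of_real (1 / s) * (g x * cnj (g x)))
     - (2 * c) * (f x * g x)))"
  proof (rule Re_mean_ge)
    show "cont (\<lambda>x. (of_real s * (f x * cnj (f x)) + of_real (1 / s) * (g x * cnj (g x))) - (2 * c) * (f x * g x))"
      by (intro continuous_intros f g)
    fix x
    have "Re (c * (f x * g x)) \<le> norm (f x) * norm (g x)"
      using complex_Re_le_cmod[of "c * (f x * g x)"] c(1) by (simp add: norm_mult)
    moreover have "2 * (norm (f x) * norm (g x)) \<le> s * (norm (f x))\<^sup>2 + (1 / s) * (norm (g x))\<^sup>2"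
    proof -
      have "0 \<le> (s * norm (f x) - norm (g x))\<^sup>2 / s" using s by simp
      also have "\<dots> = s * (norm (f x))\<^sup>2 + (1 / s) * (norm (g x))\<^sup>2 - 2 * (norm (f x) * norm (g x))"
        using s by (simp add: power2_eq_square field_simps)
      finally show ?thesis by simp
    qed
    moreover have "Re ((of_real s * (f x * cnj (f x)) + of_real (1 / s) * (g x * cnj (g x))) - (2 * c) * (f x * g x))
       = s * (norm (f x))\<^sup>2 + (1 / s) * (norm (g x))\<^sup>2 - 2 * Re (c * (f x * g x))"
      by (simp only: complex_norm_square[symmetric] mult.assoc) (simp flip: of_real_power)
    ultimately show "0 \<le> Re ((of_real s * (f x * cnj (f x)) + of_real (1 / s) * (g x * cnj (g x))) - (2 * c) * (f x * g x))"
      by linarith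
  qed
  also have "mean (\<lambda>x. (of_real s * (f x * cnj (f x)) + of_real (1 / s) * (g x * cnj (g x))) - (2 * c) * (f x * g x))
    = (of_real s * of_real (energy f) + of_real (1 / s) * of_real (energy g)) - (2 * c) * ?m"
  proof -
    have 1: "cont (\<lambda>x. f x * cnj (f x))" "cont (\<lambda>x. g x * cnj (g x))" "cont (\<lambda>x. f x * g x)"
      by (intro continuous_intros f g)+
    have 2: "cont (\<lambda>x. of_real s * (f x * cnj (f x)))" "cont (\<lambda>x. of_real (1 / s) * (g x * cnj (g x)))"
      "cont (\<lambda>x. (2 * c) * (f x * g x))"
      "cont (\<lambda>x. of_real s * (f x * cnj (f x)) + of_real (1 / s) * (g x * cnj (g x)))"
      by (intro continuous_intros f g)+
    show ?thesis
      by (simp only: mean_diff[OF 2(4,3)] mean_add[OF 2(1,2)] mean_scale[OF 1(1)] mean_scale[OF 1(2)]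
          mean_scale[OF 1(3)] mean_norm_square[OF f] mean_norm_square[OF g])
  qed
  also have "Re \<dots> = s * energy f + energy g / s - 2 * norm ?m"
    using c(2) by (simp add: mult.assoc)
  finally show ?thesis by simp
qed

lemma norm_mean_mult_square_le:
  assumes f: "cont f" and g: "cont g"
  shows "(norm (mean (\<lambda>x. f x * g x)))\<^sup>2 \<le> energy f * energy g"
proof -
  let ?m = "norm (mean (\<lambda>x. f x * g x))"
  note le = norm_mean_mult_le[OF f g]
  note nn = energy_nonneg[OF f] energy_nonneg[OF g]
  show ?thesis
  proof (cases "?m = 0")
    case True
    then show ?thesis using nn by simp
  next
    case False
    then have m: "?m > 0" by simp
    have pos: "energy f > 0"
    proof (rule ccontr)
      assume "\<not> energy f > 0"
      then have f0: "energy f = 0" using nn by simp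
      \<comment> \<open>With \<open>energy f = 0\<close> a large weight makes the right side smaller
        than the left.\<close>
      have "2 * ?m \<le> energy g / ((energy g + 1) / ?m)"
        using le[of "(energy g + 1) / ?m"] m nn f0 by simp
      also have "\<dots> = ?m * (energy g / (energy g + 1))" by simp
      also have "\<dots> \<le> ?m * 1" using m nn by (intro mult_left_mono) auto
      finally show False using m by simp
    qed
    have "2 * ?m \<le> ?m / energy f * energy f + energy g / (?m / energy f)"
      using le[of "?m / energy f"] m pos by simp
    then have "?m \<le> energy g * energy f / ?m" using pos by simp
    then show ?thesis using m by (simp add: field_simps power2_eq_square)
  qed
qed

lemma energy_reflect:
  assumes "cont f"
  shows "energy (\<lambda>y. f (x - y)) = energy f"
proof -
  have "cont (\<lambda>x. f x * cnj (f x))" by (intro continuous_intros assms)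
  from mean_reflect[OF this, of x] show ?thesis by (simp add: energy_def)
qed

lemma norm_conv_square_le:
  assumes "cont f" "cont g"
  shows "(norm (conv f g x))\<^sup>2 \<le> energy f * energy g"
proof -
  have "cont (\<lambda>y. f (x - y))" by (intro cont_compose[OF assms(1)] continuous_intros)
  from norm_mean_mult_square_le[OF this assms(2)] show ?thesis
    by (simp add: conv_def energy_reflect[OF assms(1)])
qed

end

section \<open>Spectral projections in the convolution algebra\<close>

context compact_abelian_group
begin

lemma conv_diff_right:
  assumes "cont f" "cont g" "cont h"
  shows "conv f (\<lambda>x. g x - h x) = (\<lambda>x. conv f g x - conv f h x)"
proof -
  have "cont (\<lambda>x. g x - h x)" by (intro continuous_intros assms)
  then show ?thesis
    using conv_diff_left[OF assms] by (simp add: conv_commute[OF assms(1)] assms)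
qed

text \<open>The convolution algebra need not have a unit, so the indices are shifted:
  \<open>conv_power k n\<close> has \<open>n + 1\<close> factors.\<close>

primrec conv_power :: "('k \<Rightarrow> complex) \<Rightarrow> nat \<Rightarrow> 'k \<Rightarrow> complex" where
  "conv_power k 0 = k"
| "conv_power k (Suc n) = conv k (conv_power k n)"

lemma cont_conv_power: "cont k \<Longrightarrow> cont (conv_power k n)"
  by (induction n) auto

lemma conv_power_conv:
  "cont k \<Longrightarrow> conv (conv_power k m) (conv_power k n) = conv_power k (m + n + 1)"
  by (induction m) (simp_all add: conv_assoc cont_conv_power)

lemma star_conv_power: "cont k \<Longrightarrow> star k = k \<Longrightarrow> star (conv_power k n) = conv_power k n"
  by (induction n) (simp_all add: star_conv cont_conv_power)

lemma conv_uniform_limit: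
  assumes lim: "uniform_limit UNIV P e sequentially" and P: "\<And>n. cont (P n)" and e: "cont e" and f: "cont f"
  shows "(\<lambda>n. conv f (P n) x) \<longlonglongrightarrow> conv f e x"
proof (rule tendstoI)
  fix \<epsilon> :: real assume \<epsilon>: "\<epsilon> > 0"
  have "bounded (range f)" using f compact by (intro compact_imp_bounded compact_continuous_image)
  then obtain M where M: "M > 0" "\<And>y. norm (f y) \<le> M" unfolding bounded_pos by auto
  have "\<forall>\<^sub>F n in sequentially. \<forall>y\<in>UNIV. dist (P n y) (e y) < \<epsilon> / (2 * M)"
    using \<epsilon> M by (intro uniform_limitD[OF lim]) simp
  then show "\<forall>\<^sub>F n in sequentially. dist (conv f (P n) x) (conv f e x) < \<epsilon>"
  proof (rule eventually_mono)
    fix n assume n: "\<forall>y\<in>UNIV. dist (P n y) (e y) < \<epsilon> / (2 * M)"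
    have d: "cont (\<lambda>y. P n y - e y)" by (intro continuous_intros P e)
    have "norm (f (x - y) * (P n y - e y)) \<le> \<epsilon> / 2" for y
    proof -
      have "norm (f (x - y) * (P n y - e y)) \<le> M * (\<epsilon> / (2 * M))"
        unfolding norm_mult using M n by (intro mult_mono) (auto simp: dist_norm less_imp_le)
      then show ?thesis using M by simp
    qed
    then have "norm (conv f (\<lambda>y. P n y - e y) x) \<le> \<epsilon> / 2"
      unfolding conv_def by (intro norm_mean_le cont_section[OF f d])
    then show "dist (conv f (P n) x) (conv f e x) < \<epsilon>"
      using \<epsilon> by (simp add: conv_diff_right[OF f P e] dist_norm)
  qed
qed

text \<open>With \<open>h = k * k\<close> the numbers \<open>A n = h\<^sup>n\<^sup>+\<^sup>1(0)\<close> are log-convex and submultiplicative, hence at least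
  \<open>\<Lambda>\<^sup>n\<^sup>+\<^sup>1\<close> for \<open>\<Lambda> = lim A (n + 1) / A n\<close>; this is where compactness of the convolution operator enters.
  The normalised powers \<open>h\<^sup>n / \<Lambda>\<^sup>n\<close> converge uniformly to the projection to the top eigenspace.\<close>

lemma spectral_idempotent:
  assumes k: "cont k" and self: "star k = k" and k0: "k x0 \<noteq> 0"
  obtains \<Lambda> :: real and e where "\<Lambda> > 0" "cont e" "star e = e" "conv e e = e" "e 0 \<noteq> 0"
    "conv (conv k k) e = (\<lambda>x. of_real \<Lambda> * e x)" "\<And>g. cont g \<Longrightarrow> conv k g = k \<Longrightarrow> conv e g = e"
proof -
  define p where "p = conv_power k"
  note cp = cont_conv_power[OF k, folded p_def]
  note pp = conv_power_conv[OF k, folded p_def]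
  have sp: "star (p n) = p n" for n unfolding p_def by (rule star_conv_power[OF k self])
  define A where "A n = energy (p n)" for n
  have A_eq: "p (2 * n + 1) 0 = of_real (A n)" for n
    using conv_star_zero[OF cp[of n]] pp[of n n] by (simp add: A_def sp mult_2)
  have A_nonneg: "A n \<ge> 0" for n unfolding A_def by (rule energy_nonneg[OF cp])
  define H where "H n = p (2 * n + 1)" for n
  have cH: "cont (H n)" for n unfolding H_def by (rule cp)
  have HH: "conv (H n) (H m) = H (n + m + 1)" for n m
    unfolding H_def using pp[of "2 * n + 1" "2 * m + 1"] by (simp add: algebra_simps)
  have H_le: "norm (H n x) \<le> A n" for n x
  proof (rule power2_le_imp_le)
    have "H n = conv (p n) (p n)" using pp[of n n] by (simp add: H_def mult_2)
    then show "(norm (H n x))\<^sup>2 \<le> (A n)\<^sup>2"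
      using norm_conv_square_le[OF cp[of n] cp[of n], of x] by (simp add: A_def power2_eq_square)
  qed (rule A_nonneg)
  have log_convex: "(A (Suc n))\<^sup>2 \<le> A n * A (Suc (Suc n))" for n
  proof -
    have "conv (p n) (p (Suc (Suc n))) 0 = of_real (A (Suc n))"
      using pp[of n "Suc (Suc n)"] A_eq[of "Suc n"] by (simp add: mult_2)
    then show ?thesis using norm_conv_square_le[OF cp[of n] cp[of "Suc (Suc n)"], of 0] by (simp add: A_def)
  qed
  have submult: "A (n + m + 1) \<le> A n * A m" for n m
  proof -
    have "norm (conv (H n) (H m) 0) \<le> A n * A m"
      unfolding conv_def
      by (intro norm_mean_le cont_section cH) (simp add: norm_mult mult_mono H_le A_nonneg)
    moreover have "conv (H n) (H m) 0 = of_real (A (n + m + 1))"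
      unfolding HH using A_eq[of "n + m + 1"] by (simp add: H_def)
    ultimately show ?thesis using A_nonneg[of "n + m + 1"] by simp
  qed
  have A0: "A 0 > 0" unfolding A_def p_def using energy_pos[OF k k0] by simp
  have "p 1 0 \<noteq> 0" using A_eq[of 0] A0 by simp
  then have A1: "A 1 > 0" unfolding A_def by (rule energy_pos[OF cp])
  have "A n > 0 \<and> A (Suc n) > 0" for n
  proof (induction n)
    case (Suc n)
    then have "0 < A n * A (Suc (Suc n))" using log_convex[of n] by (meson less_le_trans zero_less_power)
    then show ?case using Suc by (simp add: zero_less_mult_iff)
  qed (use A0 A1 in simp)
  then have Apos: "A n > 0" for n by blast
  define r where "r n = A (Suc n) / A n" for n
  have r_pos: "r n > 0" for n using Apos by (simp add: r_def)
  have inc: "incseq r"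
  proof (rule incseq_SucI)
    fix n
    show "r n \<le> r (Suc n)"
      using log_convex[of n] Apos[of n] Apos[of "Suc n"] by (simp add: r_def field_simps power2_eq_square)
  qed
  have r_le: "\<forall>n. r n \<le> A 0"
  proof
    fix n
    show "r n \<le> A 0" using submult[of n 0] Apos[of n] by (simp add: r_def field_simps)
  qed
  obtain \<Lambda> where \<Lambda>: "r \<longlonglongrightarrow> \<Lambda>" "\<forall>n. r n \<le> \<Lambda>"
    by (rule incseq_convergent[OF inc r_le])
  have \<Lambda>_pos: "\<Lambda> > 0" using r_pos[of 0] \<Lambda>(2) by (meson less_le_trans)
  have growth: "A n * r n ^ j \<le> A (n + j)" for n j
  proof (induction j)
    case (Suc j)
    have "A n * r n ^ Suc j = (A n * r n ^ j) * r n" by simp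
    also have "\<dots> \<le> A (n + j) * r (n + j)"
      using Suc Apos[of "n + j"] r_pos[of n] incseqD[OF inc, of n "n + j"]
      by (intro mult_mono) auto
    also have "\<dots> = A (n + Suc j)" using Apos[of "n + j"] by (simp add: r_def)
    finally show ?case .
  qed simp
  \<comment> \<open>Growth and submultiplicativity give
    \<open>r n ^ Suc m \<le> A (n + m + 1) / A n \<le> A m\<close>; then \<open>n\<close> tends to
    infinity.\<close>
  have A_ge: "\<Lambda> ^ Suc m \<le> A m" for m
  proof (rule LIMSEQ_le_const2)
    show "(\<lambda>n. r n ^ Suc m) \<longlonglongrightarrow> \<Lambda> ^ Suc m" by (intro tendsto_power \<Lambda>)
    have "r n ^ Suc m \<le> A m" for n
    proof -
      have "A n * r n ^ Suc m \<le> A n * A m" using growth[of n "Suc m"] submult[of n m] by simp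
      then show ?thesis using Apos[of n] by simp
    qed
    then show "\<exists>N. \<forall>n\<ge>N. r n ^ Suc m \<le> A m" by blast
  qed
  \<comment> \<open>The value at 0 of the normalised power \<open>P n\<close>. It decreases because
    the ratios \<open>r n\<close> stay below \<open>\<Lambda>\<close>, and the lower bound 1 keeps
    the limit from vanishing.\<close>
  define b where "b n = A n / \<Lambda> ^ Suc n" for n
  have b_ge: "1 \<le> b n" for n using A_ge[of n] \<Lambda>_pos by (simp add: b_def)
  have "decseq b"
  proof (rule decseq_SucI)
    fix n
    have "A (Suc n) \<le> \<Lambda> * A n" using \<Lambda>(2)[rule_format, of n] Apos[of n] by (simp add: r_def field_simps)
    then have "A (Suc n) / \<Lambda> ^ Suc (Suc n) \<le> (\<Lambda> * A n) / \<Lambda> ^ Suc (Suc n)"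
      using \<Lambda>_pos by (intro divide_right_mono) auto
    then show "b (Suc n) \<le> b n" using \<Lambda>_pos by (simp add: b_def)
  qed
  then obtain \<beta> where \<beta>: "b \<longlonglongrightarrow> \<beta>" using decseq_convergent[of b 1] b_ge by blast
  have \<beta>1: "\<beta> \<ge> 1" using b_ge by (intro LIMSEQ_le_const[OF \<beta>]) auto
  define c where "c n = complex_of_real (1 / \<Lambda> ^ Suc n)" for n
  define P where "P n = (\<lambda>x. c n * H n x)" for n
  have cP: "cont (P n)" for n unfolding P_def by (intro continuous_intros cH)
  have PP: "conv (P n) (P m) = P (n + m + 1)" for n m
  proof -
    have cm: "cont (\<lambda>x. c m * H m x)" by (intro continuous_intros cH)
    have "conv (P n) (P m) = (\<lambda>x. c n * (c m * H (n + m + 1) x))"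
      unfolding P_def by (simp only: conv_scale_left[OF cm cH] conv_scale_right[OF cH cH] HH)
    moreover have "c n * c m = c (n + m + 1)"
      using \<Lambda>_pos by (simp add: c_def power_add flip: of_real_mult)
    ultimately show ?thesis by (simp add: P_def fun_eq_iff mult.assoc[symmetric])
  qed
  have sH: "star (H n) = H n" for n unfolding H_def by (rule sp)
  have sP: "star (P n) = P n" for n
  proof
    fix x
    show "star (P n) x = P n x"
      using fun_cong[OF sH, of n x] by (simp add: star_def P_def c_def)
  qed
  have P0: "P n 0 = of_real (b n)" for n
    using A_eq[of n] by (simp add: P_def H_def c_def b_def)
  have energy_diff: "energy (\<lambda>x. P n x - P m x) = b (2 * n + 1) - 2 * b (n + m + 1) + b (2 * m + 1)" for n m
  proof -
    let ?d = "\<lambda>x. P n x - P m x"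
    have cd: "cont ?d" by (intro continuous_intros cP)
    have "star ?d = ?d"
    proof
      fix x
      show "star ?d x = ?d x" using fun_cong[OF sP, of n x] fun_cong[OF sP, of m x] by (simp add: star_def)
    qed
    then have 1: "of_real (energy ?d) = conv ?d ?d 0" using conv_star_zero[OF cd] by simp
    have 2: "conv ?d ?d 0 = (conv (P n) (P n) 0 - conv (P n) (P m) 0) - (conv (P m) (P n) 0 - conv (P m) (P m) 0)"
      by (simp only: conv_diff_left[OF cd cP cP] conv_diff_right[OF cP cP cP])
    have 3: "conv (P i) (P j) 0 = of_real (b (i + j + 1))" for i j
      unfolding PP by (rule P0)
    have "complex_of_real (energy ?d) =
        of_real ((b (n + n + 1) - b (n + m + 1)) - (b (m + n + 1) - b (m + m + 1)))"
      unfolding 1 2 3 of_real_diff by (rule refl)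
    then have "energy ?d = (b (n + n + 1) - b (n + m + 1)) - (b (m + n + 1) - b (m + m + 1))"
      by (rule of_real_eq_iff[THEN iffD1])
    then show ?thesis by (simp only: mult_2 add.commute[of m n])
  qed
  \<comment> \<open>The energy of a difference is a second difference of values of \<open>b\<close>,
    hence small. One more convolution with \<open>P 0\<close> turns L2 smallness into uniform
    smallness and shifts the index by one.\<close>
  have "uniformly_Cauchy_on UNIV (\<lambda>n. P (Suc n))"
    unfolding uniformly_Cauchy_on_def
  proof (intro allI impI)
    fix \<epsilon> :: real assume \<epsilon>: "\<epsilon> > 0"
    define E where "E = energy (P 0) + 1"
    have E: "E > 0" unfolding E_def using energy_nonneg[OF cP[of 0]] by simp
    define \<eta> where "\<eta> = \<epsilon>\<^sup>2 / (8 * E)"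
    have \<eta>: "\<eta> > 0" using E \<epsilon> by (simp add: \<eta>_def)
    obtain N where N: "\<forall>n\<ge>N. norm (b n - \<beta>) < \<eta>" using LIMSEQ_D[OF \<beta> \<eta>] by (rule exE)
    have "dist (P (Suc m) x) (P (Suc n) x) < \<epsilon>" if mn: "m \<ge> N" "n \<ge> N" for m n x
    proof -
      let ?d = "\<lambda>x. P m x - P n x"
      have cd: "cont ?d" by (intro continuous_intros cP)
      have "\<bar>b (2 * m + 1) - \<beta>\<bar> < \<eta>" "\<bar>b (m + n + 1) - \<beta>\<bar> < \<eta>" "\<bar>b (2 * n + 1) - \<beta>\<bar> < \<eta>"
        using N mn by auto
      then have ed: "energy ?d < 4 * \<eta>" unfolding energy_diff by linarith
      have "conv (P 0) ?d x = P (Suc m) x - P (Suc n) x"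
        by (simp only: conv_diff_right[OF cP cP cP] PP) simp
      then have "(norm (P (Suc m) x - P (Suc n) x))\<^sup>2 \<le> energy (P 0) * energy ?d"
        using norm_conv_square_le[OF cP[of 0] cd, of x] by simp
      also have "\<dots> \<le> E * (4 * \<eta>)"
        using ed energy_nonneg[OF cd] E by (intro mult_mono) (auto simp: E_def)
      also have "\<dots> = \<epsilon>\<^sup>2 / 2" using E by (simp add: \<eta>_def)
      also have "\<dots> < \<epsilon>\<^sup>2" using \<epsilon> by simp
      finally show ?thesis using \<epsilon> by (simp add: dist_norm power2_less_imp_less)
    qed
    then show "\<exists>M. \<forall>x\<in>UNIV. \<forall>m\<ge>M. \<forall>n\<ge>M. dist (P (Suc m) x) (P (Suc n) x) < \<epsilon>" by blast
  qed
  then have "uniformly_convergent_on UNIV (\<lambda>n. P (Suc n))" by (rule Cauchy_uniformly_convergent)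
  then obtain e where lim: "uniform_limit UNIV (\<lambda>n. P (Suc n)) e sequentially"
    unfolding uniformly_convergent_on_def by (rule exE)
  have ce: "cont e"
    by (rule uniform_limit_theorem[OF _ lim]) (simp_all add: cP)
  have "(\<lambda>n. P (Suc n) x) \<longlonglongrightarrow> e x" for x using tendsto_uniform_limitI[OF lim] by simp
  then have pt: "(\<lambda>n. P n x) \<longlonglongrightarrow> e x" for x by (rule LIMSEQ_imp_Suc)
  note cl = conv_uniform_limit[OF lim cP ce]
  have Pe: "conv (P m) e = e" for m
  proof
    fix x
    have "(\<lambda>n. conv (P m) (P (Suc n)) x) \<longlonglongrightarrow> e x"
      unfolding PP using LIMSEQ_ignore_initial_segment[OF pt[of x], of "m + 2"] by (simp add: add_ac)
    with cl[OF cP] show "conv (P m) e x = e x" by (rule LIMSEQ_unique)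
  qed
  show thesis
  proof (rule that[OF \<Lambda>_pos ce])
    show "star e = e"
    proof
      fix x
      have "(\<lambda>n. star (P n) x) \<longlonglongrightarrow> star e x" unfolding star_def by (intro tendsto_intros pt)
      then show "star e x = e x" unfolding sP using pt by (rule LIMSEQ_unique)
    qed
    show "conv e e = e"
    proof
      fix x
      have "conv e (P (Suc n)) x = e x" for n using Pe[of "Suc n"] by (simp add: conv_commute[OF ce cP])
      then show "conv e e x = e x" using cl[OF ce, where x = x] by (simp add: LIMSEQ_const_iff)
    qed
    have "e 0 = of_real \<beta>" using pt[of 0] \<beta> unfolding P0 by (metis LIMSEQ_unique tendsto_of_real)
    then show "e 0 \<noteq> 0" using \<beta>1 by auto
    have "conv k k = H 0" by (simp add: H_def p_def)
    moreover have "H 0 = (\<lambda>x. of_real \<Lambda> * P 0 x)" using \<Lambda>_pos by (simp add: P_def c_def fun_eq_iff)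
    ultimately have "conv (conv k k) e = conv (\<lambda>x. of_real \<Lambda> * P 0 x) e" by simp
    then show "conv (conv k k) e = (\<lambda>x. of_real \<Lambda> * e x)" by (simp only: conv_scale_left[OF ce cP] Pe)
    \<comment> \<open>Being fixed by \<open>g\<close> passes from \<open>k\<close> to its powers and
      to their limit. Taken with \<open>g\<close> an idempotent, this puts the projection below
      it.\<close>
    fix g assume g: "cont g" "conv k g = k"
    have pg: "conv (p n) g = p n" for n
      unfolding p_def using g k by (induction n) (simp_all add: conv_assoc cont_conv_power)
    have "conv (P n) g = P n" for n
      unfolding P_def by (simp only: conv_scale_left[OF g(1) cH]) (simp only: H_def pg)
    then have gP: "conv g (P n) = P n" for n by (simp add: conv_commute[OF g(1) cP])
    show "conv e g = e"
    proof
      fix x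
      have "conv g e x = e x"
        using cl[OF g(1), where x = x] LIMSEQ_Suc[OF pt[of x]] unfolding gP by (rule LIMSEQ_unique)
      then show "conv e g x = e x" by (simp add: conv_commute[OF ce g(1)])
    qed
  qed
qed

section \<open>Minimal idempotents and characters\<close>

text \<open>Convolution with such a function is a nonzero orthogonal projection that commutes with
  translations.\<close>

definition idempotent :: "('k \<Rightarrow> complex) \<Rightarrow> bool" where
  "idempotent e \<longleftrightarrow> cont e \<and> star e = e \<and> conv e e = e \<and> (\<exists>x. e x \<noteq> 0)"

text \<open>Cauchy-Schwarz for \<open>e = conv e e\<close> bounds \<open>e\<close> by its energy, so
  the energy, being the mean of the squared modulus, is at most its own square.\<close>

lemma idempotent_at_zero:
  assumes "idempotent e"
  shows "e 0 = of_real (energy e)" "norm (e x) \<le> energy e" "energy e \<ge> 1"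
proof -
  have e: "cont e" "star e = e" "conv e e = e" using assms by (auto simp: idempotent_def)
  show "e 0 = of_real (energy e)" using conv_star_zero[OF e(1)] e by simp
  have le: "norm (e x) \<le> energy e" for x
  proof (rule power2_le_imp_le)
    show "(norm (e x))\<^sup>2 \<le> (energy e)\<^sup>2"
      using norm_conv_square_le[OF e(1,1), of x] e(3) by (simp add: power2_eq_square)
  qed (rule energy_nonneg[OF e(1)])
  then show "norm (e x) \<le> energy e" .
  have pos: "energy e > 0" using assms energy_pos[OF e(1)] by (auto simp: idempotent_def)
  have "norm (mean (\<lambda>x. e x * cnj (e x))) \<le> energy e * energy e"
    using pos le by (intro norm_mean_le continuous_intros e) (simp add: norm_mult mult_mono)
  then have "energy e * 1 \<le> energy e * energy e" using pos by (simp add: mean_norm_square[OF e(1)])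
  then show "energy e \<ge> 1" using pos by simp
qed

text \<open>Every idempotent takes a value at least 1 at 0, and values at 0 are additive under splitting;
  so an idempotent whose value is within 1 of the infimum cannot be split.\<close>

lemma ex_minimal_idempotent:
  assumes e1: "idempotent e1"
  obtains e where "idempotent e" "conv e e1 = e" "\<And>e'. idempotent e' \<Longrightarrow> conv e' e = e' \<Longrightarrow> e' = e"
proof -
  define S where "S = {energy e | e. idempotent e \<and> conv e e1 = e}"
  have "energy e1 \<in> S" using e1 by (auto simp: S_def idempotent_def)
  then have ne: "S \<noteq> {}" by auto
  have S1: "s \<ge> 1" if "s \<in> S" for s using that idempotent_at_zero(3) by (auto simp: S_def)
  have bdd: "bdd_below S" using S1 by (rule bdd_belowI)
  have inf1: "Inf S \<ge> 1" using ne S1 by (rule cInf_greatest)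
  obtain s where s: "s \<in> S" "s < Inf S + 1" using cInf_lessD[OF ne, of "Inf S + 1"] by auto
  then obtain e where e: "idempotent e" "conv e e1 = e" "energy e < Inf S + 1" by (auto simp: S_def)
  have ce: "cont e" "star e = e" "conv e e = e" using e(1) by (auto simp: idempotent_def)
  have ce1: "cont e1" using e1 by (simp add: idempotent_def)
  show thesis
  proof (rule that[OF e(1,2)])
    fix e' assume e': "idempotent e'" "conv e' e = e'"
    have ce': "cont e'" "star e' = e'" "conv e' e' = e'" using e' by (auto simp: idempotent_def)
    have e'1: "conv e' e1 = e'"
      using conv_assoc[OF ce'(1) ce(1) ce1] e(2) e'(2) by simp
    define d where "d x = e x - e' x" for x
    have cd: "cont d" unfolding d_def[abs_def] by (intro continuous_intros ce ce')
    show "e' = e"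
    proof (rule ccontr)
      assume "e' \<noteq> e"
      then obtain x where "e' x \<noteq> e x" unfolding fun_eq_iff by blast
      then have "d x \<noteq> 0" by (simp add: d_def)
      moreover have "star d = d"
      proof
        fix x
        show "star d x = d x"
          using fun_cong[OF ce(2), of x] fun_cong[OF ce'(2), of x] by (simp add: star_def d_def)
      qed
      moreover have "conv d d = d"
      proof -
        have ee': "conv e e' = e'" using e'(2) conv_commute[OF ce(1) ce'(1)] by simp
        have "conv d d = (\<lambda>x. conv d e x - conv d e' x)"
          using conv_diff_right[OF cd ce(1) ce'(1)] by (simp add: d_def[abs_def])
        moreover have "conv d e = (\<lambda>x. e x - e' x)" "conv d e' = (\<lambda>x. e' x - e' x)"
          using conv_diff_left[OF ce(1) ce(1) ce'(1)] conv_diff_left[OF ce'(1) ce(1) ce'(1)]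
          by (simp_all add: d_def[abs_def] ce(3) ce'(3) ee' e'(2))
        ultimately show ?thesis by (simp add: d_def[abs_def])
      qed
      ultimately have d: "idempotent d" using cd by (auto simp: idempotent_def)
      have "conv d e1 = d"
        using conv_diff_left[OF ce1 ce(1) ce'(1)] by (simp add: d_def[abs_def] e(2) e'1)
      then have "energy d \<in> S" "energy e' \<in> S" using d e'(1) e'1 by (auto simp: S_def)
      then have "Inf S \<le> energy d" "Inf S \<le> energy e'" using cInf_lower[OF _ bdd] by auto
      moreover have "complex_of_real (energy d) = of_real (energy e - energy e')"
        using idempotent_at_zero(1)[OF d] idempotent_at_zero(1)[OF e(1)] idempotent_at_zero(1)[OF e'(1)]
        by (simp add: d_def)
      then have "energy d = energy e - energy e'" by (simp only: of_real_eq_iff)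
      ultimately show False using e(3) inf1 by simp
    qed
  qed
qed

text \<open>For self-adjoint \<open>k\<close> the spectral projection of \<open>conv k e\<close>
  lies below \<open>e\<close>, hence equals \<open>e\<close> unless \<open>conv k e\<close>
  vanishes; so \<open>conv k k\<close> acts on \<open>e\<close> as a scalar. Polarisation and
  splitting into self-adjoint parts give the general case.\<close>

lemma minimal_idempotent_eigen:
  assumes e: "idempotent e" and min: "\<And>e'. idempotent e' \<Longrightarrow> conv e' e = e' \<Longrightarrow> e' = e" and u: "cont u"
  shows "\<exists>\<mu>. conv u e = (\<lambda>x. \<mu> * e x)"
proof -
  have ce: "cont e" "star e = e" "conv e e = e" using e by (auto simp: idempotent_def)
  have square: "\<exists>\<mu>. conv (conv k k) e = (\<lambda>x. \<mu> * e x)" if k: "cont k" "star k = k" for k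
  proof -
    define k' where "k' = conv k e"
    have ck': "cont k'" unfolding k'_def using k(1) ce(1) by (rule cont_conv)
    have k'e: "conv k' e = k'" unfolding k'_def by (simp add: conv_assoc[OF k(1) ce(1) ce(1)] ce(3))
    have kk: "conv (conv k k) e = conv k k'" unfolding k'_def by (rule conv_assoc[OF k(1) k(1) ce(1)])
    show ?thesis
    proof (cases "\<exists>x. k' x \<noteq> 0")
      case False
      then have "k' = (\<lambda>x. 0)" by auto
      then have "conv k k' = (\<lambda>x. 0)" by (simp add: conv_def[abs_def] mean_eqI[OF has_mean_const])
      then show ?thesis using kk by (intro exI[of _ 0]) simp
    next
      case True
      then obtain x0 where x0: "k' x0 \<noteq> 0" by blast
      have sk': "star k' = k'" unfolding k'_def by (simp add: star_conv[OF k(1) ce(1)] k(2) ce(2))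
      obtain \<Lambda> e' where e': "\<Lambda> > 0" "cont e'" "star e' = e'" "conv e' e' = e'" "e' 0 \<noteq> 0"
        "conv (conv k' k') e' = (\<lambda>x. of_real \<Lambda> * e' x)" "\<And>g. cont g \<Longrightarrow> conv k' g = k' \<Longrightarrow> conv e' g = e'"
        using spectral_idempotent[OF ck' sk' x0] by blast
      have "conv e' e = e'" by (rule e'(7)[OF ce(1) k'e])
      moreover have "idempotent e'" using e'(2-5) by (auto simp: idempotent_def)
      ultimately have "e' = e" by (intro min)
      have "conv (conv k' k') e = conv k' k'" by (simp add: conv_assoc[OF ck' ck' ce(1)] k'e)
      also have "\<dots> = conv k (conv e k')" by (subst (1) k'_def) (rule conv_assoc[OF k(1) ce(1) ck'])
      also have "conv e k' = k'" using k'e conv_commute[OF ce(1) ck'] by simp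
      finally have "conv (conv k k) e = (\<lambda>x. of_real \<Lambda> * e x)" using e'(6) \<open>e' = e\<close> kk by simp
      then show ?thesis ..
    qed
  qed
  \<comment> \<open>Polarisation against \<open>e\<close>, which acts as a unit here: the square of
    \<open>k + e\<close> acts as the square of \<open>k\<close> plus twice \<open>k\<close> plus 1,
    and the two squares act as scalars.\<close>
  have linear: "\<exists>\<mu>. conv k e = (\<lambda>x. \<mu> * e x)" if k: "cont k" "star k = k" for k
  proof -
    let ?s = "\<lambda>x. k x + e x"
    have cs: "cont ?s" by (intro continuous_intros k ce)
    have ss: "star ?s = ?s"
    proof
      fix x
      show "star ?s x = ?s x" using fun_cong[OF k(2), of x] fun_cong[OF ce(2), of x] by (simp add: star_def)
    qed
    obtain \<mu> where \<mu>: "conv (conv ?s ?s) e = (\<lambda>x. \<mu> * e x)" using square[OF cs ss] by (rule exE)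
    obtain \<nu> where \<nu>: "conv (conv k k) e = (\<lambda>x. \<nu> * e x)" using square[OF k] by (rule exE)
    define k' where "k' = conv k e"
    have ck': "cont k'" unfolding k'_def using k(1) ce(1) by (rule cont_conv)
    have k'e: "conv k' e = k'" unfolding k'_def by (simp add: conv_assoc[OF k(1) ce(1) ce(1)] ce(3))
    have se: "conv ?s e = (\<lambda>x. k' x + e x)" using conv_add_left[OF ce(1) k(1) ce(1)] by (simp add: ce(3) k'_def)
    have ck'e: "cont (\<lambda>x. k' x + e x)" by (intro continuous_intros ck' ce)
    have "conv (conv ?s ?s) e = conv ?s (\<lambda>x. k' x + e x)" by (simp only: conv_assoc[OF cs cs ce(1)] se)
    also have "\<dots> = (\<lambda>x. (conv k k' x + conv k e x) + (conv e k' x + conv e e x))"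
      by (simp only: conv_add_left[OF ck'e k(1) ce(1)] conv_add_right[OF k(1) ck' ce(1)] conv_add_right[OF ce(1) ck' ce(1)])
    also have "conv k k' = (\<lambda>x. \<nu> * e x)" using \<nu> by (simp add: k'_def conv_assoc[OF k(1) k(1) ce(1)])
    also have "conv e k' = k'" using k'e conv_commute[OF ce(1) ck'] by simp
    finally have eq: "(\<lambda>x. \<mu> * e x) = (\<lambda>x. (\<nu> * e x + k' x) + (k' x + e x))"
      using \<mu> by (simp only: ce(3) k'_def)
    have "k' x = ((\<mu> - \<nu> - 1) / 2) * e x" for x
    proof -
      have "k' x = (2 * k' x) / 2" by simp
      also have "2 * k' x = (\<mu> - \<nu> - 1) * e x" using fun_cong[OF eq, of x] by (simp add: algebra_simps)
      finally show ?thesis by simp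
    qed
    then show ?thesis unfolding k'_def by blast
  qed
  have su: "cont (star u)" using u by (rule cont_star)
  \<comment> \<open>Both functions are self-adjoint, and \<open>u\<close> is
    \<open>(?k - \<i> * ?l) / 2\<close>.\<close>
  let ?k = "\<lambda>x. u x + star u x" and ?l = "\<lambda>x. \<i> * (u x - star u x)"
  have ck: "cont ?k" "cont ?l" by (intro continuous_intros u su)+
  obtain \<mu> where \<mu>: "conv ?k e = (\<lambda>x. \<mu> * e x)"
    using linear[OF ck(1)] by (auto simp: star_def fun_eq_iff)
  obtain \<nu> where \<nu>: "conv ?l e = (\<lambda>x. \<nu> * e x)"
    using linear[OF ck(2)] by (auto simp: star_def fun_eq_iff algebra_simps)
  have "u = (\<lambda>x. (1 / 2) * (?k x - \<i> * ?l x))" by (simp add: fun_eq_iff algebra_simps)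
  moreover have "conv (\<lambda>x. (1 / 2) * (?k x - \<i> * ?l x)) e = (\<lambda>x. (1 / 2) * (conv ?k e x - \<i> * conv ?l e x))"
  proof -
    have "cont (\<lambda>x. \<i> * ?l x)" "cont (\<lambda>x. ?k x - \<i> * ?l x)" by (intro continuous_intros u su)+
    then show ?thesis
      by (simp only: conv_scale_left[OF ce(1)] conv_diff_left[OF ce(1) ck(1)] ck)
  qed
  ultimately have "conv u e = (\<lambda>x. (1 / 2) * (\<mu> * e x - \<i> * (\<nu> * e x)))" using \<mu> \<nu> by simp
  then have "conv u e = (\<lambda>x. ((\<mu> - \<i> * \<nu>) / 2) * e x)" by (simp add: fun_eq_iff algebra_simps)
  then show ?thesis by blast
qed

text \<open>The function \<open>w\<close> measures how \<open>u\<close> changes under translation by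
  \<open>a\<close>, and the minimal idempotent is taken below the top eigenspace of
  \<open>conv w (star w)\<close>. A character trivial at \<open>a\<close> is orthogonal to
  \<open>w\<close>, so this idempotent yields a character that is not.\<close>

theorem ex_character_ne_1:
  fixes u :: "'k \<Rightarrow> complex"
  assumes u: "cont u" "u a \<noteq> u 0"
  obtains f where "cont f" "\<And>x y. f (x + y) = f x * f y" "\<And>x. norm (f x) = 1" "f a \<noteq> 1"
proof -
  define w where "w x = u x - u (x + a)" for x
  have cua: "cont (\<lambda>x. u (x + a))" by (intro cont_compose[OF u(1)] continuous_intros)
  have cw: "cont w" unfolding w_def[abs_def] by (intro continuous_intros u cua)
  define k where "k = conv w (star w)"
  have ck: "cont k" unfolding k_def by (intro cont_conv cont_star cw)
  have sk: "star k = k"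
    unfolding k_def using conv_commute[OF cw cont_star[OF cw]] by (simp add: star_conv cw cont_star)
  have "w 0 \<noteq> 0" using u(2) by (simp add: w_def)
  then have k0: "k 0 \<noteq> 0" unfolding k_def using conv_star_zero[OF cw] energy_pos[OF cw] by force
  obtain \<Lambda> e1 where e1: "\<Lambda> > 0" "cont e1" "star e1 = e1" "conv e1 e1 = e1" "e1 0 \<noteq> 0"
    "conv (conv k k) e1 = (\<lambda>x. of_real \<Lambda> * e1 x)"
    using spectral_idempotent[OF ck sk k0] by blast
  have "idempotent e1" using e1 by (auto simp: idempotent_def)
  then obtain e where e: "idempotent e" "conv e e1 = e" and min: "\<And>e'. idempotent e' \<Longrightarrow> conv e' e = e' \<Longrightarrow> e' = e"
    by (rule ex_minimal_idempotent) blast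
  have ce: "cont e" "star e = e" "conv e e = e" using e(1) by (auto simp: idempotent_def)
  have e0: "e 0 = of_real (energy e)" "energy e \<ge> 1" "\<And>x. norm (e x) \<le> energy e"
    using idempotent_at_zero[OF e(1)] by auto
  have e0': "e 0 \<noteq> 0" using e0(1,2) by auto
  have ke: "conv (conv k k) e = (\<lambda>x. of_real \<Lambda> * e x)"
  proof -
    have ckk: "cont (conv k k)" using ck by (intro cont_conv)
    have "conv (conv k k) e = conv (conv k k) (conv e1 e)" using e(2) conv_commute[OF ce(1) e1(2)] by simp
    also have "\<dots> = conv (\<lambda>x. of_real \<Lambda> * e1 x) e" using conv_assoc[OF ckk e1(2) ce(1)] e1(6) by simp
    also have "\<dots> = (\<lambda>x. of_real \<Lambda> * conv e1 e x)" by (rule conv_scale_left[OF ce(1) e1(2)])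
    finally show ?thesis using e(2) conv_commute[OF ce(1) e1(2)] by simp
  qed
  have trans: "conv (\<lambda>x. g (x + y)) e = (\<lambda>x. conv g e (x + y))" for g y
    by (simp add: conv_def[abs_def] algebra_simps)
  \<comment> \<open>Translating \<open>e\<close> gives a continuous function whose convolution with
    \<open>e\<close> is the same translate, hence a scalar multiple of \<open>e\<close>; evaluation
    at 0 identifies the scalar.\<close>
  have "e (x + y) * e 0 = e x * e y" for x y
  proof -
    have "cont (\<lambda>x. e (x + y))" by (intro cont_compose[OF ce(1)] continuous_intros)
    then obtain \<mu> where "conv (\<lambda>x. e (x + y)) e = (\<lambda>x. \<mu> * e x)"
      using minimal_idempotent_eigen[OF e(1) min] by blast
    then have \<mu>: "e (x + y) = \<mu> * e x" for x using trans[of e y] ce(3) by (simp add: fun_eq_iff)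
    show ?thesis using \<mu>[of x] \<mu>[of 0] by simp
  qed
  then have mult: "e (x + y) / e 0 = (e x / e 0) * (e y / e 0)" for x y
    using e0' by (simp add: field_simps)
  have le1: "norm (e x / e 0) \<le> 1" for x using e0 by (simp add: norm_divide)
  have norm1: "norm (e x / e 0) = 1" for x
  proof -
    have "(e x / e 0) * (e (- x) / e 0) = 1" using mult[of x "- x"] e0' by simp
    then have "norm (e x / e 0) * norm (e (- x) / e 0) = 1" by (metis norm_mult norm_one)
    moreover have "norm (e x / e 0) * norm (e (- x) / e 0) \<le> norm (e x / e 0) * 1"
      by (intro mult_left_mono le1) simp
    ultimately show ?thesis using le1[of x] by simp
  qed
  \<comment> \<open>Otherwise \<open>e\<close> has period \<open>a\<close>, so convolving
    \<open>u\<close> and its translate with \<open>e\<close> gives the same result; then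
    \<open>w\<close> and \<open>k\<close> are annihilated, although \<open>conv k k\<close> acts on
    \<open>e\<close> as the positive scalar \<open>\<Lambda>\<close>.\<close>
  have "e a / e 0 \<noteq> 1"
  proof
    assume "e a / e 0 = 1"
    then have inv: "e (x + a) = e x" for x using mult[of x a] e0' by (simp add: field_simps)
    have "conv (\<lambda>x. u (x + a)) e = (\<lambda>x. conv u e (x + a))" by (rule trans)
    moreover have "conv u e (x + a) = conv u e x" for x
    proof -
      have "conv u e (x + a) = conv e u (x + a)" by (simp only: conv_commute[OF u(1) ce(1)])
      also have "\<dots> = mean (\<lambda>y. e (x - y + a) * u y)" by (simp add: conv_def algebra_simps)
      also have "\<dots> = conv e u x" by (simp add: inv conv_def)
      finally show ?thesis by (simp only: conv_commute[OF u(1) ce(1)])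
    qed
    ultimately have "conv w e = (\<lambda>x. 0)"
      using conv_diff_left[OF ce(1) u(1) cua] by (simp add: w_def[abs_def])
    then have "conv (star w) (conv w e) = (\<lambda>x. 0)" by (simp add: conv_def[abs_def] mean_eqI[OF has_mean_const])
    then have "conv k e = (\<lambda>x. 0)"
      unfolding k_def conv_commute[OF cw cont_star[OF cw]]
      by (simp add: conv_assoc[OF cont_star[OF cw] cw ce(1)])
    then have "conv (conv k k) e = (\<lambda>x. 0)"
      by (simp add: conv_assoc[OF ck ck ce(1)]) (simp add: conv_def[abs_def] mean_eqI[OF has_mean_const])
    then show False using fun_cong[OF ke, of 0] e1(1) e0' by simp
  qed
  moreover have "cont (\<lambda>x. e x / e 0)" by (intro continuous_intros ce) (simp add: e0')
  ultimately show thesis using that[of "\<lambda>x. e x / e 0"] mult norm1 by blast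
qed

end

section \<open>The bridge theorem\<close>

text \<open>Compact Hausdorff spaces are normal, so Urysohn's lemma supplies a continuous function
  that distinguishes \<open>k\<close> from 0.\<close>

lemma ex_character_separating:
  fixes k :: "'k::{topological_ab_group_add, t2_space}"
  assumes compact: "compact (UNIV :: 'k set)" and k: "k \<noteq> 0"
  shows "\<exists>\<xi>. circle_exp (character \<xi> k) \<noteq> 1"
proof -
  interpret compact_abelian_group "TYPE('k)" using compact by unfold_locales
  have "Hausdorff_space (euclidean :: 'k topology)"
    unfolding Hausdorff_space_def
  proof (intro allI impI)
    fix x y :: 'k assume "x \<in> topspace euclidean \<and> y \<in> topspace euclidean \<and> x \<noteq> y"
    then obtain U V where "open U" "open V" "x \<in> U" "y \<in> V" "U \<inter> V = {}" using hausdorff[of x y] by auto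
    then show "\<exists>U V. openin euclidean U \<and> openin euclidean V \<and> x \<in> U \<and> y \<in> V \<and> disjnt U V"
      by (intro exI[of _ U] exI[of _ V]) (simp add: disjnt_def)
  qed
  moreover have "compact_space (euclidean :: 'k topology)" using compact by (simp add: compact_space_def)
  ultimately have "normal_space (euclidean :: 'k topology)"
    by (intro compact_Hausdorff_or_regular_imp_normal_space) auto
  then obtain g where g: "continuous_map euclidean euclideanreal g" "g ` {0 :: 'k} \<subseteq> {0}" "g ` {k} \<subseteq> {1}"
    by (rule Urysohn_lemma_alt[of euclidean "{0 :: 'k}" "{k}" 0 1]) (use k in \<open>auto simp: disjnt_def\<close>)
  define u where "u x = complex_of_real (g x)" for x
  have "continuous_on UNIV g" using g(1) by simp
  then have "cont u" unfolding u_def by (intro continuous_intros)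
  moreover have "u k \<noteq> u 0" using g(2,3) by (simp add: u_def)
  ultimately obtain f where f: "cont f" "\<And>x y. f (x + y) = f x * f y" "\<And>x. norm (f x) = 1" "f k \<noteq> 1"
    by (rule ex_character_ne_1) blast
  obtain \<xi> :: "'k dual" where "\<And>x. circle_exp (character \<xi> x) = f x"
    using circle_character_of_complex[OF f(2,3,1)] by blast
  then have "circle_exp (character \<xi> k) \<noteq> 1" using f(4) by simp
  then show ?thesis ..
qed

lemma ex_character_discrete:
  fixes x :: "'x::{topological_ab_group_add, discrete_topology}"
  assumes "x \<noteq> 0"
  shows "\<exists>\<xi>. circle_exp (character \<xi> x) \<noteq> 1"
proof -
  obtain \<phi> :: "'x \<Rightarrow> circle" where \<phi>: "Modules.additive \<phi>" "\<phi> x \<noteq> 0"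
    using ex_additive_nonzero[OF assms] by (elim exE conjE)
  have "character (Abs_dual \<phi>) = \<phi>" using \<phi>(1) by (intro Abs_dual_inverse) simp
  then have "circle_exp (character (Abs_dual \<phi>) x) \<noteq> 1" using \<phi>(2) by (simp add: circle_exp_eq_1_iff)
  then show ?thesis ..
qed

lemma dual_eq_zeroI:
  assumes "\<And>x. circle_exp (character \<xi> x) = 1"
  shows "\<xi> = 0"
proof -
  have "character \<xi> = character 0"
    using assms by (simp add: fun_eq_iff zero_dual.rep_eq circle_exp_eq_1_iff)
  then show ?thesis by (simp only: character_inject)
qed

lemma circle_exp_character_add:
  "circle_exp (character \<xi> (x + y)) = circle_exp (character \<xi> x) * circle_exp (character \<xi> y)"
  using additive_character[of \<xi>] by (simp add: Modules.additive_def circle_exp_add)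

lemma circle_exp_plus_dual:
  "circle_exp (character (\<xi> + \<psi>) x) = circle_exp (character \<xi> x) * circle_exp (character \<psi> x)"
  by (simp add: plus_dual.rep_eq circle_exp_add)

theorem mainTheorem2:
  fixes \<rho> :: "'s::monoid_mult \<Rightarrow> 'k::{topological_ab_group_add, t2_space} \<Rightarrow> 'k"
    and l :: "'s \<Rightarrow> 'x::{topological_ab_group_add, discrete_topology} \<Rightarrow> 'x"
  assumes left_cancel: "\<And>a b c :: 's. a * b = a * c \<Longrightarrow> b = c"
    and right_cancel: "\<And>a b c :: 's. b * a = c * a \<Longrightarrow> b = c"
    and amenable: "right_amenable TYPE('s)"
    and compact: "compact (UNIV :: 'k set)"
    and right: "right_action \<rho>"
    and left: "left_action l"
  shows "h_top \<rho> = h_alg (dual_action \<rho>) \<and> h_alg l = h_top (dual_action l)"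
proof
  have \<rho>: "Modules.additive (\<rho> s)" "continuous_on UNIV (\<rho> s)" "\<rho> (s * t) = \<rho> t \<circ> \<rho> s" for s t
    using right by (auto simp: right_action_def)
  have ch\<rho>: "character (dual_action \<rho> s \<xi>) = character \<xi> \<circ> \<rho> s" for s \<xi>
    unfolding dual_action_def by (rule character_dual_map[OF \<rho>(1,2)])
  interpret K: dual_pair \<rho> "dual_action \<rho>" "\<lambda>\<xi> k. circle_exp (character \<xi> k)"
  proof
    show "left_action (dual_action \<rho>)" by (rule left_action_dual_action[OF right])
    show "continuous_on UNIV (\<lambda>k. circle_exp (character \<xi> k))" for \<xi> :: "'k dual"
      by (rule continuous_on_compose2[OF continuous_circle_exp continuous_character]) auto
    show "k = 0" if "\<And>\<xi>. circle_exp (character \<xi> k) = 1" for k :: 'k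
      using ex_character_separating[OF compact, of k] that by auto
    show "circle_exp (character (dual_action \<rho> s \<xi>) k) = circle_exp (character \<xi> (\<rho> s k))" for s \<xi> k
      by (simp add: ch\<rho>)
    show "b = c" if "a * b = a * c" for a b c :: 's by (rule left_cancel[OF that])
    show "b = c" if "b * a = c * a" for a b c :: 's by (rule right_cancel[OF that])
    show "right_amenable TYPE('s)" by (rule amenable)
    show "compact (UNIV :: 'k set)" by (rule compact)
    show "continuous_on UNIV (\<rho> s)" "\<rho> (s * t) = \<rho> t \<circ> \<rho> s" for s t by (rule \<rho>)+
    show "\<xi> = 0" if "\<And>k. circle_exp (character \<xi> k) = 1" for \<xi> :: "'k dual" by (rule dual_eq_zeroI[OF that])
  qed (simp_all add: circle_exp_character_add circle_exp_plus_dual norm_circle_exp)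
  show "h_top \<rho> = h_alg (dual_action \<rho>)" by (rule K.h_top_eq_h_alg)
  have l: "Modules.additive (l s)" "continuous_on UNIV (l s)" "l (s * t) = l s \<circ> l t" for s t
    using left by (auto simp: left_action_def)
  have chl: "character (dual_action l s \<xi>) = character \<xi> \<circ> l s" for s \<xi>
    unfolding dual_action_def by (rule character_dual_map[OF l(1,2)])
  interpret X: dual_pair "dual_action l" l "\<lambda>x \<xi>. circle_exp (character \<xi> x)"
  proof
    show "continuous_on UNIV (dual_action l s)" for s
      unfolding dual_action_def by (rule continuous_dual_map[OF l(1,2)])
    show "dual_action l (s * t) = dual_action l t \<circ> dual_action l s" for s t
      by (simp add: fun_eq_iff character_inject[symmetric] chl l(3))
    show "continuous_on UNIV (\<lambda>\<xi>. circle_exp (character \<xi> x))" for x :: 'x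
      by (rule continuous_on_compose2[OF continuous_circle_exp continuous_evaluation]) auto
    show "x = 0" if "\<And>\<xi>. circle_exp (character \<xi> x) = 1" for x :: 'x
      using ex_character_discrete[of x] that by auto
    show "compact (UNIV :: 'x dual set)" by (rule compact_dual_discrete)
    show "b = c" if "a * b = a * c" for a b c :: 's by (rule left_cancel[OF that])
    show "b = c" if "b * a = c * a" for a b c :: 's by (rule right_cancel[OF that])
    show "right_amenable TYPE('s)" by (rule amenable)
    show "left_action l" by (rule left)
    show "\<xi> = 0" if "\<And>x. circle_exp (character \<xi> x) = 1" for \<xi> :: "'x dual" by (rule dual_eq_zeroI[OF that])
  qed (simp_all add: circle_exp_character_add circle_exp_plus_dual norm_circle_exp chl)
  show "h_alg l = h_top (dual_action l)" by (rule X.h_top_eq_h_alg[symmetric])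
qed

end
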